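(* Let $\mathcal A\in Sp(2d,\mathbb R)$ be covariant, and let $$B_{\mathcal A}=\begin{pmatrix}A_{13}&\tfrac12 I_{d\times d}-A_{11}\\ \tfrac12 I_{d\times d}-A_{11}^T&-A_{21}\end{pmatrix}.$$ Then, up to a constant factor of modulus one, $$W_{\mathcal A}(f,g)=W(f,g)\ast\sigma_{\mathcal A},\qquad f,g\in\mathcal S(\mathbb R^d),$$ where $\sigma_{\mathcal A}=\mathcal F^{-1}\big(e^{-\pi i\zeta\cdot B_{\mathcal A}\zeta}\big)\in\mathcal S'(\mathbb R^{2d})$.
   Context: A matrix $\mathcal A\in Sp(2d,\mathbb R)$ is covariant if, in $d\times d$ blocks, $\mathcal A=\begin{pmatrix}A_{11}&I-A_{11}&A_{13}&A_{13}\\ A_{21}&-A_{21}&I-A_{11}^T&-A_{11}^T\\ 0&0&I&I\\ -I&I&0&0\end{pmatrix}$ with $A_{13},A_{21}$ symmetric. The metaplectic representation $\mu$ assigns to $\mathcal A\in Sp(n,\mathbb R)$ (symplectic w.r.t. $J=\begin{pmatrix}0&I_n\\-I_n&0\end{pmatrix}$) a unitary operator on $L^2(\mathbb R^n)$, extended to $\mathcal S,\mathcal S'$, defined up to a unimodular constant (standard normalization: $\mu(J)$ = Fourier transform, $\mu\begin{pmatrix}M^{-1}&0\\0&M^T\end{pmatrix}F(x)=|\det M|^{1/2}F(Mx)$, $\mu\begin{pmatrix}I&C\\0&I\end{pmatrix}F(x)=e^{i\pi Cx\cdot x}F(x)$, up to unimodular constants). $W_{\mathcal A}(f,g)=\mu(\mathcal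 A)(f\otimes\bar g)$, $(f\otimes\bar g)(x,y)=f(x)\overline{g(y)}$. The cross-Wigner distribution is $W(f,g)(x,\xi)=\int f(x+\tfrac t2)\overline{g(x-\tfrac t2)}e^{-2\pi i t\cdot\xi}dt$. $\mathcal F F(\zeta)=\int F(z)e^{-2\pi i z\cdot\zeta}dz$.
   Formalization: The chirp e^{iπCx·x} is assigned to the lower-triangular matrix (I 0; C I), not the upper-triangular one of the stated normalization, which contradicts the dilation rule (take M=2I, C=I); μ(A) is the usual metaplectic operator, given by its intertwining relation. *)

theory Defs
  imports "HOL-Analysis.Analysis"
begin

definition fstv :: "real^('a::finite + 'b::finite) \<Rightarrow> real^'a" where
  "fstv z = (\<chi> i. z $ Inl i)"

definition sndv :: "real^('a::finite + 'b::finite) \<Rightarrow> real^'b" where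
  "sndv z = (\<chi> i. z $ Inr i)"

fun dderiv :: "'a::euclidean_space list \<Rightarrow> ('a \<Rightarrow> complex) \<Rightarrow> 'a \<Rightarrow> complex" where
  "dderiv [] f = f"
| "dderiv (v # vs) f = (\<lambda>x. frechet_derivative (dderiv vs f) (at x) v)"

definition schwartz :: "('a::euclidean_space \<Rightarrow> complex) \<Rightarrow> bool" where
  "schwartz f \<longleftrightarrow>
     (\<forall>vs. \<forall>x. dderiv vs f differentiable (at x)) \<and>
     (\<forall>vs. \<forall>k::nat. \<exists>C. \<forall>x. (1 + norm x) ^ k * norm (dderiv vs f x) \<le> C)"

definition fourier :: "(real^'n::finite \<Rightarrow> complex) \<Rightarrow> real^'n \<Rightarrow> complex" where
  "fourier F \<zeta> = (\<integral>z. F z * exp (- 2 * complex_of_real pi * \<i> * complex_of_real (z \<bullet> \<zeta>)) \<partial>lborel)"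

definition inv_fourier :: "(real^'n::finite \<Rightarrow> complex) \<Rightarrow> real^'n \<Rightarrow> complex" where
  "inv_fourier F z = (\<integral>\<zeta>. F \<zeta> * exp (2 * complex_of_real pi * \<i> * complex_of_real (z \<bullet> \<zeta>)) \<partial>lborel)"

definition wigner :: "(real^'d::finite \<Rightarrow> complex) \<Rightarrow> (real^'d \<Rightarrow> complex) \<Rightarrow> real^('d + 'd) \<Rightarrow> complex" where
  "wigner f g w = (\<integral>t. f (fstv w + (1/2) *\<^sub>R t) * cnj (g (fstv w - (1/2) *\<^sub>R t))
        * exp (- 2 * complex_of_real pi * \<i> * complex_of_real (t \<bullet> sndv w)) \<partial>lborel)"

definition tensor_conj :: "(real^'d::finite \<Rightarrow> complex) \<Rightarrow> (real^'d \<Rightarrow> complex) \<Rightarrow> real^('d + 'd) \<Rightarrow> complex" where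
  "tensor_conj f g z = f (fstv z) * cnj (g (sndv z))"

text \<open>The inverse Fourier transform of the tempered distribution given by the bounded
  smooth function m: its action on a test function psi is
  the integral of m times the inverse Fourier transform of psi.\<close>
definition inv_fourier_distr :: "(real^'n::finite \<Rightarrow> complex) \<Rightarrow> (real^'n \<Rightarrow> complex) \<Rightarrow> complex" where
  "inv_fourier_distr m \<psi> = (\<integral>\<zeta>. m \<zeta> * inv_fourier \<psi> \<zeta> \<partial>lborel)"

definition conv_distr :: "(real^'n::finite \<Rightarrow> complex) \<Rightarrow> ((real^'n \<Rightarrow> complex) \<Rightarrow> complex) \<Rightarrow> real^'n \<Rightarrow> complex" where
  "conv_distr \<phi> \<sigma> x = \<sigma> (\<lambda>y. \<phi> (x - y))"

definition Jmat :: "real^('n::finite + 'n)^('n + 'n)" where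
  "Jmat = (\<chi> r c. case r of Inl i \<Rightarrow> (if c = Inr i then 1 else 0)
                          | Inr i \<Rightarrow> (if c = Inl i then -1 else 0))"

definition symplectic :: "real^('n::finite + 'n)^('n + 'n) \<Rightarrow> bool" where
  "symplectic A \<longleftrightarrow> transpose A ** Jmat ** A = Jmat"

definition L2 :: "(real^'n::finite \<Rightarrow> complex) \<Rightarrow> bool" where
  "L2 F \<longleftrightarrow> F \<in> borel_measurable lborel \<and> integrable lborel (\<lambda>x. (cmod (F x))^2)"

text \<open>Symmetric time-frequency shift (Schroedinger representation):
  rho(p,q) F(t) = exp(-pi i p.q) exp(2 pi i q.t) F(t - p).\<close>
definition rho :: "real^('n::finite + 'n) \<Rightarrow> (real^'n \<Rightarrow> complex) \<Rightarrow> real^'n \<Rightarrow> complex" where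
  "rho w F t = exp (- complex_of_real pi * \<i> * complex_of_real (fstv w \<bullet> sndv w))
     * exp (2 * complex_of_real pi * \<i> * complex_of_real (sndv w \<bullet> t)) * F (t - fstv w)"

text \<open>U is a metaplectic operator mu(A) (any choice of the phase): a unitary operator on
  L^2 (acting on representatives, compatible with a.e. equality) satisfying
  mu(A) rho(w) = rho(A w) mu(A) for all w.  By Stone--von Neumann/Schur this
  determines mu(A) up to a unimodular constant.\<close>
definition metaplectic_op :: "real^('n::finite + 'n)^('n + 'n)
     \<Rightarrow> ((real^'n \<Rightarrow> complex) \<Rightarrow> (real^'n \<Rightarrow> complex)) \<Rightarrow> bool" where
  "metaplectic_op A U \<longleftrightarrow>
     (\<forall>F. L2 F \<longrightarrow> L2 (U F)) \<and>
     (\<forall>F G. L2 F \<longrightarrow> L2 G \<longrightarrow> (AE x in lborel. F x = G x) \<longrightarrow> (AE x in lborel. U F x = U G x)) \<and>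
     (\<forall>F G c. L2 F \<longrightarrow> L2 G \<longrightarrow> (AE x in lborel. U (\<lambda>y. F y + c * G y) x = U F x + c * U G x)) \<and>
     (\<forall>F. L2 F \<longrightarrow> (\<integral>x. (cmod (U F x))^2 \<partial>lborel) = (\<integral>x. (cmod (F x))^2 \<partial>lborel)) \<and>
     (\<forall>G. L2 G \<longrightarrow> (\<exists>F. L2 F \<and> (AE x in lborel. U F x = G x))) \<and>
     (\<forall>w F. L2 F \<longrightarrow> (AE x in lborel. U (rho w F) x = rho (A *v w) (U F) x))"

fun blk2 :: "'d + 'd \<Rightarrow> nat" where "blk2 (Inl i) = 0" | "blk2 (Inr i) = 1"
fun pos2 :: "'d + 'd \<Rightarrow> 'd" where "pos2 (Inl i) = i" | "pos2 (Inr i) = i"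

fun blk4 :: "('d + 'd) + ('d + 'd) \<Rightarrow> nat" where
  "blk4 (Inl k) = blk2 k" | "blk4 (Inr k) = 2 + blk2 k"
fun pos4 :: "('d + 'd) + ('d + 'd) \<Rightarrow> 'd" where
  "pos4 (Inl k) = pos2 k" | "pos4 (Inr k) = pos2 k"

text \<open>The 4x4 block matrix in d x d blocks, block rows/columns ordered (x, y, xi, eta).\<close>
definition cov_matrix :: "real^'d::finite^'d \<Rightarrow> real^'d^'d \<Rightarrow> real^'d^'d
     \<Rightarrow> real^(('d + 'd) + ('d + 'd))^(('d + 'd) + ('d + 'd))" where
  "cov_matrix A11 A13 A21 =
    (let I = (mat 1 :: real^'d^'d);
         Bs = [[A11, I - A11, A13, A13],
               [A21, - A21, I - transpose A11, - transpose A11],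
               [0, 0, I, I],
               [- I, I, 0, 0]]
     in (\<chi> r c. ((Bs ! blk4 r) ! blk4 c) $ pos4 r $ pos4 c))"

definition B_cov :: "real^'d::finite^'d \<Rightarrow> real^'d^'d \<Rightarrow> real^'d^'d \<Rightarrow> real^('d + 'd)^('d + 'd)" where
  "B_cov A11 A13 A21 =
    (let H = (mat (1/2) :: real^'d^'d);
         Bs = [[A13, H - A11], [H - transpose A11, - A21]]
     in (\<chi> r c. ((Bs ! blk2 r) ! blk2 c) $ pos2 r $ pos2 c))"

definition sigma_cov :: "real^'d::finite^'d \<Rightarrow> real^'d^'d \<Rightarrow> real^'d^'d
     \<Rightarrow> (real^('d + 'd) \<Rightarrow> complex) \<Rightarrow> complex" where
  "sigma_cov A11 A13 A21 = inv_fourier_distr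
     (\<lambda>\<zeta>. exp (- complex_of_real pi * \<i> * complex_of_real (\<zeta> \<bullet> (B_cov A11 A13 A21 *v \<zeta>))))"

end

theory Submission
  imports Defs "HOL-Probability.Probability"
begin

text \<open>The Fourier transform of the Wigner distribution is the ambiguity function, so the convolution
  is the map T that multiplies the ambiguity function by a chirp and transforms back. Plancherel's
  theorem makes T isometric on tensor products, and a computation on phase-space shifts shows
  that T, like U, intertwines \<open>\<rho>(w)\<close> with \<open>\<rho>(A w)\<close>. Only the following instance of Schur's lemma is
  needed to compare the two. The matrix coefficients satisfy
  \<open>\<langle>UF, \<rho>(A w) UG\<rangle> = \<langle>F, \<rho>(w) G\<rangle> = \<langle>TF, \<rho>(A w) TG\<rangle>\<close>. Multiplying the first by the conjugate of the last,
  integrating over w (A preserves volume) and applying Moyal's identity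
  gives \<open>\<langle>UF, TF\<rangle> * cnj \<langle>UG, TG\<rangle> = \<parallel>F\<parallel>\<^sup>2 * \<parallel>G\<parallel>\<^sup>2\<close>. Hence \<open>\<langle>UF, TF\<rangle> = c * \<parallel>F\<parallel>\<^sup>2\<close> with one unimodular c
  for all tensor products F, which is the equality case of the Cauchy-Schwarz inequality.\<close>

text \<open>T is available only on tensor products, so it cannot be composed with the inverse of U
  to give an operator commuting with all shifts. Comparing matrix coefficients needs only individual
  vectors.

  The vectors UF are merely square integrable and fixed almost everywhere. This makes Moyal's
  identity asymmetric: one pair is arbitrary in L^2, while the other is continuous and bounded with
  integrable coefficients. T supplies the regular pair.

  All Fourier transforms are absolutely convergent integrals, so ambiguity functions, Wigner
  distributions and matrix coefficients must be shown integrable. For Schwartz functions the three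
  decay estimates are one estimate, for the product \<open>sesq\<close> with three choices of
  coefficients. The intertwining relation of T, in turn, is proved for bounded continuous integrable
  functions with integrable ambiguity function, a class visibly stable under phase-space shifts.

  Changes of variables are composed of shears, reflections and coordinate permutations, so volume
  preservation never requires a determinant.\<close>

section \<open>Maps preserving Lebesgue measure\<close>

definition lborel_preserving :: "('a::euclidean_space \<Rightarrow> 'b::euclidean_space) \<Rightarrow> bool" where
  "lborel_preserving T \<longleftrightarrow> T \<in> borel_measurable borel \<and> distr lborel borel T = lborel"

lemma lborel_preserving_measurable [measurable_dest]:
  "lborel_preserving T \<Longrightarrow> T \<in> borel_measurable borel"
  by (simp add: lborel_preserving_def)

lemma lborel_preserving_compose:
  assumes "lborel_preserving S" "lborel_preserving T"
  shows "lborel_preserving (\<lambda>x. S (T x))"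
proof -
  have [measurable]: "S \<in> borel_measurable borel" "T \<in> borel_measurable borel"
    using assms by (auto simp: lborel_preserving_def)
  have "distr lborel borel (\<lambda>x. S (T x)) = distr (distr lborel borel T) borel S"
    by (simp add: distr_distr o_def)
  then show ?thesis
    using assms by (simp add: lborel_preserving_def)
qed

lemma lborel_preserving_integrable_iff:
  fixes f :: "'b::euclidean_space \<Rightarrow> 'c::{banach, second_countable_topology}"
  assumes T: "lborel_preserving (T :: 'a::euclidean_space \<Rightarrow> 'b)" and f: "f \<in> borel_measurable borel"
  shows "integrable lborel (\<lambda>x. f (T x)) \<longleftrightarrow> integrable lborel f"
  using integrable_distr_eq[of T lborel borel f] T f by (simp add: lborel_preserving_def)

lemma lborel_preserving_integral:
  fixes f :: "'b::euclidean_space \<Rightarrow> 'c::{banach, second_countable_topology}"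
  assumes T: "lborel_preserving (T :: 'a::euclidean_space \<Rightarrow> 'b)" and f: "f \<in> borel_measurable borel"
  shows "(\<integral>x. f (T x) \<partial>lborel) = (\<integral>x. f x \<partial>lborel)"
  using integral_distr[of T lborel borel f] T f by (simp add: lborel_preserving_def)

lemma lborel_preserving_integrable:
  fixes f :: "'b::euclidean_space \<Rightarrow> 'c::{banach, second_countable_topology}"
  assumes T: "lborel_preserving (T :: 'a::euclidean_space \<Rightarrow> 'b)" and f: "integrable lborel f"
  shows "integrable lborel (\<lambda>x. f (T x))"
  using lborel_preserving_integrable_iff[OF T, of f] f borel_measurable_integrable[OF f] by simp

lemma lborel_preserving_affine:
  fixes t :: "'a::euclidean_space"
  assumes "\<bar>c\<bar> = 1"
  shows "lborel_preserving (\<lambda>x. t + c *\<^sub>R x)"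
  using lborel_affine[of c t] assms by (auto simp: lborel_preserving_def density_1)

lemma lborel_preserving_add: "lborel_preserving (\<lambda>x::'a::euclidean_space. x + t)"
  using lborel_preserving_affine[of 1 t] by (simp add: add.commute)

lemma lborel_preserving_diff: "lborel_preserving (\<lambda>x::'a::euclidean_space. x - t)"
  using lborel_preserving_add[of "-t"] by simp

lemma lborel_preserving_uminus: "lborel_preserving (\<lambda>x::'a::euclidean_space. - x)"
  using lborel_preserving_affine[of "-1" "0::'a"] by simp

lemma prod_Basis_vec: "(\<Prod>b\<in>Basis. f b) = (\<Prod>i\<in>UNIV. f (axis i (1::real)))"
proof -
  have *: "(Basis :: (real^'n) set) = (\<lambda>i. axis i 1) ` UNIV"
    by (auto simp: Basis_vec_def)
  show ?thesis
    unfolding * by (subst prod.reindex) (auto simp: inj_on_def axis_eq_axis)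
qed

lemma emeasure_lborel_box_vec:
  fixes l u :: "real^'n"
  assumes "\<And>i. l $ i \<le> u $ i"
  shows "emeasure lborel (box l u) = ennreal (\<Prod>i\<in>UNIV. u $ i - l $ i)"
  using assms
  by (subst emeasure_lborel_box)
     (auto simp: prod_Basis_vec inner_axis, auto simp: Basis_vec_def inner_axis)

lemma lborel_vec_eqI:
  fixes M :: "(real^'n) measure"
  assumes "\<And>l u. (\<And>i. l $ i \<le> u $ i) \<Longrightarrow> emeasure M (box l u) = ennreal (\<Prod>i\<in>UNIV. u $ i - l $ i)"
    and "sets M = sets borel"
  shows "M = lborel"
proof (rule lborel_eqI[symmetric])
  fix l u :: "real^'n"
  assume "\<And>b. b \<in> Basis \<Longrightarrow> l \<bullet> b \<le> u \<bullet> b"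
  then have "l $ i \<le> u $ i" for i
    using axis_in_Basis_iff[of i "1::real"] by (metis inner_axis inner_real_def mult.right_neutral Basis_real_def singletonI)
  then show "emeasure M (box l u) = ennreal (\<Prod>b\<in>Basis. (u - l) \<bullet> b)"
    by (simp add: assms(1) prod_Basis_vec inner_axis)
qed fact

section \<open>Block vectors and Fubini's theorem\<close>

definition joinv :: "real^'a \<Rightarrow> real^'b \<Rightarrow> real^('a::finite + 'b::finite)" where
  "joinv x y = (\<chi> k. case k of Inl i \<Rightarrow> x $ i | Inr j \<Rightarrow> y $ j)"

lemma joinv_nth [simp]: "joinv x y $ Inl i = x $ i" "joinv x y $ Inr j = y $ j"
  by (simp_all add: joinv_def)

lemma fstv_nth [simp]: "fstv z $ i = z $ Inl i" and sndv_nth [simp]: "sndv z $ j = z $ Inr j"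
  by (simp_all add: fstv_def sndv_def)

lemma fstv_joinv [simp]: "fstv (joinv x y) = x" and sndv_joinv [simp]: "sndv (joinv x y) = y"
  by (simp_all add: vec_eq_iff)

lemma joinv_eqI: "fstv z = x \<Longrightarrow> sndv z = y \<Longrightarrow> z = joinv x y"
  by (simp add: vec_eq_iff split_sum_all)

lemma joinv_fstv_sndv [simp]: "joinv (fstv z) (sndv z) = z"
  by (rule joinv_eqI[symmetric]) simp_all

lemma joinv_eq_iff: "z = w \<longleftrightarrow> fstv z = fstv w \<and> sndv z = sndv w"
  by (metis joinv_fstv_sndv)

lemma fstv_simps [simp]: "fstv (z + w) = fstv z + fstv w" "fstv (z - w) = fstv z - fstv w"
    "fstv (- z) = - fstv z" "fstv (c *\<^sub>R z) = c *\<^sub>R fstv z" "fstv 0 = 0"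
  and sndv_simps [simp]: "sndv (z + w) = sndv z + sndv w" "sndv (z - w) = sndv z - sndv w"
    "sndv (- z) = - sndv z" "sndv (c *\<^sub>R z) = c *\<^sub>R sndv z" "sndv 0 = 0"
  by (simp_all add: vec_eq_iff)

lemma continuous_on_fstv [continuous_intros]:
    "continuous_on S f \<Longrightarrow> continuous_on S (\<lambda>x. fstv (f x))"
  and continuous_on_sndv [continuous_intros]:
    "continuous_on S f \<Longrightarrow> continuous_on S (\<lambda>x. sndv (f x))"
  by (auto simp: fstv_def sndv_def intro!: continuous_intros continuous_on_vec_lambda)

lemma continuous_on_joinv [continuous_intros]:
  assumes "continuous_on S f" "continuous_on S g"
  shows "continuous_on S (\<lambda>x. joinv (f x) (g x))"
  unfolding joinv_def
proof (rule continuous_on_vec_lambda)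
  show "continuous_on S (\<lambda>x. case k of Inl i \<Rightarrow> f x $ i | Inr j \<Rightarrow> g x $ j)" for k
    using assms by (cases k) (auto intro!: continuous_intros)
qed

lemma measurable_fstv [measurable]: "fstv \<in> borel_measurable borel"
  and measurable_sndv [measurable]: "sndv \<in> borel_measurable borel"
  by (auto intro!: borel_measurable_continuous_onI continuous_intros)

lemma measurable_joinv [measurable (raw)]:
  assumes [measurable]: "f \<in> borel_measurable M" "g \<in> borel_measurable M"
  shows "(\<lambda>x. joinv (f x) (g x)) \<in> borel_measurable M"
proof -
  have "(\<lambda>z. joinv (fst z) (snd z)) \<in> borel_measurable (borel \<Otimes>\<^sub>M borel)"
    unfolding borel_prod by (intro borel_measurable_continuous_onI continuous_intros)
  from measurable_compose[OF _ this, of "\<lambda>x. (f x, g x)"] show ?thesis by simp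
qed

lemma inner_joinv: "joinv x y \<bullet> joinv x' y' = x \<bullet> x' + y \<bullet> y'"
  by (simp add: inner_vec_def UNIV_Plus_UNIV[symmetric] sum.Plus del: UNIV_Plus_UNIV)

lemma inner_sumv: "z \<bullet> w = fstv z \<bullet> fstv w + sndv z \<bullet> sndv w"
  by (metis inner_joinv joinv_fstv_sndv)

text \<open>The volume of a box is the product of the volumes of its two blocks. This identifies
  vectors indexed by a sum type with pairs, so that Fubini's theorem for product measures applies to
  them.\<close>

lemma lborel_joinv:
  "distr (lborel \<Otimes>\<^sub>M lborel) borel (\<lambda>(x, y). joinv x y) = (lborel :: (real^('a::finite + 'b::finite)) measure)"
proof (rule lborel_vec_eqI)
  fix l u :: "real^('a + 'b)"
  assume le: "\<And>k. l $ k \<le> u $ k"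
  have [measurable]: "(\<lambda>(x, y). joinv x y) \<in> borel_measurable (borel \<Otimes>\<^sub>M borel)"
    by measurable
  have "(\<lambda>(x, y). joinv x y) -` box l u = box (fstv l) (fstv u) \<times> box (sndv l) (sndv u)"
    by (auto simp: mem_box_cart split_sum_all)
  then have "emeasure (distr (lborel \<Otimes>\<^sub>M lborel) borel (\<lambda>(x, y). joinv x y)) (box l u)
      = emeasure (lborel \<Otimes>\<^sub>M lborel) (box (fstv l) (fstv u) \<times> box (sndv l) (sndv u))"
    by (subst emeasure_distr) (auto simp: space_pair_measure)
  also have "\<dots> = ennreal (\<Prod>i\<in>UNIV. u $ Inl i - l $ Inl i) * ennreal (\<Prod>i\<in>UNIV. u $ Inr i - l $ Inr i)"
    by (subst lborel.emeasure_pair_measure_Times) (auto simp: emeasure_lborel_box_vec le)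
  also have "\<dots> = ennreal (\<Prod>i\<in>UNIV. u $ i - l $ i)"
    by (subst ennreal_mult[symmetric])
       (auto simp: UNIV_Plus_UNIV[symmetric] prod.Plus le intro!: prod_nonneg simp del: UNIV_Plus_UNIV)
  finally show "emeasure (distr (lborel \<Otimes>\<^sub>M lborel) borel (\<lambda>(x, y). joinv x y)) (box l u)
      = ennreal (\<Prod>i\<in>UNIV. u $ i - l $ i)" .
qed simp

lemma integrable_joinv_iff:
  fixes f :: "real^('a::finite + 'b::finite) \<Rightarrow> 'c::{banach, second_countable_topology}"
  assumes [measurable]: "f \<in> borel_measurable borel"
  shows "integrable lborel f \<longleftrightarrow> integrable (lborel \<Otimes>\<^sub>M lborel) (\<lambda>(x, y). f (joinv x y))"
proof -
  have [measurable]: "(\<lambda>(x, y). joinv x y) \<in> borel_measurable (lborel \<Otimes>\<^sub>M lborel)"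
    by measurable
  show ?thesis
    by (subst lborel_joinv[symmetric], subst integrable_distr_eq) (auto simp: case_prod_unfold)
qed

lemma integral_joinv:
  fixes f :: "real^('a::finite + 'b::finite) \<Rightarrow> 'c::{banach, second_countable_topology}"
  assumes f: "integrable lborel f"
  shows "(\<integral>z. f z \<partial>lborel) = (\<integral>x. \<integral>y. f (joinv x y) \<partial>lborel \<partial>lborel)"
    and "(\<integral>z. f z \<partial>lborel) = (\<integral>y. \<integral>x. f (joinv x y) \<partial>lborel \<partial>lborel)"
    and "AE x in lborel. integrable lborel (\<lambda>y. f (joinv x y))"
    and "AE y in lborel. integrable lborel (\<lambda>x. f (joinv x y))"
proof -
  have [measurable]: "f \<in> borel_measurable borel" using borel_measurable_integrable[OF f] by simp
  have i: "integrable (lborel \<Otimes>\<^sub>M lborel) (\<lambda>(x, y). f (joinv x y))"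
    using f integrable_joinv_iff[of f] by simp
  have [measurable]: "(\<lambda>(x, y). joinv x y) \<in> borel_measurable (lborel \<Otimes>\<^sub>M lborel)"
    by measurable
  have e: "(\<integral>z. f z \<partial>lborel) = (\<integral>z. (case z of (x, y) \<Rightarrow> f (joinv x y)) \<partial>(lborel \<Otimes>\<^sub>M lborel))"
    by (subst lborel_joinv[symmetric], subst integral_distr) (auto simp: case_prod_unfold)
  show "(\<integral>z. f z \<partial>lborel) = (\<integral>x. \<integral>y. f (joinv x y) \<partial>lborel \<partial>lborel)"
    using lborel_pair.integral_fst[of "\<lambda>x y. f (joinv x y)"] i e by simp
  show "(\<integral>z. f z \<partial>lborel) = (\<integral>y. \<integral>x. f (joinv x y) \<partial>lborel \<partial>lborel)"
    using lborel_pair.integral_snd[of "\<lambda>x y. f (joinv x y)"] i e by simp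
  show "AE x in lborel. integrable lborel (\<lambda>y. f (joinv x y))"
    using lborel_pair.AE_integrable_fst[of "\<lambda>x y. f (joinv x y)"] i by simp
  show "AE y in lborel. integrable lborel (\<lambda>x. f (joinv x y))"
    using lborel_pair.AE_integrable_snd[of "\<lambda>x y. f (joinv x y)"] i by simp
qed

lemma integrable_tensor:
  fixes f :: "real^'a::finite \<Rightarrow> 'c::{real_normed_field, banach, second_countable_topology}"
    and g :: "real^'b::finite \<Rightarrow> 'c"
  assumes f: "integrable lborel f" and g: "integrable lborel g"
  shows "integrable lborel (\<lambda>z. f (fstv z) * g (sndv z))"
proof -
  have [measurable]: "f \<in> borel_measurable borel" "g \<in> borel_measurable borel"
    using borel_measurable_integrable[OF f] borel_measurable_integrable[OF g] by auto
  have "integrable (lborel \<Otimes>\<^sub>M lborel) (\<lambda>z. f (fst z) * g (snd z))"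
  proof (rule lborel_pair.Fubini_integrable)
    show "integrable lborel (\<lambda>x. \<integral>y. norm (f (fst (x, y)) * g (snd (x, y))) \<partial>lborel)"
      using f g by (simp add: norm_mult)
    show "AE x in lborel. integrable lborel (\<lambda>y. f (fst (x, y)) * g (snd (x, y)))"
      using g by simp
  qed measurable
  then show ?thesis
    by (subst integrable_joinv_iff) (auto simp: case_prod_unfold)
qed

text \<open>For a fixed second block the shear is a translation of the first block, so Tonelli's
  theorem reduces the claim to translation invariance. \<open>L\<close> may be any measurable
  map.\<close>

lemma lborel_preserving_shear1:
  fixes L :: "real^'b::finite \<Rightarrow> real^'a::finite"
  assumes [measurable]: "L \<in> borel_measurable borel"
  shows "lborel_preserving (\<lambda>z. joinv (fstv z + L (sndv z)) (sndv z))" (is "lborel_preserving ?T")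
proof -
  have "distr lborel borel ?T = lborel"
  proof (rule measure_eqI)
    fix S assume "S \<in> sets (distr lborel borel ?T)"
    then have [measurable]: "S \<in> sets borel" by simp
    have *: "emeasure lborel S' = (\<integral>\<^sup>+y. \<integral>\<^sup>+x. indicator S' (joinv x y) \<partial>lborel \<partial>lborel)"
      if [measurable]: "S' \<in> sets borel" for S' :: "(real^('a + 'b)) set"
    proof -
      have "emeasure lborel S' = (\<integral>\<^sup>+z. indicator S' z \<partial>distr (lborel \<Otimes>\<^sub>M lborel) borel (\<lambda>(x, y). joinv x y))"
        by (subst lborel_joinv) simp
      also have "\<dots> = (\<integral>\<^sup>+z. indicator S' (joinv (fst z) (snd z)) \<partial>(lborel \<Otimes>\<^sub>M lborel))"
        by (subst nn_integral_distr) (auto simp: case_prod_unfold)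
      also have "\<dots> = (\<integral>\<^sup>+y. \<integral>\<^sup>+x. indicator S' (joinv x y) \<partial>lborel \<partial>lborel)"
        using lborel_pair.nn_integral_snd[of "\<lambda>z. indicator S' (joinv (fst z) (snd z))"] by simp
      finally show ?thesis .
    qed
    have "emeasure (distr lborel borel ?T) S = emeasure lborel (?T -` S)"
      by (subst emeasure_distr) auto
    also have "\<dots> = (\<integral>\<^sup>+y. \<integral>\<^sup>+x. indicator (?T -` S) (joinv x y) \<partial>lborel \<partial>lborel)"
      by (intro *) (use measurable_sets[of ?T borel borel S] in simp)
    also have "\<dots> = (\<integral>\<^sup>+y. \<integral>\<^sup>+x. indicator S (joinv (x + L y) y) \<partial>lborel \<partial>lborel)"
      by (simp add: indicator_def)
    also have "\<dots> = (\<integral>\<^sup>+y. \<integral>\<^sup>+x. indicator S (joinv x y) \<partial>lborel \<partial>lborel)"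
    proof (rule nn_integral_cong)
      fix y :: "real^'b"
      have "(\<integral>\<^sup>+x. indicator S (joinv x y) \<partial>lborel)
          = (\<integral>\<^sup>+x. indicator S (joinv x y) \<partial>distr lborel borel (\<lambda>x. x + L y))"
        using lborel_preserving_add[of "L y"] by (simp add: lborel_preserving_def)
      also have "\<dots> = (\<integral>\<^sup>+x. indicator S (joinv (x + L y) y) \<partial>lborel)"
        by (subst nn_integral_distr) auto
      finally show "(\<integral>\<^sup>+x. indicator S (joinv (x + L y) y) \<partial>lborel) = (\<integral>\<^sup>+x. indicator S (joinv x y) \<partial>lborel)"
        by simp
    qed
    also have "\<dots> = emeasure lborel S" by (rule *[symmetric]) simp
    finally show "emeasure (distr lborel borel ?T) S = emeasure lborel S" .
  qed simp
  then show ?thesis by (simp add: lborel_preserving_def)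
qed

text \<open>A permutation of coordinates takes boxes to boxes with the same side lengths, and the
  volumes of boxes determine Lebesgue measure.\<close>

lemma lborel_preserving_reindex:
  fixes \<pi> :: "'m::finite \<Rightarrow> 'n::finite"
  assumes "bij \<pi>"
  shows "lborel_preserving (\<lambda>z :: real^'n. \<chi> i. z $ \<pi> i)" (is "lborel_preserving ?T")
proof -
  have [measurable]: "?T \<in> borel_measurable borel"
    by (intro borel_measurable_continuous_onI continuous_intros)
  have "distr lborel borel ?T = lborel"
  proof (rule lborel_vec_eqI)
    fix l u :: "real^'m"
    assume le: "\<And>i. l $ i \<le> u $ i"
    let ?\<sigma> = "inv \<pi>"
    have \<sigma>: "?\<sigma> (\<pi> i) = i" "\<pi> (?\<sigma> j) = j" for i j
      using assms by (auto simp: bij_def surj_f_inv_f)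
    have "?T -` box l u = box (\<chi> j. l $ ?\<sigma> j) (\<chi> j. u $ ?\<sigma> j)"
      by (auto simp: mem_box_cart) (metis \<sigma>)+
    then have "emeasure (distr lborel borel ?T) (box l u)
        = emeasure lborel (box (\<chi> j. l $ ?\<sigma> j) (\<chi> j. u $ ?\<sigma> j) :: (real^'n) set)"
      by (subst emeasure_distr) auto
    also have "\<dots> = ennreal (\<Prod>j\<in>UNIV. u $ ?\<sigma> j - l $ ?\<sigma> j)"
      by (subst emeasure_lborel_box_vec) (auto simp: le)
    also have "(\<Prod>j\<in>UNIV. u $ ?\<sigma> j - l $ ?\<sigma> j) = (\<Prod>i\<in>UNIV. u $ i - l $ i)"
      by (rule prod.reindex_bij_betw) (use assms in \<open>simp add: bij_imp_bij_inv\<close>)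
    finally show "emeasure (distr lborel borel ?T) (box l u) = ennreal (\<Prod>i\<in>UNIV. u $ i - l $ i)" .
  qed simp
  then show ?thesis by (simp add: lborel_preserving_def)
qed

text \<open>Conjugation with this swap turns statements about the first block into statements about
  the second.\<close>

lemma lborel_preserving_swapv:
  "lborel_preserving (\<lambda>z :: real^('a::finite + 'b::finite). joinv (sndv z) (fstv z))"
proof -
  let ?\<pi> = "\<lambda>k::'b + 'a. case k of Inl i \<Rightarrow> Inr i | Inr j \<Rightarrow> (Inl j :: 'a + 'b)"
  have "bij ?\<pi>"
    by (rule o_bij[where g="\<lambda>k. case k of Inl i \<Rightarrow> Inr i | Inr j \<Rightarrow> Inl j"])
       (auto simp: fun_eq_iff split: sum.splits)
  from lborel_preserving_reindex[OF this]
  show ?thesis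
    by (rule arg_cong[where f=lborel_preserving, THEN iffD1, rotated])
       (auto simp: fun_eq_iff vec_eq_iff split_sum_all)
qed

lemma lborel_preserving_shear2:
  fixes L :: "real^'a::finite \<Rightarrow> real^'b::finite"
  assumes "L \<in> borel_measurable borel"
  shows "lborel_preserving (\<lambda>z. joinv (fstv z) (sndv z + L (fstv z)))"
  using lborel_preserving_compose[OF lborel_preserving_swapv
      lborel_preserving_compose[OF lborel_preserving_shear1[OF assms] lborel_preserving_swapv]]
  by simp

lemma lborel_preserving_fstv:
  fixes S :: "real^'a::finite \<Rightarrow> real^'a"
  assumes S: "lborel_preserving S"
  shows "lborel_preserving (\<lambda>z :: real^('a + 'b::finite). joinv (S (fstv z)) (sndv z))"
    (is "lborel_preserving ?T")
proof -
  have [measurable]: "S \<in> borel_measurable borel" using S by simp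
  have "distr lborel borel ?T = distr (lborel \<Otimes>\<^sub>M lborel) borel (\<lambda>(x, y). joinv (S x) y)"
    by (subst lborel_joinv[symmetric], subst distr_distr) (auto simp: o_def case_prod_unfold)
  also have "\<dots> = distr (distr (lborel \<Otimes>\<^sub>M lborel) (borel \<Otimes>\<^sub>M borel) (\<lambda>(x, y). (S x, y))) borel (\<lambda>(x, y). joinv x y)"
    by (subst distr_distr) (auto simp: o_def case_prod_unfold)
  also have "distr (lborel \<Otimes>\<^sub>M lborel) (borel \<Otimes>\<^sub>M borel) (\<lambda>(x, y). (S x, y :: real^'b))
      = distr lborel borel S \<Otimes>\<^sub>M distr lborel borel (\<lambda>x. x)"
    using S by (subst pair_measure_distr) (auto simp: lborel_preserving_def distr_id2 intro: sigma_finite_lborel)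
  also have "\<dots> = lborel \<Otimes>\<^sub>M lborel"
    using S by (simp add: lborel_preserving_def distr_id2)
  finally show ?thesis
    by (simp add: lborel_preserving_def lborel_joinv)
qed

lemma lborel_preserving_sndv:
  fixes S :: "real^'b::finite \<Rightarrow> real^'b"
  assumes S: "lborel_preserving S"
  shows "lborel_preserving (\<lambda>z :: real^('a::finite + 'b). joinv (fstv z) (S (sndv z)))"
  using lborel_preserving_compose[OF lborel_preserving_swapv
      lborel_preserving_compose[OF lborel_preserving_fstv[OF S] lborel_preserving_swapv]]
  by simp

section \<open>Characters and estimates for integrals\<close>

text \<open>Every phase below is written in this form. An identity between products of phases then
  becomes an identity between real exponents, settled by bilinearity of the inner product.\<close>

definition unit_char :: "real \<Rightarrow> complex" where
  "unit_char r = cis (2 * pi * r)"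

lemma unit_char_add: "unit_char (r + s) = unit_char r * unit_char s"
  by (simp add: unit_char_def cis_mult algebra_simps)

lemma unit_char_0 [simp]: "unit_char 0 = 1"
  by (simp add: unit_char_def)

lemma norm_unit_char [simp]: "cmod (unit_char r) = 1"
  by (simp add: unit_char_def)

lemma cnj_unit_char [simp]: "cnj (unit_char r) = unit_char (- r)"
  by (simp add: unit_char_def cis_cnj)

lemma exp_unit_char:
  "exp (2 * complex_of_real pi * \<i> * complex_of_real r) = unit_char r"
  "exp (- 2 * complex_of_real pi * \<i> * complex_of_real r) = unit_char (- r)"
  "exp (- complex_of_real pi * \<i> * complex_of_real r) = unit_char (- r / 2)"
  by (simp_all add: unit_char_def cis_conv_exp mult_ac)

lemma continuous_on_unit_char [continuous_intros]:
  "continuous_on S f \<Longrightarrow> continuous_on S (\<lambda>x. unit_char (f x))"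
  unfolding unit_char_def by (intro continuous_intros)

lemma measurable_cnj [measurable]: "cnj \<in> borel_measurable borel"
  by (intro borel_measurable_continuous_onI continuous_intros)

lemma measurable_unit_char [measurable]: "unit_char \<in> borel_measurable borel"
  by (intro borel_measurable_continuous_onI continuous_intros)

lemma fourier_unit_char: "fourier F \<zeta> = (\<integral>z. F z * unit_char (- (z \<bullet> \<zeta>)) \<partial>lborel)"
  unfolding fourier_def by (simp only: exp_unit_char)

lemma inv_fourier_unit_char: "inv_fourier F z = (\<integral>\<zeta>. F \<zeta> * unit_char (z \<bullet> \<zeta>) \<partial>lborel)"
  unfolding inv_fourier_def by (simp only: exp_unit_char)

lemma inv_fourier_eq_fourier: "inv_fourier F z = fourier F (- z)"
  by (simp add: fourier_unit_char inv_fourier_unit_char inner_commute)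

lemma continuous_on_integral_dominated:
  fixes f :: "'p::metric_space \<Rightarrow> 'a \<Rightarrow> 'b::{banach, second_countable_topology}"
  assumes "\<And>x. x \<in> space M \<Longrightarrow> continuous_on S (\<lambda>p. f p x)"
    and "\<And>p. f p \<in> borel_measurable M"
    and "integrable M w" "\<And>p x. norm (f p x) \<le> w x"
  shows "continuous_on S (\<lambda>p. \<integral>x. f p x \<partial>M)"
  unfolding continuous_on_sequentially
proof (intro allI ballI impI, elim conjE, unfold o_def)
  fix u a assume u: "a \<in> S" "\<forall>n. u n \<in> S" "u \<longlonglongrightarrow> a"
  show "(\<lambda>n. \<integral>x. f (u n) x \<partial>M) \<longlonglongrightarrow> (\<integral>x. f a x \<partial>M)"
  proof (rule integral_dominated_convergence[where w=w])
    show "AE x in M. (\<lambda>n. f (u n) x) \<longlonglongrightarrow> f a x"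
      using u by (intro AE_I2) (auto intro: continuous_on_tendsto_compose[OF assms(1)])
  qed (use assms in auto)
qed

lemma norm_integral_le:
  fixes f :: "'a \<Rightarrow> 'b::{banach, second_countable_topology}"
  assumes "integrable M w" "\<And>x. norm (f x) \<le> w x"
  shows "norm (\<integral>x. f x \<partial>M) \<le> (\<integral>x. w x \<partial>M)"
proof (cases "integrable M f")
  case True
  then show ?thesis
    using assms by (intro order_trans[OF integral_norm_bound integral_mono]) auto
next
  \<comment> \<open>The integral of a non-integrable function is 0 by convention, so the bound
    reduces to nonnegativity of the integral of \<open>w\<close>.\<close>
  case False
  have "0 \<le> (\<integral>x. w x \<partial>M)"
    using assms(2) by (intro integral_nonneg_AE AE_I2) (meson norm_ge_zero order_trans)
  with False show ?thesis by (simp add: not_integrable_integral_eq)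
qed

lemma integrable_pair_mult:
  fixes f :: "'a::euclidean_space \<Rightarrow> 'c::{real_normed_field, banach, second_countable_topology}"
    and g :: "'b::euclidean_space \<Rightarrow> 'c"
  assumes f: "integrable lborel f" and g: "integrable lborel g"
  shows "integrable (lborel \<Otimes>\<^sub>M lborel) (\<lambda>z. f (fst z) * g (snd z))"
proof (rule lborel_pair.Fubini_integrable)
  show "integrable lborel (\<lambda>x. \<integral>y. norm (f (fst (x, y)) * g (snd (x, y))) \<partial>lborel)"
    using f g by (simp add: norm_mult)
  show "AE x in lborel. integrable lborel (\<lambda>y. f (fst (x, y)) * g (snd (x, y)))"
    using g by simp
qed (use f g in measurable)

lemma integral_scaleR_affine:
  fixes f :: "'a::euclidean_space \<Rightarrow> 'b::{banach, second_countable_topology}"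
  assumes "c \<noteq> 0" and [measurable]: "f \<in> borel_measurable borel"
  shows "(\<integral>x. f x \<partial>lborel) = \<bar>c\<bar> ^ DIM('a) *\<^sub>R (\<integral>x. f (t + c *\<^sub>R x) \<partial>lborel)"
  by (subst lborel_affine[OF assms(1), of t])
     (simp add: integral_density integral_distr)

lemma integrable_mult_bounded:
  fixes f g :: "'a \<Rightarrow> complex"
  assumes "integrable M f" "g \<in> borel_measurable M" "\<And>x. cmod (g x) \<le> C"
  shows "integrable M (\<lambda>x. f x * g x)" "integrable M (\<lambda>x. g x * f x)"
proof -
  show "integrable M (\<lambda>x. f x * g x)"
  proof (rule Bochner_Integration.integrable_bound[of _ "\<lambda>x. complex_of_real C * f x"])
    have "cmod (g x) \<le> \<bar>C\<bar>" for x using assms(3)[of x] by linarith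
    then show "AE x in M. norm (f x * g x) \<le> norm (complex_of_real C * f x)"
      by (intro AE_I2) (simp add: norm_mult mult.commute[of "cmod (f _)"] mult_right_mono)
  qed (use assms in auto)
  then show "integrable M (\<lambda>x. g x * f x)" by (simp add: mult.commute)
qed

subsection \<open>Fourier inversion and Plancherel's theorem\<close>

text \<open>Normalised to have integral 1 and to be its own Fourier transform.\<close>

definition gauss :: "'a::euclidean_space \<Rightarrow> real" where
  "gauss x = exp (- pi * (x \<bullet> x))"

lemma gauss_nonneg [simp]: "0 \<le> gauss x" and gauss_le_1: "gauss x \<le> 1"
  by (simp_all add: gauss_def)

lemma continuous_on_gauss [continuous_intros]:
  "continuous_on S f \<Longrightarrow> continuous_on S (\<lambda>x. gauss (f x))"
  unfolding gauss_def by (intro continuous_intros)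

lemma measurable_gauss [measurable]: "gauss \<in> borel_measurable borel"
  by (intro borel_measurable_continuous_onI continuous_intros)

lemma gauss_real_fourier:
  fixes \<xi> :: real
  shows "integrable lborel (gauss :: real \<Rightarrow> real)"
    and "(\<integral>x. complex_of_real (gauss x) * unit_char (- (x * \<xi>)) \<partial>lborel) = complex_of_real (gauss \<xi>)"
proof -
  \<comment> \<open>The standard normal density has exponent -x^2/2. At \<open>r * x\<close> with
    r^2 = 2 pi this becomes -pi x^2, and its prefactor is 1/r. The known characteristic function,
    evaluated at -r \<xi>, is then exp (-pi \<xi>^2).\<close>
  define r where "r = sqrt (2 * pi)"
  have r: "r > 0" "r * r = 2 * pi" by (auto simp: r_def)
  have dens: "std_normal_density (r * x) = gauss x / r" for x
  proof -
    have "(r * x)\<^sup>2 = (r * r) * x\<^sup>2" by (simp add: power2_eq_square)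
    then have "(r * x)\<^sup>2 = 2 * pi * x\<^sup>2" using r(2) by simp
    then show ?thesis
      by (simp add: std_normal_density_def gauss_def r_def power2_eq_square)
  qed
  have "integrable lborel (\<lambda>x. std_normal_density x)"
    using integrable_std_normal_moment[of 0] by simp
  from lborel_integrable_real_affine[OF this, of r 0] r
  have "integrable lborel (\<lambda>x. r * std_normal_density (0 + r * x))" by simp
  then show "integrable lborel (gauss :: real \<Rightarrow> real)" using r by (simp add: dens)
  let ?t = "- (r * \<xi>)"
  have "complex_of_real (exp (- ?t\<^sup>2 / 2)) = char std_normal_distribution ?t"
    by (simp add: char_std_normal_distribution)
  also have "\<dots> = (\<integral>x. std_normal_density x *\<^sub>R iexp (?t * x) \<partial>lborel)"
    unfolding char_def by (subst integral_density) (auto simp: normal_density_nonneg)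
  also have "\<dots> = r *\<^sub>R (\<integral>x. std_normal_density (0 + r * x) *\<^sub>R iexp (?t * (0 + r * x)) \<partial>lborel)"
    using r by (subst lborel_integral_real_affine[of r _ 0]) auto
  also have "\<dots> = (\<integral>x. r *\<^sub>R (std_normal_density (r * x) *\<^sub>R iexp (?t * (r * x))) \<partial>lborel)"
    using r by (subst integral_scaleR_right[symmetric]) (auto simp del: integral_scaleR_right)
  also have "\<dots> = (\<integral>x. complex_of_real (gauss x) * unit_char (- (x * \<xi>)) \<partial>lborel)"
  proof (rule Bochner_Integration.integral_cong[OF refl])
    fix x :: real
    have "?t * (r * x) = - (r * r) * \<xi> * x" by simp
    also have "\<dots> = 2 * pi * (- (x * \<xi>))" using r by simp
    finally show "r *\<^sub>R (std_normal_density (r * x) *\<^sub>R iexp (?t * (r * x)))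
        = complex_of_real (gauss x) * unit_char (- (x * \<xi>))"
      using r by (simp only: dens) (simp add: unit_char_def cis_conv_exp scaleR_conv_of_real)
  qed
  finally have *: "complex_of_real (exp (- ?t\<^sup>2 / 2)) = (\<integral>x. complex_of_real (gauss x) * unit_char (- (x * \<xi>)) \<partial>lborel)" .
  show "(\<integral>x. complex_of_real (gauss x) * unit_char (- (x * \<xi>)) \<partial>lborel) = complex_of_real (gauss \<xi>)"
  proof -
    have "(- (r * \<xi>))\<^sup>2 = (r * r) * \<xi>\<^sup>2" by (simp add: power2_eq_square)
    then have "exp (- (- (r * \<xi>))\<^sup>2 / 2) = gauss \<xi>"
      by (simp only: r(2)) (simp add: gauss_def power2_eq_square)
    then show ?thesis using * by simp
  qed
qed

lemma gauss_eq_prod: "gauss x = (\<Prod>b\<in>Basis. gauss (x \<bullet> b))"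
  by (simp add: gauss_def exp_sum[symmetric] euclidean_inner[of x x] sum_distrib_left)

lemma unit_char_sum: "finite I \<Longrightarrow> unit_char (\<Sum>i\<in>I. f i) = (\<Prod>i\<in>I. unit_char (f i))"
  by (induction I rule: finite_induct) (simp_all add: unit_char_add)

interpretation lborel_fun: product_sigma_finite "\<lambda>_::'a. lborel :: real measure"
  by unfold_locales

lemma lborel_prod_integral:
  fixes f :: "'a::euclidean_space \<Rightarrow> real \<Rightarrow> 'c::{real_normed_field, banach, second_countable_topology}"
  assumes f: "\<And>b. b \<in> Basis \<Longrightarrow> integrable lborel (f b)"
  shows "integrable lborel (\<lambda>x::'a. \<Prod>b\<in>Basis. f b (x \<bullet> b))"
    and "(\<integral>x. (\<Prod>b\<in>Basis. f b (x \<bullet> b)) \<partial>lborel) = (\<Prod>b\<in>Basis. \<integral>x. f b x \<partial>lborel)"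
proof -
  have [measurable]: "f b \<in> borel_measurable borel" if "b \<in> Basis" for b
    using borel_measurable_integrable[OF f[OF that]] by simp
  let ?P = "Pi\<^sub>M (Basis::'a set) (\<lambda>_. lborel :: real measure)"
  have m [measurable]: "(\<lambda>g. \<Sum>b\<in>Basis. g b *\<^sub>R b) \<in> ?P \<rightarrow>\<^sub>M (borel :: 'a measure)"
    by measurable
  have e: "(\<Prod>b\<in>Basis. f b ((\<Sum>b'\<in>Basis. g b' *\<^sub>R b') \<bullet> b)) = (\<Prod>b\<in>Basis. f b (g b))" for g :: "'a \<Rightarrow> real"
    by (intro prod.cong refl) (simp add: inner_sum_left inner_Basis if_distrib cong: if_cong)
  show "integrable lborel (\<lambda>x::'a. \<Prod>b\<in>Basis. f b (x \<bullet> b))"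
    by (subst lborel_eq, subst integrable_distr_eq)
       (auto simp: e intro!: lborel_fun.product_integrable_prod f)
  show "(\<integral>x. (\<Prod>b\<in>Basis. f b (x \<bullet> b)) \<partial>lborel) = (\<Prod>b\<in>Basis. \<integral>x. f b x \<partial>lborel)"
    by (subst lborel_eq, subst integral_distr)
       (auto simp: e intro!: lborel_fun.product_integral_prod f)
qed

lemma integrable_gauss [simp, intro]: "integrable lborel (gauss :: 'a::euclidean_space \<Rightarrow> real)"
proof -
  have "(\<lambda>x::'a. \<Prod>b\<in>Basis. gauss (x \<bullet> b)) = gauss"
    by (rule ext, rule gauss_eq_prod[symmetric])
  then show ?thesis
    using lborel_prod_integral(1)[where 'a='a, of "\<lambda>_. gauss"] gauss_real_fourier(1) by simp
qed

text \<open>The Gaussian and the character are both products over the coordinates, so the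
  one-dimensional formula suffices.\<close>

lemma fourier_gauss: "fourier (\<lambda>x. complex_of_real (gauss x)) \<xi> = complex_of_real (gauss \<xi>)"
proof -
  have "fourier (\<lambda>x. complex_of_real (gauss x)) \<xi>
      = (\<integral>x. (\<Prod>b\<in>Basis. complex_of_real (gauss (x \<bullet> b)) * unit_char (- ((x \<bullet> b) * (\<xi> \<bullet> b)))) \<partial>lborel)"
    unfolding fourier_unit_char
    by (simp only: prod.distrib of_real_prod[symmetric] gauss_eq_prod[symmetric])
       (simp add: unit_char_sum[symmetric] sum_negf euclidean_inner[of _ \<xi>])
  also have "\<dots> = (\<Prod>b\<in>Basis. \<integral>x. complex_of_real (gauss x) * unit_char (- (x * (\<xi> \<bullet> b))) \<partial>lborel)"
  proof (rule lborel_prod_integral(2)[of "\<lambda>b x. complex_of_real (gauss x) * unit_char (- (x * (\<xi> \<bullet> b)))"])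
    fix b show "integrable lborel (\<lambda>x. complex_of_real (gauss x) * unit_char (- (x * (\<xi> \<bullet> b))))"
      by (rule integrable_mult_bounded[where C=1]) (auto simp: gauss_real_fourier(1))
  qed
  also have "\<dots> = complex_of_real (gauss \<xi>)"
    by (simp add: gauss_real_fourier(2)) (simp only: gauss_eq_prod[of \<xi>] of_real_prod)
  finally show ?thesis .
qed

lemma integral_gauss: "(\<integral>x. gauss (x :: real^'n::finite) \<partial>lborel) = 1"
proof -
  have "complex_of_real (\<integral>x. gauss (x :: real^'n) \<partial>lborel) = 1"
    using fourier_gauss[of "0 :: real^'n"] by (simp add: fourier_unit_char gauss_def)
  then show ?thesis by simp
qed

lemma measurable_fourier [measurable]:
  assumes [measurable]: "F \<in> borel_measurable borel"
  shows "fourier F \<in> borel_measurable borel"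
  unfolding fourier_unit_char[abs_def] by measurable

lemma norm_fourier_le:
  assumes "integrable lborel F"
  shows "cmod (fourier F \<zeta>) \<le> (\<integral>x. cmod (F x) \<partial>lborel)"
  unfolding fourier_unit_char by (rule norm_integral_le) (use assms in \<open>auto simp: norm_mult\<close>)

lemma continuous_on_fourier:
  assumes F: "integrable lborel F"
  shows "continuous_on S (fourier F)"
  unfolding fourier_unit_char[abs_def]
proof (rule continuous_on_integral_dominated[where w="\<lambda>x. cmod (F x)"])
  show "(\<lambda>z. F z * unit_char (- (z \<bullet> p))) \<in> borel_measurable lborel" for p
    using borel_measurable_integrable[OF F] by measurable
qed (use F in \<open>auto intro!: continuous_intros simp: norm_mult\<close>)

text \<open>The common source of inversion, Plancherel and Moyal below: each arises by choosing
  \<open>G\<close> so that its transform is known.\<close>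

lemma fourier_multiplication:
  assumes F: "integrable lborel F" and G: "integrable lborel G"
  shows "(\<integral>\<xi>. fourier F \<xi> * G \<xi> \<partial>lborel) = (\<integral>x. F x * fourier G x \<partial>lborel)"
proof -
  have [measurable]: "F \<in> borel_measurable borel" "G \<in> borel_measurable borel"
    using borel_measurable_integrable[OF F] borel_measurable_integrable[OF G] by auto
  have "(\<integral>\<xi>. fourier F \<xi> * G \<xi> \<partial>lborel) = (\<integral>\<xi>. \<integral>x. F x * unit_char (- (x \<bullet> \<xi>)) * G \<xi> \<partial>lborel \<partial>lborel)"
    unfolding fourier_unit_char by simp
  also have "\<dots> = (\<integral>x. \<integral>\<xi>. F x * unit_char (- (x \<bullet> \<xi>)) * G \<xi> \<partial>lborel \<partial>lborel)"
  proof (rule lborel_pair.Fubini_integral)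
    have "integrable (lborel \<Otimes>\<^sub>M lborel) (\<lambda>z. F (fst z) * G (snd z) * unit_char (- (fst z \<bullet> snd z)))"
      by (rule integrable_mult_bounded[where C=1, OF integrable_pair_mult]) (use F G in auto)
    then show "integrable (lborel \<Otimes>\<^sub>M lborel) (\<lambda>(x, \<xi>). F x * unit_char (- (x \<bullet> \<xi>)) * G \<xi>)"
      by (simp add: case_prod_unfold mult_ac)
  qed
  also have "\<dots> = (\<integral>x. F x * fourier G x \<partial>lborel)"
    unfolding fourier_unit_char by (simp add: mult.assoc) (simp add: inner_commute mult.commute)
  finally show ?thesis .
qed

lemma integrable_gauss_scaled:
  "\<delta> \<noteq> 0 \<Longrightarrow> integrable lborel (\<lambda>\<xi>::real^'n::finite. gauss (\<delta> *\<^sub>R \<xi>))"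
  and integral_gauss_scaled_char:
  "\<delta> > 0 \<Longrightarrow> (\<delta> ^ CARD('n)) *\<^sub>R (\<integral>\<xi>. complex_of_real (gauss (\<delta> *\<^sub>R (\<xi>::real^'n::finite))) * unit_char (- ((\<delta> *\<^sub>R s) \<bullet> \<xi>)) \<partial>lborel)
     = complex_of_real (gauss s)"
proof -
  assume d: "\<delta> \<noteq> 0"
  have "integrable (density (distr lborel borel (\<lambda>x. 0 + \<delta> *\<^sub>R x)) (\<lambda>_. ennreal (\<bar>\<delta>\<bar> ^ DIM(real^'n)))) (gauss :: real^'n \<Rightarrow> real)"
    using lborel_affine[OF d, of "0 :: real^'n"] integrable_gauss[where 'a="real^'n"] by simp
  then show "integrable lborel (\<lambda>\<xi>::real^'n. gauss (\<delta> *\<^sub>R \<xi>))"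
    by (subst (asm) integrable_density) (use d in \<open>auto simp: integrable_distr_eq\<close>)
next
  assume d: "\<delta> > 0"
  let ?f = "\<lambda>\<xi>. complex_of_real (gauss \<xi>) * unit_char (- (\<xi> \<bullet> s))"
  have "complex_of_real (gauss s) = (\<integral>\<xi>. ?f \<xi> \<partial>lborel)"
    using fourier_gauss[of s] by (simp add: fourier_unit_char)
  also have "\<dots> = \<delta> ^ CARD('n) *\<^sub>R (\<integral>\<xi>. ?f (0 + \<delta> *\<^sub>R \<xi>) \<partial>lborel)"
    using d by (subst integral_scaleR_affine[of \<delta> _ 0]) auto
  finally show "(\<delta> ^ CARD('n)) *\<^sub>R (\<integral>\<xi>. complex_of_real (gauss (\<delta> *\<^sub>R (\<xi>::real^'n))) * unit_char (- ((\<delta> *\<^sub>R s) \<bullet> \<xi>)) \<partial>lborel)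
     = complex_of_real (gauss s)"
    by (simp add: inner_commute)
qed

text \<open>Gaussian damping in frequency is Gaussian averaging in space. The multiplication formula
  is applied to the damped character, whose transform is a Gaussian of width \<delta> centred at
  \<open>x\<close>. The substitution y = x + \<delta> s absorbs its normalising factor.\<close>

lemma fourier_gauss_regularised:
  fixes H :: "real^'n::finite \<Rightarrow> complex"
  assumes H: "integrable lborel H" and d: "\<delta> > 0"
  shows "(\<integral>\<xi>. fourier H \<xi> * (complex_of_real (gauss (\<delta> *\<^sub>R \<xi>)) * unit_char (x \<bullet> \<xi>)) \<partial>lborel)
     = (\<integral>s. H (x + \<delta> *\<^sub>R s) * complex_of_real (gauss s) \<partial>lborel)"
proof -
  have [measurable]: "H \<in> borel_measurable borel"
    using borel_measurable_integrable[OF H] by auto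
  let ?k = "\<lambda>\<xi>. complex_of_real (gauss (\<delta> *\<^sub>R \<xi>)) * unit_char (x \<bullet> \<xi>)"
  have k: "integrable lborel ?k"
    by (rule integrable_mult_bounded[where C=1]) (use d in \<open>auto intro!: integrable_gauss_scaled\<close>)
  have "(\<integral>\<xi>. fourier H \<xi> * ?k \<xi> \<partial>lborel) = (\<integral>y. H y * fourier ?k y \<partial>lborel)"
    by (rule fourier_multiplication[OF H k])
  also have "\<dots> = \<delta> ^ CARD('n) *\<^sub>R (\<integral>s. H (x + \<delta> *\<^sub>R s) * fourier ?k (x + \<delta> *\<^sub>R s) \<partial>lborel)"
    using d by (subst integral_scaleR_affine[of \<delta> _ x]) auto
  also have "\<dots> = (\<integral>s. H (x + \<delta> *\<^sub>R s) * (\<delta> ^ CARD('n) *\<^sub>R fourier ?k (x + \<delta> *\<^sub>R s)) \<partial>lborel)"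
    using d by (subst integral_scaleR_right[symmetric]) (auto simp del: integral_scaleR_right)
  also have "\<dots> = (\<integral>s. H (x + \<delta> *\<^sub>R s) * complex_of_real (gauss s) \<partial>lborel)"
  proof (rule Bochner_Integration.integral_cong[OF refl])
    fix s
    have "?k \<xi> * unit_char (- (\<xi> \<bullet> (x + \<delta> *\<^sub>R s))) = complex_of_real (gauss (\<delta> *\<^sub>R \<xi>)) * unit_char (- ((\<delta> *\<^sub>R s) \<bullet> \<xi>))" for \<xi>
      by (simp only: mult.assoc unit_char_add[symmetric]) (simp add: inner_commute inner_add_right)
    then have "fourier ?k (x + \<delta> *\<^sub>R s) = (\<integral>\<xi>. complex_of_real (gauss (\<delta> *\<^sub>R \<xi>)) * unit_char (- ((\<delta> *\<^sub>R s) \<bullet> \<xi>)) \<partial>lborel)"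
      unfolding fourier_unit_char by (simp only:)
    then show "H (x + \<delta> *\<^sub>R s) * (\<delta> ^ CARD('n) *\<^sub>R fourier ?k (x + \<delta> *\<^sub>R s)) = H (x + \<delta> *\<^sub>R s) * complex_of_real (gauss s)"
      using integral_gauss_scaled_char[OF d, of s] by simp
  qed
  finally show ?thesis .
qed

text \<open>Continuity gives pointwise limits of mollifications, boundedness gives the dominating
  functions, and both survive products, shifts and phases. Chirped ambiguity functions belong to
  this class without any discussion of their smoothness.\<close>

definition nice :: "(real^'n::finite \<Rightarrow> complex) \<Rightarrow> bool" where
  "nice H \<longleftrightarrow> continuous_on UNIV H \<and> (\<exists>C. \<forall>x. cmod (H x) \<le> C) \<and> integrable lborel H"

lemma nice_continuous: "nice H \<Longrightarrow> continuous_on S H"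
  and nice_integrable: "nice H \<Longrightarrow> integrable lborel H"
  and nice_bounded: "nice H \<Longrightarrow> \<exists>C. \<forall>x. cmod (H x) \<le> C"
  by (auto simp: nice_def intro: continuous_on_subset)

lemma nice_measurable [measurable_dest]: "nice H \<Longrightarrow> H \<in> borel_measurable borel"
  by (auto simp: nice_def intro: borel_measurable_continuous_onI)

text \<open>A fixed sequence of scales tending to 0, along which dominated and monotone convergence
  are applied. The same sequence serves as step size of difference quotients.\<close>

definition recip_Suc :: "nat \<Rightarrow> real" where "recip_Suc k = 1 / real (Suc k)"

lemma recip_Suc_pos: "recip_Suc k > 0" and recip_Suc_tendsto: "recip_Suc \<longlonglongrightarrow> 0"
  unfolding recip_Suc_def[abs_def] using LIMSEQ_Suc[OF lim_1_over_n[where 'a=real]] by auto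

lemma gauss_mollify:
  fixes H :: "real^'n::finite \<Rightarrow> complex"
  assumes H: "nice H"
  shows "(\<lambda>k. \<integral>s. H (x + recip_Suc k *\<^sub>R s) * complex_of_real (gauss s) \<partial>lborel) \<longlonglongrightarrow> H x"
proof -
  obtain C where C: "\<And>x. cmod (H x) \<le> C" using nice_bounded[OF H] by auto
  note [measurable] = nice_measurable[OF H]
  have "(\<lambda>k. \<integral>s. H (x + recip_Suc k *\<^sub>R s) * complex_of_real (gauss s) \<partial>lborel)
      \<longlonglongrightarrow> (\<integral>s. H x * complex_of_real (gauss (s :: real^'n)) \<partial>lborel)"
  proof (rule integral_dominated_convergence[where w="\<lambda>s::real^'n. C * gauss s"])
    show "AE s in lborel. (\<lambda>k. H (x + recip_Suc k *\<^sub>R s) * complex_of_real (gauss s)) \<longlonglongrightarrow> H x * complex_of_real (gauss s)"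
    proof (intro AE_I2 tendsto_mult tendsto_const)
      fix s
      have "(\<lambda>k. x + recip_Suc k *\<^sub>R s) \<longlonglongrightarrow> x + 0 *\<^sub>R s"
        by (intro tendsto_intros recip_Suc_tendsto)
      then show "(\<lambda>k. H (x + recip_Suc k *\<^sub>R s)) \<longlonglongrightarrow> H x"
        using continuous_on_tendsto_compose[OF nice_continuous[OF H, of UNIV], of _ x] by simp
    qed
  qed (auto simp: norm_mult intro!: mult_right_mono C)
  also have "(\<integral>s. H x * complex_of_real (gauss (s :: real^'n)) \<partial>lborel) = H x"
    using integral_gauss[where 'n='n] by simp
  finally show ?thesis .
qed

lemma gauss_recip_Suc_tendsto: "(\<lambda>k. gauss (recip_Suc k *\<^sub>R \<xi>)) \<longlonglongrightarrow> 1"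
proof -
  have "(\<lambda>k. gauss (recip_Suc k *\<^sub>R \<xi>)) \<longlonglongrightarrow> exp (- pi * ((0 *\<^sub>R \<xi>) \<bullet> (0 *\<^sub>R \<xi>)))"
    unfolding gauss_def by (intro tendsto_intros recip_Suc_tendsto)
  then show ?thesis by simp
qed

text \<open>The regularised identity has two limits as the scale tends to 0: the damped integral is
  dominated by the modulus of \<open>fourier H\<close>, and the mollification converges by
  continuity of \<open>H\<close>.\<close>

theorem fourier_inversion:
  fixes H :: "real^'n::finite \<Rightarrow> complex"
  assumes H: "nice H" and FH: "integrable lborel (fourier H)"
  shows "inv_fourier (fourier H) x = H x"
proof -
  note [measurable] = nice_measurable[OF H]
  have "(\<lambda>k. \<integral>\<xi>. fourier H \<xi> * (complex_of_real (gauss (recip_Suc k *\<^sub>R \<xi>)) * unit_char (x \<bullet> \<xi>)) \<partial>lborel)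
      \<longlonglongrightarrow> (\<integral>\<xi>. fourier H \<xi> * (complex_of_real 1 * unit_char (x \<bullet> \<xi>)) \<partial>lborel)"
  proof (rule integral_dominated_convergence[where w="\<lambda>\<xi>. cmod (fourier H \<xi>)"])
    show "AE \<xi> in lborel. (\<lambda>k. fourier H \<xi> * (complex_of_real (gauss (recip_Suc k *\<^sub>R \<xi>)) * unit_char (x \<bullet> \<xi>)))
        \<longlonglongrightarrow> fourier H \<xi> * (complex_of_real 1 * unit_char (x \<bullet> \<xi>))"
      by (intro AE_I2 tendsto_intros gauss_recip_Suc_tendsto)
  qed (use FH in \<open>auto simp: norm_mult gauss_le_1 intro!: mult_left_le\<close>)
  then have "(\<lambda>k. \<integral>s. H (x + recip_Suc k *\<^sub>R s) * complex_of_real (gauss s) \<partial>lborel) \<longlonglongrightarrow> inv_fourier (fourier H) x"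
    by (simp add: fourier_gauss_regularised[OF nice_integrable[OF H] recip_Suc_pos] inv_fourier_unit_char)
  from LIMSEQ_unique[OF this gauss_mollify[OF H]] show ?thesis .
qed

text \<open>The Gaussian makes the frequency integral converge before the transforms are known to be
  square integrable; that fact is deduced from this limit.\<close>

lemma plancherel_regularised:
  fixes H1 H2 :: "real^'n::finite \<Rightarrow> complex"
  assumes H1: "nice H1" and H2: "nice H2"
  shows "(\<lambda>k. \<integral>\<xi>. fourier H1 \<xi> * cnj (fourier H2 \<xi>) * complex_of_real (gauss (recip_Suc k *\<^sub>R \<xi>)) \<partial>lborel)
      \<longlonglongrightarrow> (\<integral>x. H1 x * cnj (H2 x) \<partial>lborel)"
proof -
  note [measurable] = nice_measurable[OF H1] nice_measurable[OF H2]
  obtain C where C: "\<And>x. cmod (H2 x) \<le> C" using nice_bounded[OF H2] by auto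
  let ?M = "\<lambda>k x. \<integral>s. H2 (x + recip_Suc k *\<^sub>R s) * complex_of_real (gauss s) \<partial>lborel"
  have eq: "(\<integral>\<xi>. fourier H1 \<xi> * cnj (fourier H2 \<xi>) * complex_of_real (gauss (recip_Suc k *\<^sub>R \<xi>)) \<partial>lborel)
      = (\<integral>x. H1 x * cnj (?M k x) \<partial>lborel)" for k
  proof -
    \<comment> \<open>Chosen so that its Fourier transform is the conjugate of the mollified
      \<open>H2\<close>.\<close>
    let ?k = "\<lambda>\<xi>. complex_of_real (gauss (recip_Suc k *\<^sub>R \<xi>)) * cnj (fourier H2 \<xi>)"
    have k: "integrable lborel ?k"
      by (rule integrable_mult_bounded[where C="\<integral>x. cmod (H2 x) \<partial>lborel"])
         (use recip_Suc_pos[of k] norm_fourier_le[OF nice_integrable[OF H2]] in \<open>auto intro!: integrable_gauss_scaled\<close>)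
    have "fourier ?k x = cnj (?M k x)" for x
    proof -
      have "fourier ?k x = cnj (\<integral>\<xi>. fourier H2 \<xi> * (complex_of_real (gauss (recip_Suc k *\<^sub>R \<xi>)) * unit_char (x \<bullet> \<xi>)) \<partial>lborel)"
        unfolding fourier_unit_char[of ?k]
        by (subst Bochner_Integration.integral_cnj[symmetric]) (simp add: mult_ac inner_commute)
      then show ?thesis
        by (simp add: fourier_gauss_regularised[OF nice_integrable[OF H2] recip_Suc_pos])
    qed
    then show ?thesis
      using fourier_multiplication[OF nice_integrable[OF H1] k] by (simp add: mult_ac)
  qed
  have "(\<lambda>k. \<integral>x. H1 x * cnj (?M k x) \<partial>lborel) \<longlonglongrightarrow> (\<integral>x. H1 x * cnj (H2 x) \<partial>lborel)"
  proof (rule integral_dominated_convergence[where w="\<lambda>x. cmod (H1 x) * C"])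
    show "AE x in lborel. (\<lambda>k. H1 x * cnj (?M k x)) \<longlonglongrightarrow> H1 x * cnj (H2 x)"
      by (intro AE_I2 tendsto_mult tendsto_const tendsto_cnj gauss_mollify[OF H2])
    have "cmod (?M k x) \<le> (\<integral>s. C * gauss (s :: real^'n) \<partial>lborel)" for k x
      by (rule norm_integral_le) (auto simp: norm_mult intro!: mult_right_mono C)
    then show "AE x in lborel. cmod (H1 x * cnj (?M k x)) \<le> cmod (H1 x) * C" for k
      by (auto simp: norm_mult integral_gauss intro!: mult_left_mono)
  qed (use nice_integrable[OF H1] in auto)
  then show ?thesis by (simp add: eq)
qed

text \<open>For equal arguments the regularised integrands are nonnegative and increase with
  \<open>k\<close>, so convergence of their integrals makes the limit integrable. Only then is there
  a dominating function for the polarised identity.\<close>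

theorem plancherel_L2:
  fixes H :: "real^'n::finite \<Rightarrow> complex"
  assumes H: "nice H"
  shows "integrable lborel (\<lambda>\<xi>. (cmod (fourier H \<xi>))\<^sup>2)"
proof -
  note [measurable] = nice_measurable[OF H]
  let ?f = "\<lambda>k \<xi>. (cmod (fourier H \<xi>))\<^sup>2 * gauss (recip_Suc k *\<^sub>R \<xi>)"
  have bd: "(cmod (fourier H \<xi>))\<^sup>2 \<le> (\<integral>x. cmod (H x) \<partial>lborel)\<^sup>2" for \<xi>
    by (intro power_mono norm_fourier_le nice_integrable H) auto
  have int: "integrable lborel (?f k)" for k
    by (rule Bochner_Integration.integrable_bound[of _ "\<lambda>\<xi>. (\<integral>x. cmod (H x) \<partial>lborel)\<^sup>2 * gauss (recip_Suc k *\<^sub>R \<xi>)"])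
       (use recip_Suc_pos[of k] bd in \<open>auto simp: norm_mult intro!: integrable_gauss_scaled mult_right_mono\<close>)
  have "(\<lambda>k. Re (\<integral>\<xi>. fourier H \<xi> * cnj (fourier H \<xi>) * complex_of_real (gauss (recip_Suc k *\<^sub>R \<xi>)) \<partial>lborel))
      \<longlonglongrightarrow> Re (\<integral>x. H x * cnj (H x) \<partial>lborel)"
    by (intro tendsto_Re plancherel_regularised H)
  moreover have "(\<integral>\<xi>. fourier H \<xi> * cnj (fourier H \<xi>) * complex_of_real (gauss (recip_Suc k *\<^sub>R \<xi>)) \<partial>lborel)
      = complex_of_real (\<integral>\<xi>. ?f k \<xi> \<partial>lborel)" for k
    by (subst integral_complex_of_real[symmetric]) (simp add: complex_norm_square[symmetric])
  ultimately have lim: "(\<lambda>k. \<integral>\<xi>. ?f k \<xi> \<partial>lborel) \<longlonglongrightarrow> Re (\<integral>x. H x * cnj (H x) \<partial>lborel)"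
    by simp
  show ?thesis
  proof (rule integrable_monotone_convergence[OF int _ _ lim])
    show "AE \<xi> in lborel. mono (\<lambda>k. ?f k \<xi>)"
    proof (intro AE_I2 monoI mult_left_mono)
      fix \<xi> :: "real^'n" and j k :: nat assume "j \<le> k"
      then have "recip_Suc k \<le> recip_Suc j" by (simp add: recip_Suc_def field_simps)
      then have "(recip_Suc k)\<^sup>2 \<le> (recip_Suc j)\<^sup>2" using recip_Suc_pos[of k] by (intro power_mono) auto
      then show "gauss (recip_Suc j *\<^sub>R \<xi>) \<le> gauss (recip_Suc k *\<^sub>R \<xi>)"
        by (auto simp: gauss_def power2_eq_square mult.assoc[symmetric] intro!: mult_right_mono)
    qed auto
    show "AE \<xi> in lborel. (\<lambda>k. ?f k \<xi>) \<longlonglongrightarrow> (cmod (fourier H \<xi>))\<^sup>2"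
    proof (intro AE_I2)
      fix \<xi> :: "real^'n"
      show "(\<lambda>k. ?f k \<xi>) \<longlonglongrightarrow> (cmod (fourier H \<xi>))\<^sup>2"
        using tendsto_mult[OF tendsto_const gauss_recip_Suc_tendsto, of "(cmod (fourier H \<xi>))\<^sup>2" \<xi>] by simp
    qed
  qed measurable
qed

lemma mult_le_sum_power2: "a * b \<le> a\<^sup>2 + (b :: real)\<^sup>2"
  using zero_le_power2[of a] zero_le_power2[of b] zero_le_power2[of "a - b"]
  unfolding power2_diff by linarith

lemma integrable_mult_L2:
  fixes f g :: "'a \<Rightarrow> complex"
  assumes [measurable]: "f \<in> borel_measurable M" "g \<in> borel_measurable M"
    and "integrable M (\<lambda>x. (cmod (f x))\<^sup>2)" "integrable M (\<lambda>x. (cmod (g x))\<^sup>2)"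
  shows "integrable M (\<lambda>x. f x * g x)"
proof (rule Bochner_Integration.integrable_bound[of _ "\<lambda>x. (cmod (f x))\<^sup>2 + (cmod (g x))\<^sup>2"])
  show "AE x in M. norm (f x * g x) \<le> norm ((cmod (f x))\<^sup>2 + (cmod (g x))\<^sup>2)"
    by (auto simp: norm_mult mult_le_sum_power2)
qed (use assms in auto)

theorem plancherel:
  fixes H1 H2 :: "real^'n::finite \<Rightarrow> complex"
  assumes H1: "nice H1" and H2: "nice H2"
  shows "(\<integral>\<xi>. fourier H1 \<xi> * cnj (fourier H2 \<xi>) \<partial>lborel) = (\<integral>x. H1 x * cnj (H2 x) \<partial>lborel)"
proof -
  note [measurable] = nice_measurable[OF H1] nice_measurable[OF H2]
  have int: "integrable lborel (\<lambda>\<xi>. fourier H1 \<xi> * cnj (fourier H2 \<xi>))"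
    by (rule integrable_mult_L2) (use plancherel_L2 H1 H2 in auto)
  have "(\<lambda>k. \<integral>\<xi>. fourier H1 \<xi> * cnj (fourier H2 \<xi>) * complex_of_real (gauss (recip_Suc k *\<^sub>R \<xi>)) \<partial>lborel)
      \<longlonglongrightarrow> (\<integral>\<xi>. fourier H1 \<xi> * cnj (fourier H2 \<xi>) * complex_of_real 1 \<partial>lborel)"
  proof (rule integral_dominated_convergence[where w="\<lambda>\<xi>. cmod (fourier H1 \<xi> * cnj (fourier H2 \<xi>))"])
    show "AE \<xi> in lborel. (\<lambda>k. fourier H1 \<xi> * cnj (fourier H2 \<xi>) * complex_of_real (gauss (recip_Suc k *\<^sub>R \<xi>)))
        \<longlonglongrightarrow> fourier H1 \<xi> * cnj (fourier H2 \<xi>) * complex_of_real 1"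
      by (intro AE_I2 tendsto_intros gauss_recip_Suc_tendsto)
  qed (use integrable_norm[OF int] in \<open>auto simp: norm_mult gauss_le_1 intro!: mult_left_le\<close>)
  from LIMSEQ_unique[OF this plancherel_regularised[OF H1 H2]] show ?thesis by simp
qed

subsection \<open>Schwartz functions\<close>

text \<open>The exponent provides two powers of 1 + |x| per coordinate, so the weight lies below the
  product of the integrable functions 1/(1 + x_i^2).\<close>

definition weight :: "real^'n::finite \<Rightarrow> real" where
  "weight x = 1 / (1 + norm x) ^ (2 * CARD('n))"

lemma weight_pos: "0 < weight x"
  by (auto simp: weight_def intro!: zero_less_power add_pos_nonneg)

lemma weight_nonneg [simp]: "0 \<le> weight x"
  using weight_pos[of x] by simp

lemma weight_le_1: "weight x \<le> 1"
proof -
  have "1 \<le> (1 + norm x) ^ (2 * CARD('a))" by (rule one_le_power) simp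
  then show ?thesis by (auto simp: weight_def divide_le_eq_1 intro: less_le_trans[OF zero_less_one])
qed

lemma weight_minus [simp]: "weight (- x) = weight x"
  by (simp add: weight_def)

lemma measurable_weight [measurable]: "weight \<in> borel_measurable borel"
  unfolding weight_def by measurable

lemma weight_bound_iff:
  fixes x :: "real^'n::finite"
  shows "y \<le> C * weight x \<longleftrightarrow> (1 + norm x) ^ (2 * CARD('n)) * y \<le> C"
proof -
  have "(1 + norm x) ^ (2 * CARD('n)) > 0"
    by (intro zero_less_power add_pos_nonneg) auto
  then show ?thesis by (simp add: weight_def pos_le_divide_eq mult.commute)
qed

lemma integrable_weight: "integrable lborel (weight :: real^'n::finite \<Rightarrow> real)"
proof -
  have "integrable lborel (\<lambda>x::real. inverse (1 + x\<^sup>2))"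
    using integrable_inverse_1_plus_square by (simp add: set_integrable_def einterval_eq)
  then have i: "integrable lborel (\<lambda>x::real^'n. \<Prod>b\<in>Basis. inverse (1 + (x \<bullet> b)\<^sup>2))"
    by (intro lborel_prod_integral(1)[of "\<lambda>_ x. inverse (1 + x\<^sup>2)"])
  show ?thesis
  proof (rule Bochner_Integration.integrable_bound[OF i])
    have "weight x \<le> (\<Prod>b\<in>Basis. inverse (1 + (x \<bullet> b)\<^sup>2))" for x :: "real^'n"
    proof -
      have "weight x = (\<Prod>b\<in>(Basis :: (real^'n) set). inverse ((1 + norm x)\<^sup>2))"
        by (simp add: weight_def power_mult inverse_eq_divide power_one_over)
      also have "\<dots> \<le> (\<Prod>b\<in>Basis. inverse (1 + (x \<bullet> b)\<^sup>2))"
      proof (intro prod_mono conjI)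
        fix b :: "real^'n" assume "b \<in> Basis"
        then have "(x \<bullet> b)\<^sup>2 \<le> (norm x)\<^sup>2"
          using Basis_le_norm[of b x] by (metis abs_ge_zero abs_norm_cancel power2_abs power_mono)
        then show "inverse ((1 + norm x)\<^sup>2) \<le> inverse (1 + (x \<bullet> b)\<^sup>2)"
          by (intro le_imp_inverse_le) (auto simp: power2_sum intro: add_pos_nonneg add_increasing2)
      qed auto
      finally show ?thesis .
    qed
    then show "AE x in lborel. norm (weight (x::real^'n)) \<le> norm (\<Prod>b\<in>Basis. inverse (1 + (x \<bullet> b)\<^sup>2))"
      by (auto simp: abs_prod intro: order_trans[OF _ abs_ge_self])
  qed simp
qed

text \<open>From 1 + |x| \<le> 2 (1 + |x + e|), raised to the power 2n; hence the constant 4^n. It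
  gives a single dominating function for difference quotients with all steps at most 1.\<close>

lemma weight_shift:
  fixes x e :: "real^'n::finite"
  assumes "norm e \<le> 1"
  shows "weight (x + e) \<le> 4 ^ CARD('n) * weight x"
proof -
  have "norm x \<le> norm (x + e) + norm e"
    using norm_triangle_ineq4[of "x + e" e] by simp
  then have "1 + norm x \<le> 2 * (1 + norm (x + e))"
    using assms norm_ge_zero[of "x + e"] unfolding distrib_left by linarith
  then have "(1 + norm x) ^ (2 * CARD('n)) \<le> (2 * (1 + norm (x + e))) ^ (2 * CARD('n))"
    by (intro power_mono) auto
  also have "\<dots> = 4 ^ CARD('n) * (1 + norm (x + e)) ^ (2 * CARD('n))"
    unfolding power_mult_distrib by (simp add: power_mult[of 2 2])
  finally have "(1 + norm x) ^ (2 * CARD('n)) * weight (x + e) \<le> 4 ^ CARD('n) * (1 + norm (x + e)) ^ (2 * CARD('n)) * weight (x + e)"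
    by (intro mult_right_mono) auto
  also have "\<dots> = 4 ^ CARD('n)"
  proof -
    have "(1 + norm (x + e)) \<noteq> 0" using norm_ge_zero[of "x + e"] by linarith
    then show ?thesis by (simp add: weight_def)
  qed
  finally show ?thesis by (simp add: weight_bound_iff)
qed

section \<open>Derivatives under the Fourier transform\<close>

lemma unit_char_difference_quotient:
  "(\<lambda>k. (unit_char (recip_Suc k * c) - 1) / complex_of_real (recip_Suc k)) \<longlonglongrightarrow> 2 * complex_of_real pi * \<i> * complex_of_real c"
proof -
  let ?z = "2 * complex_of_real pi * \<i> * complex_of_real c"
  have "((\<lambda>z. exp (?z * z)) has_field_derivative ?z) (at 0)"
    by (auto intro!: derivative_eq_intros)
  then have "(\<lambda>h. (exp (?z * (0 + h)) - exp (?z * 0)) / h) \<midarrow>0\<rightarrow> ?z"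
    by (rule DERIV_D)
  moreover have "(\<lambda>k. complex_of_real (recip_Suc k)) \<longlonglongrightarrow> 0" "\<And>k. complex_of_real (recip_Suc k) \<noteq> 0"
    using recip_Suc_pos recip_Suc_tendsto by (auto intro: tendsto_of_real_iff[THEN iffD2, of _ 0, simplified] simp: less_imp_neq[symmetric])
  ultimately have "(\<lambda>k. (exp (?z * (0 + complex_of_real (recip_Suc k))) - exp (?z * 0)) / complex_of_real (recip_Suc k)) \<longlonglongrightarrow> ?z"
    unfolding tendsto_at_iff_sequentially o_def by auto
  then show ?thesis
    by (simp add: unit_char_def cis_conv_exp mult_ac)
qed

text \<open>Integration by parts is replaced by translation invariance. The transform of a
  difference quotient of \<open>h\<close> is the difference quotient of a character times
  \<open>fourier h\<close>; dominated convergence on one side and the derivative of the character on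
  the other identify the limit.\<close>

lemma fourier_directional_derivative:
  fixes h :: "real^'n::finite \<Rightarrow> complex"
  assumes D: "\<And>x. (h has_derivative D x) (at x)"
    and e: "norm e = 1" and h': "\<And>x. D x e = h' x" and cont: "continuous_on UNIV h'"
    and hC: "\<And>x. cmod (h x) \<le> C * weight x" and h'C: "\<And>x. cmod (h' x) \<le> C * weight x"
  shows "fourier h' \<xi> = 2 * complex_of_real pi * \<i> * complex_of_real (e \<bullet> \<xi>) * fourier h \<xi>"
proof -
  have conth: "continuous_on UNIV h"
    using D by (meson continuous_at_imp_continuous_on has_derivative_continuous)
  have [measurable]: "h \<in> borel_measurable borel" "h' \<in> borel_measurable borel"
    using conth cont by (auto intro: borel_measurable_continuous_onI)
  have ih: "integrable lborel h"
    by (rule Bochner_Integration.integrable_bound[of _ "\<lambda>x. C * weight x"])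
       (use hC integrable_weight in \<open>auto intro: order_trans[OF _ abs_ge_self]\<close>)
  have C0: "0 \<le> C"
    using order_trans[OF norm_ge_zero hC[of 0]] weight_pos[of "0::real^'n"] by (simp add: zero_le_mult_iff)
  let ?D = "\<lambda>k x. (h (x + recip_Suc k *\<^sub>R e) - h x) / complex_of_real (recip_Suc k)"
  have lim: "(\<lambda>k. ?D k x) \<longlonglongrightarrow> h' x" for x
  proof -
    have bl: "bounded_linear (D x)" using D[of x] by (rule has_derivative_bounded_linear)
    have "(\<lambda>v. norm (h (x + v) - h x - D x v) / norm v) \<midarrow>0\<rightarrow> 0"
      using D[of x] by (simp add: has_derivative_at)
    moreover have "(\<lambda>k. recip_Suc k *\<^sub>R e) \<longlonglongrightarrow> 0"
      using tendsto_scaleR[OF recip_Suc_tendsto tendsto_const[of e]] by simp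
    moreover have "recip_Suc k *\<^sub>R e \<noteq> 0" for k using recip_Suc_pos[of k] e by auto
    ultimately have "(\<lambda>k. norm (h (x + recip_Suc k *\<^sub>R e) - h x - D x (recip_Suc k *\<^sub>R e)) / norm (recip_Suc k *\<^sub>R e)) \<longlonglongrightarrow> 0"
      unfolding tendsto_at_iff_sequentially o_def by (auto simp del: norm_scaleR)
    moreover have "norm (h (x + recip_Suc k *\<^sub>R e) - h x - D x (recip_Suc k *\<^sub>R e)) / norm (recip_Suc k *\<^sub>R e) = norm (?D k x - h' x)" for k
    proof -
      have "D x (recip_Suc k *\<^sub>R e) = complex_of_real (recip_Suc k) * h' x"
        using linear_cmul[OF bounded_linear.linear[OF bl], of "recip_Suc k" e] h' by (simp add: scaleR_conv_of_real)
      moreover have "?D k x - h' x = (h (x + recip_Suc k *\<^sub>R e) - h x - complex_of_real (recip_Suc k) * h' x) / complex_of_real (recip_Suc k)"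
        using recip_Suc_pos[of k] by (simp add: diff_divide_distrib)
      ultimately show ?thesis
        using recip_Suc_pos[of k] e by (simp add: norm_divide)
    qed
    ultimately have "(\<lambda>k. norm (?D k x - h' x)) \<longlonglongrightarrow> 0" by simp
    then show ?thesis by (simp add: tendsto_norm_zero_iff LIM_zero_iff)
  qed
  have bound: "cmod (?D k x) \<le> C * 4 ^ CARD('n) * weight x" for k x
  proof -
    have s: "0 < recip_Suc k" "recip_Suc k \<le> 1" by (simp_all add: recip_Suc_pos) (simp add: recip_Suc_def)
    \<comment> \<open>Mean value inequality along the segment from x to x + e/(k+1). All its points
      are within distance 1 of \<open>x\<close>, so \<open>weight_shift\<close> bounds the
      derivative by a multiple of the weight at \<open>x\<close>.\<close>
    have "norm (h (x + recip_Suc k *\<^sub>R e) - h (x + 0 *\<^sub>R e)) \<le> (C * 4 ^ CARD('n) * weight x) * norm (recip_Suc k - 0)"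
    proof (rule differentiable_bound[of "{0..recip_Suc k}" "\<lambda>s. h (x + s *\<^sub>R e)" "\<lambda>s r. D (x + s *\<^sub>R e) (r *\<^sub>R e)"])
      fix s assume s': "s \<in> {0..recip_Suc k}"
      have "((\<lambda>s. x + s *\<^sub>R e) has_derivative (\<lambda>r. r *\<^sub>R e)) (at s within {0..recip_Suc k})"
        by (auto intro!: derivative_eq_intros)
      from has_derivative_compose[OF this D]
      show "((\<lambda>s. h (x + s *\<^sub>R e)) has_derivative (\<lambda>r. D (x + s *\<^sub>R e) (r *\<^sub>R e))) (at s within {0..recip_Suc k})" .
      show "onorm (\<lambda>r. D (x + s *\<^sub>R e) (r *\<^sub>R e)) \<le> C * 4 ^ CARD('n) * weight x"
      proof (rule onorm_le)
        fix r :: real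
        have "D (x + s *\<^sub>R e) (r *\<^sub>R e) = r *\<^sub>R h' (x + s *\<^sub>R e)"
          using linear_cmul[OF has_derivative_linear[OF D[of "x + s *\<^sub>R e"]], of r e]
          by (simp add: h')
        then have "norm (D (x + s *\<^sub>R e) (r *\<^sub>R e)) = \<bar>r\<bar> * cmod (h' (x + s *\<^sub>R e))" by simp
        also have "\<dots> \<le> \<bar>r\<bar> * (C * weight (x + s *\<^sub>R e))"
          by (intro mult_left_mono h'C) auto
        also have "\<dots> \<le> \<bar>r\<bar> * (C * (4 ^ CARD('n) * weight x))"
          using s' s e C0 by (intro mult_left_mono weight_shift) auto
        finally show "norm (D (x + s *\<^sub>R e) (r *\<^sub>R e)) \<le> C * 4 ^ CARD('n) * weight x * norm r"
          by (simp add: mult_ac)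
      qed
    qed (use s in auto)
    then show ?thesis using s by (simp add: norm_divide pos_divide_le_eq)
  qed
  have "(\<lambda>k. \<integral>x. ?D k x * unit_char (- (x \<bullet> \<xi>)) \<partial>lborel) \<longlonglongrightarrow> fourier h' \<xi>"
    unfolding fourier_unit_char
  proof (rule integral_dominated_convergence[where w="\<lambda>x. C * 4 ^ CARD('n) * weight x"])
    show "AE x in lborel. (\<lambda>k. ?D k x * unit_char (- (x \<bullet> \<xi>))) \<longlonglongrightarrow> h' x * unit_char (- (x \<bullet> \<xi>))"
      by (intro AE_I2 tendsto_mult tendsto_const lim)
    show "AE x in lborel. norm (?D k x * unit_char (- (x \<bullet> \<xi>))) \<le> C * 4 ^ CARD('n) * weight x" for k
      by (rule AE_I2, unfold norm_mult norm_unit_char mult_1_right) (rule bound)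
  qed (use integrable_weight in auto)
  moreover have "(\<integral>x. ?D k x * unit_char (- (x \<bullet> \<xi>)) \<partial>lborel)
      = (unit_char (recip_Suc k * (e \<bullet> \<xi>)) - 1) / complex_of_real (recip_Suc k) * fourier h \<xi>" for k
  proof -
    let ?s = "recip_Suc k"
    have i1: "integrable lborel (\<lambda>x. h x * unit_char (- (x \<bullet> \<xi>)))"
      by (rule integrable_mult_bounded[where C=1, OF ih]) auto
    have i2: "integrable lborel (\<lambda>x. h (x + ?s *\<^sub>R e) * unit_char (- (x \<bullet> \<xi>)))"
      by (rule integrable_mult_bounded[where C=1, OF lborel_preserving_integrable[OF lborel_preserving_add ih]]) auto
    have "(\<integral>x. h (x + ?s *\<^sub>R e) * unit_char (- (x \<bullet> \<xi>)) \<partial>lborel)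
        = (\<integral>x. unit_char (?s * (e \<bullet> \<xi>)) * (h (x + ?s *\<^sub>R e) * unit_char (- ((x + ?s *\<^sub>R e) \<bullet> \<xi>))) \<partial>lborel)"
      by (intro Bochner_Integration.integral_cong refl)
         (simp add: inner_add_left unit_char_add[symmetric] mult.left_commute)
    also have "\<dots> = unit_char (?s * (e \<bullet> \<xi>)) * fourier h \<xi>"
      using lborel_preserving_integral[OF lborel_preserving_add, of "\<lambda>x. h x * unit_char (- (x \<bullet> \<xi>))" "?s *\<^sub>R e"]
      by (simp add: fourier_unit_char)
    finally have eq: "(\<integral>x. h (x + ?s *\<^sub>R e) * unit_char (- (x \<bullet> \<xi>)) \<partial>lborel) = unit_char (?s * (e \<bullet> \<xi>)) * fourier h \<xi>" .
    have "(\<integral>x. ?D k x * unit_char (- (x \<bullet> \<xi>)) \<partial>lborel)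
        = (\<integral>x. (h (x + ?s *\<^sub>R e) * unit_char (- (x \<bullet> \<xi>)) - h x * unit_char (- (x \<bullet> \<xi>))) / complex_of_real ?s \<partial>lborel)"
      by (intro Bochner_Integration.integral_cong refl) (simp add: algebra_simps)
    also have "\<dots> = (unit_char (?s * (e \<bullet> \<xi>)) * fourier h \<xi> - fourier h \<xi>) / complex_of_real ?s"
      using i1 i2 eq by (simp add: fourier_unit_char)
    finally show ?thesis by (simp add: algebra_simps)
  qed
  ultimately have "(\<lambda>k. (unit_char (recip_Suc k * (e \<bullet> \<xi>)) - 1) / complex_of_real (recip_Suc k) * fourier h \<xi>) \<longlonglongrightarrow> fourier h' \<xi>"
    by (simp only:)
  from LIMSEQ_unique[OF this tendsto_mult[OF unit_char_difference_quotient tendsto_const]]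
  show ?thesis by simp
qed

section \<open>Decay of Schwartz functions and of their products\<close>

lemma dderiv_append: "dderiv (vs @ ws) f = dderiv vs (dderiv ws f)"
  by (induction vs) simp_all

lemma schwartz_deriv:
  assumes "schwartz f"
  shows "schwartz (\<lambda>x. frechet_derivative f (at x) e)"
proof -
  have "(\<lambda>x. frechet_derivative f (at x) e) = dderiv [e] f" by simp
  then show ?thesis
    using assms by (simp only: schwartz_def dderiv_append[symmetric]) blast
qed

lemma schwartz_has_derivative:
  assumes "schwartz f"
  shows "(f has_derivative frechet_derivative f (at x)) (at x)"
proof -
  have "dderiv [] f differentiable (at x)"
    using assms unfolding schwartz_def by blast
  then show ?thesis by (simp add: frechet_derivative_works)
qed

lemma schwartz_continuous: "schwartz f \<Longrightarrow> continuous_on S f"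
  by (meson continuous_at_imp_continuous_on has_derivative_continuous schwartz_has_derivative)

lemma schwartz_decay:
  assumes "schwartz f"
  shows "\<exists>C. \<forall>x. (1 + norm x) ^ k * cmod (f x) \<le> C"
  using assms unfolding schwartz_def by (metis dderiv.simps(1))

lemma integrable_weight_bound:
  fixes h :: "real^'n::finite \<Rightarrow> complex"
  assumes [measurable]: "h \<in> borel_measurable borel" and hC: "\<And>x. cmod (h x) \<le> C * weight x"
  shows "integrable lborel h"
  by (rule Bochner_Integration.integrable_bound[of _ "\<lambda>x. C * weight x"])
     (use hC integrable_weight in \<open>auto intro: order_trans[OF _ abs_ge_self]\<close>)

lemma nice_weight_bound:
  fixes h :: "real^'n::finite \<Rightarrow> complex"
  assumes cont: "continuous_on UNIV h" and hC: "\<And>x. cmod (h x) \<le> C * weight x"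
  shows "nice h"
  unfolding nice_def
proof (intro conjI cont exI allI)
  show "integrable lborel h"
    by (rule integrable_weight_bound[OF _ hC]) (use cont in \<open>auto intro: borel_measurable_continuous_onI\<close>)
  show "cmod (h x) \<le> \<bar>C\<bar>" for x
  proof -
    have "cmod (h x) \<le> \<bar>C\<bar> * weight x"
      using hC[of x] mult_right_mono[OF abs_ge_self[of C] weight_nonneg[of x]] by linarith
    also have "\<dots> \<le> \<bar>C\<bar>" by (rule mult_left_le[OF weight_le_1]) simp
    finally show ?thesis .
  qed
qed

lemma schwartz_nice:
  fixes f :: "real^'n::finite \<Rightarrow> complex"
  assumes "schwartz f"
  shows "nice f"
proof -
  obtain C where "\<And>x. (1 + norm x) ^ (2 * CARD('n)) * cmod (f x) \<le> C"
    using schwartz_decay[OF assms] by blast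
  then show ?thesis
    using schwartz_continuous[OF assms] by (intro nice_weight_bound[of f C]) (simp_all add: weight_bound_iff)
qed

text \<open>The Wigner distribution, the ambiguity function and the short-time Fourier transform all
  have the form of a Fourier transform in \<^term>\<open>t\<close> of the following product; the determinant
  condition on the coefficients makes decay in both arguments translate into decay in
  \<^term>\<open>p\<close> and \<^term>\<open>t\<close>.\<close>

definition sesq :: "real \<Rightarrow> real \<Rightarrow> real \<Rightarrow> real \<Rightarrow> (real^'n::finite \<Rightarrow> complex) \<Rightarrow> (real^'n \<Rightarrow> complex)
    \<Rightarrow> real^'n \<Rightarrow> real^'n \<Rightarrow> complex" where
  "sesq \<alpha> a \<beta> b f g p t = f (\<alpha> *\<^sub>R p + a *\<^sub>R t) * cnj (g (\<beta> *\<^sub>R p + b *\<^sub>R t))"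

definition unimodular_coeffs :: "real \<Rightarrow> real \<Rightarrow> real \<Rightarrow> real \<Rightarrow> bool" where
  "unimodular_coeffs \<alpha> a \<beta> b \<longleftrightarrow> \<bar>\<alpha> * b - \<beta> * a\<bar> = 1 \<and> \<bar>\<alpha>\<bar> \<le> 1 \<and> \<bar>a\<bar> \<le> 1 \<and> \<bar>\<beta>\<bar> \<le> 1 \<and> \<bar>b\<bar> \<le> 1"

lemma norm_lincomb_le:
  assumes "\<bar>a\<bar> \<le> 1" "\<bar>b\<bar> \<le> 1"
  shows "norm (b *\<^sub>R x - a *\<^sub>R y) \<le> norm x + norm y"
proof -
  have "norm (b *\<^sub>R x - a *\<^sub>R y) \<le> \<bar>b\<bar> * norm x + \<bar>a\<bar> * norm y"
    by (metis norm_scaleR norm_triangle_ineq4)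
  also have "\<dots> \<le> norm x + norm y"
    using assms by (intro add_mono mult_left_le_one_le) auto
  finally show ?thesis .
qed

text \<open>Let X and Y be the arguments of \<open>f\<close> and \<open>g\<close>. Both p and t are
  controlled by X and Y, so 1 + |p| and 1 + |t| are each at most (1 + |X|)(1 + |Y|). Thus
  \<open>f\<close> and \<open>g\<close> each pay for k powers from p and k from t, which is why
  decay of order 2k is taken from them.\<close>

lemma sesq_decay:
  fixes f g :: "real^'n::finite \<Rightarrow> complex"
  assumes f: "schwartz f" and g: "schwartz g" and u: "unimodular_coeffs \<alpha> a \<beta> b"
  shows "\<exists>C. \<forall>p t. (1 + norm p) ^ k * ((1 + norm t) ^ k * cmod (sesq \<alpha> a \<beta> b f g p t)) \<le> C"
proof -
  obtain Cf where Cf: "\<And>x. (1 + norm x) ^ (2 * k) * cmod (f x) \<le> Cf"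
    using schwartz_decay[OF f] by blast
  obtain Cg where Cg: "\<And>x. (1 + norm x) ^ (2 * k) * cmod (g x) \<le> Cg"
    using schwartz_decay[OF g] by blast
  have "(1 + norm p) ^ k * ((1 + norm t) ^ k * cmod (sesq \<alpha> a \<beta> b f g p t)) \<le> Cf * Cg" for p t
  proof -
    let ?X = "\<alpha> *\<^sub>R p + a *\<^sub>R t" and ?Y = "\<beta> *\<^sub>R p + b *\<^sub>R t"
    \<comment> \<open>Cramer's rule: since the determinant is 1 or -1, these combinations of the two
      arguments return p and t up to sign.\<close>
    have "b *\<^sub>R ?X - a *\<^sub>R ?Y = (\<alpha> * b - \<beta> * a) *\<^sub>R p" "\<beta> *\<^sub>R ?X - \<alpha> *\<^sub>R ?Y = - (\<alpha> * b - \<beta> * a) *\<^sub>R t"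
      by (simp_all add: algebra_simps)
    then have "norm (b *\<^sub>R ?X - a *\<^sub>R ?Y) = norm p" "norm (\<beta> *\<^sub>R ?X - \<alpha> *\<^sub>R ?Y) = norm t"
      using u unfolding unimodular_coeffs_def by (metis norm_scaleR mult_1, metis abs_minus_cancel norm_scaleR mult_1)
    then have "norm p \<le> norm ?X + norm ?Y" "norm t \<le> norm ?X + norm ?Y"
      using u unfolding unimodular_coeffs_def by (metis norm_lincomb_le)+
    moreover have "1 + (norm ?X + norm ?Y) \<le> (1 + norm ?X) * (1 + norm ?Y)"
      by (simp add: algebra_simps)
    ultimately have "1 + norm p \<le> (1 + norm ?X) * (1 + norm ?Y)" "1 + norm t \<le> (1 + norm ?X) * (1 + norm ?Y)"
      by linarith+
    then have "(1 + norm p) ^ k * (1 + norm t) ^ k \<le> ((1 + norm ?X) * (1 + norm ?Y)) ^ k * ((1 + norm ?X) * (1 + norm ?Y)) ^ k"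
      by (intro mult_mono power_mono) auto
    also have "\<dots> = (1 + norm ?X) ^ (2 * k) * (1 + norm ?Y) ^ (2 * k)"
      unfolding mult_2 power_add power_mult_distrib by (simp only: mult_ac)
    finally have "(1 + norm p) ^ k * (1 + norm t) ^ k * cmod (sesq \<alpha> a \<beta> b f g p t)
        \<le> (1 + norm ?X) ^ (2 * k) * (1 + norm ?Y) ^ (2 * k) * cmod (sesq \<alpha> a \<beta> b f g p t)"
      by (intro mult_right_mono) auto
    also have "\<dots> = ((1 + norm ?X) ^ (2 * k) * cmod (f ?X)) * ((1 + norm ?Y) ^ (2 * k) * cmod (g ?Y))"
      by (simp add: sesq_def norm_mult mult_ac)
    also have "\<dots> \<le> Cf * Cg"
      by (intro mult_mono Cf Cg) (auto intro: order_trans[OF _ Cf[of 0]])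
    finally show ?thesis by (simp add: mult_ac)
  qed
  then show ?thesis by blast
qed

lemma sesq_weight:
  fixes f g :: "real^'n::finite \<Rightarrow> complex"
  assumes "schwartz f" "schwartz g" "unimodular_coeffs \<alpha> a \<beta> b"
  shows "\<exists>C. \<forall>p t. (1 + norm p) ^ k * cmod (sesq \<alpha> a \<beta> b f g p t) \<le> C * weight t"
proof -
  \<comment> \<open>Large enough for the requested power of 1 + |p| and for the weight in t.\<close>
  let ?m = "max k (2 * CARD('n))"
  obtain C where C: "\<And>p t. (1 + norm p) ^ ?m * ((1 + norm t) ^ ?m * cmod (sesq \<alpha> a \<beta> b f g p t)) \<le> C"
    using sesq_decay[OF assms] by blast
  have "(1 + norm p) ^ k * cmod (sesq \<alpha> a \<beta> b f g p t) \<le> C * weight t" for p t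
  proof -
    have "(1 + norm t) ^ (2 * CARD('n)) * ((1 + norm p) ^ k * cmod (sesq \<alpha> a \<beta> b f g p t))
        \<le> (1 + norm t) ^ ?m * ((1 + norm p) ^ ?m * cmod (sesq \<alpha> a \<beta> b f g p t))"
      by (intro mult_mono power_increasing) auto
    also have "\<dots> \<le> C" using C[of p t] by (simp add: mult_ac)
    finally show ?thesis by (simp add: weight_bound_iff)
  qed
  then show ?thesis by blast
qed

lemma sesq_continuous:
  assumes "continuous_on UNIV f" "continuous_on UNIV g"
  shows "continuous_on UNIV (sesq \<alpha> a \<beta> b f g p)"
  unfolding sesq_def
  by (intro continuous_intros continuous_on_compose2[OF assms(1)] continuous_on_compose2[OF assms(2)]) auto

lemma sesq_has_derivative:
  assumes f: "schwartz f" and g: "schwartz g"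
  shows "\<exists>D. (sesq \<alpha> a \<beta> b f g p has_derivative D) (at t) \<and>
     (\<forall>e. D e = complex_of_real a * sesq \<alpha> a \<beta> b (\<lambda>x. frechet_derivative f (at x) e) g p t
            + complex_of_real b * sesq \<alpha> a \<beta> b f (\<lambda>x. frechet_derivative g (at x) e) p t)"
proof -
  let ?X = "\<lambda>t. \<alpha> *\<^sub>R p + a *\<^sub>R t" and ?Y = "\<lambda>t. \<beta> *\<^sub>R p + b *\<^sub>R t"
  have X: "(?X has_derivative (\<lambda>v. a *\<^sub>R v)) (at t)" and Y: "(?Y has_derivative (\<lambda>v. b *\<^sub>R v)) (at t)"
    by (auto intro!: derivative_eq_intros)
  have lf: "frechet_derivative f (at x) (a *\<^sub>R e) = complex_of_real a * frechet_derivative f (at x) e" for x e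
    using linear_cmul[OF has_derivative_linear[OF schwartz_has_derivative[OF f]]]
    by (simp add: scaleR_conv_of_real)
  have lg: "frechet_derivative g (at x) (b *\<^sub>R e) = complex_of_real b * frechet_derivative g (at x) e" for x e
    using linear_cmul[OF has_derivative_linear[OF schwartz_has_derivative[OF g]]]
    by (simp add: scaleR_conv_of_real)
  have dX: "((\<lambda>t. f (?X t)) has_derivative (\<lambda>v. frechet_derivative f (at (?X t)) (a *\<^sub>R v))) (at t)"
    by (rule has_derivative_compose[OF X schwartz_has_derivative[OF f]])
  have dY: "((\<lambda>t. cnj (g (?Y t))) has_derivative (\<lambda>v. cnj (frechet_derivative g (at (?Y t)) (b *\<^sub>R v)))) (at t)"
    by (rule bounded_linear.has_derivative[OF bounded_linear_cnj has_derivative_compose[OF Y schwartz_has_derivative[OF g]]])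
  from has_derivative_mult[OF dX dY] show ?thesis
    by (intro exI conjI allI, unfold sesq_def) (auto simp: lf lg algebra_simps)
qed

text \<open>By the product rule a factor of q is exchanged for a derivative of \<open>f\<close> or
  of \<open>g\<close>. Both terms are again of the form \<open>sesq\<close> with Schwartz functions,
  which is what makes an induction possible.\<close>

lemma fourier_sesq_derivative:
  fixes f g :: "real^'n::finite \<Rightarrow> complex"
  assumes f: "schwartz f" and g: "schwartz g" and u: "unimodular_coeffs \<alpha> a \<beta> b" and e: "norm e = 1"
  shows "2 * complex_of_real pi * \<i> * complex_of_real (e \<bullet> q) * fourier (sesq \<alpha> a \<beta> b f g p) q
    = complex_of_real a * fourier (sesq \<alpha> a \<beta> b (\<lambda>x. frechet_derivative f (at x) e) g p) q
      + complex_of_real b * fourier (sesq \<alpha> a \<beta> b f (\<lambda>x. frechet_derivative g (at x) e) p) q"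
proof -
  define f' where "f' = (\<lambda>x. frechet_derivative f (at x) e)"
  define g' where "g' = (\<lambda>x. frechet_derivative g (at x) e)"
  have f': "schwartz f'" and g': "schwartz g'"
    unfolding f'_def g'_def by (intro schwartz_deriv f g)+
  note cont = schwartz_continuous[OF f] schwartz_continuous[OF f'] schwartz_continuous[OF g] schwartz_continuous[OF g']
  let ?h = "sesq \<alpha> a \<beta> b f g p" and ?h1 = "sesq \<alpha> a \<beta> b f' g p" and ?h2 = "sesq \<alpha> a \<beta> b f g' p"
  let ?h' = "\<lambda>t. complex_of_real a * ?h1 t + complex_of_real b * ?h2 t"
  obtain C0 where C0: "\<And>t. cmod (?h t) \<le> C0 * weight t"
    using sesq_weight[OF f g u, of 0] by auto
  obtain C1 where C1: "\<And>t. cmod (?h1 t) \<le> C1 * weight t"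
    using sesq_weight[OF f' g u, of 0] by auto
  obtain C2 where C2: "\<And>t. cmod (?h2 t) \<le> C2 * weight t"
    using sesq_weight[OF f g' u, of 0] by auto
  obtain D where D: "\<And>t. (?h has_derivative D t) (at t)" "\<And>t. D t e = ?h' t"
    using sesq_has_derivative[OF f g, of \<alpha> a \<beta> b p] unfolding f'_def g'_def by metis
  have c12: "continuous_on UNIV ?h1" "continuous_on UNIV ?h2"
    by (intro sesq_continuous cont)+
  have i12: "integrable lborel ?h1" "integrable lborel ?h2"
    using nice_weight_bound[OF c12(1) C1] nice_weight_bound[OF c12(2) C2] by (auto intro: nice_integrable)
  have nn: "0 \<le> C" if "\<And>t. cmod (h t) \<le> C * weight t" for h :: "real^'n \<Rightarrow> complex" and C
    using order_trans[OF norm_ge_zero that[of 0]] weight_pos[of "0::real^'n"] by (simp add: zero_le_mult_iff)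
  have h'b: "cmod (?h' t) \<le> (C0 + C1 + C2) * weight t" for t
  proof -
    have ab: "\<bar>a\<bar> \<le> 1" "\<bar>b\<bar> \<le> 1" using u by (auto simp: unimodular_coeffs_def)
    have "cmod (?h' t) \<le> \<bar>a\<bar> * cmod (?h1 t) + \<bar>b\<bar> * cmod (?h2 t)"
      by (rule order_trans[OF norm_triangle_ineq]) (simp add: norm_mult)
    also have "\<dots> \<le> 1 * (C1 * weight t) + 1 * (C2 * weight t)"
      using ab C1 C2 by (intro add_mono mult_mono) auto
    also have "\<dots> \<le> (C0 + C1 + C2) * weight t"
      using nn[OF C0] weight_nonneg[of t] by (simp add: algebra_simps)
    finally show ?thesis .
  qed
  have "fourier ?h' q = 2 * complex_of_real pi * \<i> * complex_of_real (e \<bullet> q) * fourier ?h q"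
  proof (rule fourier_directional_derivative[OF D(1) e D(2), where C="C0 + C1 + C2"])
    show "continuous_on UNIV ?h'" by (intro continuous_intros c12)
    show "cmod (?h t) \<le> (C0 + C1 + C2) * weight t" for t
    proof -
      have "0 \<le> C1 * weight t" "0 \<le> C2 * weight t" using nn[OF C1] nn[OF C2] by auto
      then show ?thesis using C0[of t] unfolding distrib_right by linarith
    qed
  qed (rule h'b)
  moreover have "fourier ?h' q = complex_of_real a * fourier ?h1 q + complex_of_real b * fourier ?h2 q"
  proof -
    have "integrable lborel (\<lambda>t. ?h1 t * unit_char (- (t \<bullet> q)))" "integrable lborel (\<lambda>t. ?h2 t * unit_char (- (t \<bullet> q)))"
      by (rule integrable_mult_bounded[where C=1]; use i12 in simp)+
    then show ?thesis
      unfolding fourier_unit_char by (simp add: distrib_right mult.assoc)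
  qed
  ultimately show ?thesis unfolding f'_def g'_def by simp
qed

text \<open>Induction on the power of 1 + |q|, for all Schwartz \<open>f\<close> and
  \<open>g\<close> at once, because each further power costs a derivative of one of them. The bound
  1 + |q| \<le> 1 + sum |q_i| reduces a power of the norm to single coordinates.\<close>

lemma fourier_sesq_decay:
  fixes f g :: "real^'n::finite \<Rightarrow> complex"
  assumes f: "schwartz f" and g: "schwartz g" and u: "unimodular_coeffs \<alpha> a \<beta> b"
  shows "\<exists>C. \<forall>p q. (1 + norm p) ^ m * ((1 + norm q) ^ k * cmod (fourier (sesq \<alpha> a \<beta> b f g p) q)) \<le> C"
  using f g
proof (induction k arbitrary: f g)
  case 0
  obtain C where C: "\<And>p t. (1 + norm p) ^ m * cmod (sesq \<alpha> a \<beta> b f g p t) \<le> C * weight t"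
    using sesq_weight[OF 0 u] by blast
  have "(1 + norm p) ^ m * cmod (fourier (sesq \<alpha> a \<beta> b f g p) q) \<le> C * (\<integral>t. weight (t :: real^'n) \<partial>lborel)" for p q
  proof -
    have "cmod (complex_of_real ((1 + norm p) ^ m) * fourier (sesq \<alpha> a \<beta> b f g p) q)
        = cmod (\<integral>t. complex_of_real ((1 + norm p) ^ m) * (sesq \<alpha> a \<beta> b f g p t * unit_char (- (t \<bullet> q))) \<partial>lborel)"
      unfolding fourier_unit_char by simp
    also have "\<dots> \<le> (\<integral>t. C * weight (t :: real^'n) \<partial>lborel)"
      by (rule norm_integral_le) (use C integrable_weight in \<open>auto simp: norm_mult norm_power simp del: of_real_add\<close>)
    finally show ?thesis by (simp add: norm_mult norm_power del: of_real_add)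
  qed
  then show ?case by auto
next
  case (Suc k)
  let ?I = "\<lambda>f g p q. fourier (sesq \<alpha> a \<beta> b f g p) q"
  let ?d = "\<lambda>f i x. frechet_derivative f (at x) (axis i 1)"
  obtain C0 where C0: "\<And>p q. (1 + norm p) ^ m * ((1 + norm q) ^ k * cmod (?I f g p q)) \<le> C0"
    using Suc.IH[OF Suc.prems] by blast
  have "\<forall>i. \<exists>C. \<forall>p q. (1 + norm p) ^ m * ((1 + norm q) ^ k * cmod (?I (?d f i) g p q)) \<le> C"
    by (intro allI Suc.IH schwartz_deriv Suc.prems)
  then obtain C1 where C1: "\<And>i p q. (1 + norm p) ^ m * ((1 + norm q) ^ k * cmod (?I (?d f i) g p q)) \<le> C1 i"
    by metis
  have "\<forall>i. \<exists>C. \<forall>p q. (1 + norm p) ^ m * ((1 + norm q) ^ k * cmod (?I f (?d g i) p q)) \<le> C"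
    by (intro allI Suc.IH schwartz_deriv Suc.prems)
  then obtain C2 where C2: "\<And>i p q. (1 + norm p) ^ m * ((1 + norm q) ^ k * cmod (?I f (?d g i) p q)) \<le> C2 i"
    by metis
  have "(1 + norm p) ^ m * ((1 + norm q) ^ Suc k * cmod (?I f g p q)) \<le> C0 + (\<Sum>i\<in>UNIV. C1 i + C2 i)" for p q
  proof -
    let ?w = "(1 + norm p) ^ m * (1 + norm q) ^ k"
    have w: "0 \<le> ?w" by simp
    have ab: "\<bar>a\<bar> \<le> 1" "\<bar>b\<bar> \<le> 1" using u by (auto simp: unimodular_coeffs_def)
    have coord: "?w * (\<bar>q $ i\<bar> * cmod (?I f g p q)) \<le> C1 i + C2 i" for i
    proof -
      have "\<bar>q $ i\<bar> * cmod (?I f g p q) \<le> 2 * pi * \<bar>q $ i\<bar> * cmod (?I f g p q)"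
        using pi_ge_two by (intro mult_right_mono) (auto simp: mult_ge1_I intro: mult_right_mono[of 1 "2 * pi", simplified])
      also have "\<dots> = cmod (2 * complex_of_real pi * \<i> * complex_of_real (axis i 1 \<bullet> q) * ?I f g p q)"
        by (simp add: norm_mult inner_axis')
      also have "\<dots> \<le> \<bar>a\<bar> * cmod (?I (?d f i) g p q) + \<bar>b\<bar> * cmod (?I f (?d g i) p q)"
        by (subst fourier_sesq_derivative[OF Suc.prems u]) (auto simp: norm_mult intro: order_trans[OF norm_triangle_ineq])
      also have "\<dots> \<le> 1 * cmod (?I (?d f i) g p q) + 1 * cmod (?I f (?d g i) p q)"
        using ab by (intro add_mono mult_right_mono) auto
      finally have "?w * (\<bar>q $ i\<bar> * cmod (?I f g p q)) \<le> ?w * (1 * cmod (?I (?d f i) g p q) + 1 * cmod (?I f (?d g i) p q))"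
        using w by (rule mult_left_mono)
      also have "\<dots> \<le> C1 i + C2 i"
        using C1[of p q i] C2[of p q i] by (simp add: distrib_left mult.assoc)
      finally show ?thesis .
    qed
    have "(1 + norm p) ^ m * ((1 + norm q) ^ Suc k * cmod (?I f g p q)) = ?w * ((1 + norm q) * cmod (?I f g p q))"
      by (simp add: mult_ac)
    also have "\<dots> \<le> ?w * ((1 + (\<Sum>i\<in>UNIV. \<bar>q $ i\<bar>)) * cmod (?I f g p q))"
      using w by (intro mult_left_mono mult_right_mono add_left_mono norm_le_l1_cart) auto
    also have "\<dots> = ?w * cmod (?I f g p q) + (\<Sum>i\<in>UNIV. ?w * (\<bar>q $ i\<bar> * cmod (?I f g p q)))"
      by (simp add: distrib_right distrib_left sum_distrib_left sum_distrib_right)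
    also have "\<dots> \<le> C0 + (\<Sum>i\<in>UNIV. C1 i + C2 i)"
      using C0[of p q] coord by (intro add_mono sum_mono) (auto simp: mult.assoc)
    finally show ?thesis .
  qed
  then show ?case by blast
qed

lemma fourier_sesq_weight:
  fixes f g :: "real^'n::finite \<Rightarrow> complex"
  assumes "schwartz f" "schwartz g" "unimodular_coeffs \<alpha> a \<beta> b"
  shows "\<exists>C. \<forall>p q. cmod (fourier (sesq \<alpha> a \<beta> b f g p) q) \<le> C * (weight p * weight q)"
proof -
  let ?m = "2 * CARD('n)"
  obtain C where C: "\<And>p q. (1 + norm p) ^ ?m * ((1 + norm q) ^ ?m * cmod (fourier (sesq \<alpha> a \<beta> b f g p) q)) \<le> C"
    using fourier_sesq_decay[OF assms] by blast
  have "cmod (fourier (sesq \<alpha> a \<beta> b f g p) q) \<le> (C * weight p) * weight q" for p q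
    unfolding weight_bound_iff[of _ "C * weight p"] using C[of p q] by (subst weight_bound_iff)
  then show ?thesis by (auto simp: mult.assoc)
qed

lemma integrable_weight_joinv:
  "integrable lborel (\<lambda>z :: real^('a::finite + 'b::finite). weight (fstv z) * weight (sndv z))"
  by (rule integrable_tensor[OF integrable_weight integrable_weight])

subsection \<open>The ambiguity function\<close>

lemma lborel_preserving_reflect: "lborel_preserving (\<lambda>y::'a::euclidean_space. x - y)"
  using lborel_preserving_affine[of "-1" x] by simp

lemma nice_mult:
  assumes f: "nice f" and g: "nice g"
  shows "nice (\<lambda>x. f x * g x)"
proof -
  obtain C D where C: "\<And>x. cmod (f x) \<le> C" and D: "\<And>x. cmod (g x) \<le> D"
    using nice_bounded[OF f] nice_bounded[OF g] by blast
  have "0 \<le> C" using order_trans[OF norm_ge_zero C[of 0]] .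
  then have "cmod (f x * g x) \<le> C * D" for x
    unfolding norm_mult using C D by (intro mult_mono) auto
  moreover have "integrable lborel (\<lambda>x. f x * g x)"
    by (rule integrable_mult_bounded[OF nice_integrable[OF f] _ D]) (use g in measurable)
  ultimately show ?thesis
    using f g by (auto simp: nice_def intro!: continuous_intros)
qed

lemma nice_shift:
  assumes f: "nice f"
  shows "nice (\<lambda>x. f (x + c))"
  unfolding nice_def
proof (intro conjI)
  show "continuous_on UNIV (\<lambda>x. f (x + c))"
    by (rule continuous_on_compose2[OF nice_continuous[OF f, of UNIV]]) (auto intro!: continuous_intros)
  show "\<exists>C. \<forall>x. cmod (f (x + c)) \<le> C" using nice_bounded[OF f] by blast
  show "integrable lborel (\<lambda>x. f (x + c))"
    by (rule lborel_preserving_integrable[OF lborel_preserving_add nice_integrable[OF f]])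
qed

lemma nice_cnj: "nice f \<Longrightarrow> nice (\<lambda>x. cnj (f x))"
  by (auto simp: nice_def intro!: continuous_intros)

lemma nice_phase:
  assumes f: "nice f" and c: "continuous_on UNIV c" "\<And>x. cmod (c x) \<le> 1"
  shows "nice (\<lambda>x. c x * f x)"
proof -
  obtain C where C: "\<And>x. cmod (f x) \<le> C" using nice_bounded[OF f] by blast
  have "cmod (c x * f x) \<le> C" for x
    using mult_mono[OF c(2)[of x] C[of x]] by (simp add: norm_mult)
  moreover have "integrable lborel (\<lambda>x. c x * f x)"
    by (rule integrable_mult_bounded(2)[OF nice_integrable[OF f] _ c(2)])
       (use c(1) in \<open>auto intro: borel_measurable_continuous_onI\<close>)
  ultimately show ?thesis
    using f c by (auto simp: nice_def intro!: continuous_intros)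
qed

lemma nice_L2:
  assumes f: "nice f"
  shows "L2 f"
proof -
  have "integrable lborel (\<lambda>x. f x * cnj (f x))"
    using nice_integrable[OF nice_mult[OF f nice_cnj[OF f]]] .
  then have "integrable lborel (\<lambda>x. complex_of_real ((cmod (f x))\<^sup>2))"
    by (simp only: complex_norm_square)
  then have "integrable lborel (\<lambda>x. Re (complex_of_real ((cmod (f x))\<^sup>2)))"
    by (rule integrable_Re)
  then show ?thesis using f by (auto simp: L2_def)
qed

text \<open>The usual cross-ambiguity function up to the sign and order of its variables: the first
  block is the frequency and the second the displacement, with \<open>g\<close> displaced forward.
  With this arrangement it is exactly the Fourier transform of the Wigner distribution.\<close>

definition amb :: "(real^'d::finite \<Rightarrow> complex) \<Rightarrow> (real^'d \<Rightarrow> complex) \<Rightarrow> real^('d + 'd) \<Rightarrow> complex" where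
  "amb f g \<zeta> = fourier (sesq (-1/2) 1 (1/2) 1 f g (sndv \<zeta>)) (fstv \<zeta>)"

lemma nice_sesq_1:
  assumes f: "nice f" and g: "nice g"
  shows "nice (sesq \<alpha> 1 \<beta> 1 f g p)"
  using nice_mult[OF nice_shift[OF f, of "\<alpha> *\<^sub>R p"] nice_cnj[OF nice_shift[OF g, of "\<beta> *\<^sub>R p"]]]
  by (simp add: sesq_def[abs_def] add.commute)

text \<open>After this translation \<open>f\<close> no longer depends on \<zeta>, so |f| times a
  bound for |g| dominates the integrand uniformly in \<zeta>. Continuity and boundedness of
  \<open>amb\<close> follow.\<close>

lemma amb_centred:
  assumes f: "nice f" and g: "nice g"
  shows "amb f g \<zeta> = (\<integral>x. f x * cnj (g (x + sndv \<zeta>)) * unit_char (- ((x + (1/2) *\<^sub>R sndv \<zeta>) \<bullet> fstv \<zeta>)) \<partial>lborel)"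
proof -
  note [measurable] = nice_measurable[OF f] nice_measurable[OF g]
  let ?v = "sndv \<zeta>" and ?u = "fstv \<zeta>"
  let ?h = "\<lambda>x. f x * cnj (g (x + ?v)) * unit_char (- ((x + (1/2) *\<^sub>R ?v) \<bullet> ?u))"
  have "(\<integral>x. ?h x \<partial>lborel) = (\<integral>x. ?h (x - (1/2) *\<^sub>R ?v) \<partial>lborel)"
    by (rule lborel_preserving_integral[OF lborel_preserving_diff, symmetric]) measurable
  also have "\<dots> = amb f g \<zeta>"
    unfolding amb_def fourier_unit_char sesq_def
  proof (intro Bochner_Integration.integral_cong refl)
    fix x
    have "x - (1/2) *\<^sub>R ?v + ?v = (1/2) *\<^sub>R ?v + 1 *\<^sub>R x"
      by (simp add: vec_eq_iff field_simps)
    then show "?h (x - (1/2) *\<^sub>R ?v)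
        = f ((-1/2) *\<^sub>R ?v + 1 *\<^sub>R x) * cnj (g ((1/2) *\<^sub>R ?v + 1 *\<^sub>R x)) * unit_char (- (x \<bullet> ?u))"
      by (simp only:) simp
  qed
  finally show ?thesis by simp
qed

lemma amb_continuous_bounded:
  assumes f: "nice f" and g: "nice g"
  shows "continuous_on UNIV (amb f g)" and "\<exists>C. \<forall>\<zeta>. cmod (amb f g \<zeta>) \<le> C"
proof -
  note [measurable] = nice_measurable[OF f] nice_measurable[OF g]
  obtain C where C: "\<And>x. cmod (g x) \<le> C" using nice_bounded[OF g] by blast
  let ?h = "\<lambda>\<zeta> x. f x * cnj (g (x + sndv \<zeta>)) * unit_char (- ((x + (1/2) *\<^sub>R sndv \<zeta>) \<bullet> fstv \<zeta>))"
  have eq: "amb f g = (\<lambda>\<zeta>. \<integral>x. ?h \<zeta> x \<partial>lborel)"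
    by (rule ext, rule amb_centred[OF f g])
  have bound: "cmod (?h \<zeta> x) \<le> cmod (f x) * C" for \<zeta> x
    using mult_left_mono[OF C norm_ge_zero] by (simp add: norm_mult)
  have int: "integrable lborel (\<lambda>x. cmod (f x) * C)"
    using nice_integrable[OF f] by simp
  show "continuous_on UNIV (amb f g)"
    unfolding eq
  proof (rule continuous_on_integral_dominated[OF _ _ int bound])
    show "continuous_on UNIV (\<lambda>\<zeta>. ?h \<zeta> x)" for x
      by (intro continuous_intros continuous_on_compose2[OF nice_continuous[OF g, of UNIV]]) auto
  qed measurable
  show "\<exists>C. \<forall>\<zeta>. cmod (amb f g \<zeta>) \<le> C"
    unfolding eq by (intro exI[of _ "\<integral>x. cmod (f x) * C \<partial>lborel"] allI norm_integral_le[OF int bound])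
qed

lemma nice_amb:
  assumes "nice f" "nice g" "integrable lborel (amb f g)"
  shows "nice (amb f g)"
  using amb_continuous_bounded[OF assms(1,2)] assms(3) by (simp add: nice_def)

text \<open>Plancherel in the frequency block for each displacement, then the shear (x, v) to (x, x
  + v) separates the variables. Fubini is justified by integrability of one ambiguity function and
  boundedness of the other.\<close>

lemma amb_inner:
  assumes f: "nice f" and g: "nice g" and f': "nice f'" and g': "nice g'"
    and i: "integrable lborel (amb f g)"
  shows "(\<integral>\<zeta>. amb f g \<zeta> * cnj (amb f' g' \<zeta>) \<partial>lborel)
     = (\<integral>x. f x * cnj (f' x) \<partial>lborel) * (\<integral>y. cnj (g y) * g' y \<partial>lborel)"
proof -
  note [measurable] = nice_measurable[OF f] nice_measurable[OF g] nice_measurable[OF f'] nice_measurable[OF g']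
  let ?s = "\<lambda>f g v. sesq (-1/2) 1 (1/2) 1 f g v"
  let ?k = "\<lambda>x. f x * cnj (f' x)" and ?l = "\<lambda>y. cnj (g y) * g' y"
  obtain C where C: "\<And>\<zeta>. cmod (cnj (amb f' g' \<zeta>)) \<le> C"
    using amb_continuous_bounded(2)[OF f' g'] by auto
  have "integrable lborel (\<lambda>\<zeta>. amb f g \<zeta> * cnj (amb f' g' \<zeta>))"
    by (rule integrable_mult_bounded[OF i _ C])
       (use amb_continuous_bounded(1)[OF f' g'] in \<open>auto intro!: borel_measurable_continuous_onI continuous_intros\<close>)
  from integral_joinv(2)[OF this]
  have "(\<integral>\<zeta>. amb f g \<zeta> * cnj (amb f' g' \<zeta>) \<partial>lborel)
      = (\<integral>v. \<integral>u. fourier (?s f g v) u * cnj (fourier (?s f' g' v) u) \<partial>lborel \<partial>lborel)"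
    by (simp add: amb_def)
  also have "\<dots> = (\<integral>v. \<integral>x. ?s f g v x * cnj (?s f' g' v x) \<partial>lborel \<partial>lborel)"
    by (intro Bochner_Integration.integral_cong refl plancherel nice_sesq_1 f g f' g')
  also have "\<dots> = (\<integral>v. \<integral>x. ?k x * ?l (x + v) \<partial>lborel \<partial>lborel)"
  proof (rule Bochner_Integration.integral_cong[OF refl])
    fix v
    have "(\<integral>x. ?k x * ?l (x + v) \<partial>lborel) = (\<integral>x. ?k (x - (1/2) *\<^sub>R v) * ?l (x - (1/2) *\<^sub>R v + v) \<partial>lborel)"
      by (rule lborel_preserving_integral[OF lborel_preserving_diff, symmetric]) measurable
    also have "\<dots> = (\<integral>x. ?s f g v x * cnj (?s f' g' v x) \<partial>lborel)"
    proof (rule Bochner_Integration.integral_cong[OF refl])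
      fix x
      have "x - (1/2) *\<^sub>R v + v = (1/2) *\<^sub>R v + 1 *\<^sub>R x"
        by (simp add: vec_eq_iff field_simps)
      then show "?k (x - (1/2) *\<^sub>R v) * ?l (x - (1/2) *\<^sub>R v + v) = ?s f g v x * cnj (?s f' g' v x)"
        by (simp only:) (simp add: sesq_def mult_ac)
    qed
    finally show "(\<integral>x. ?s f g v x * cnj (?s f' g' v x) \<partial>lborel) = (\<integral>x. ?k x * ?l (x + v) \<partial>lborel)" ..
  qed
  also have "\<dots> = (\<integral>x. ?k x \<partial>lborel) * (\<integral>y. ?l y \<partial>lborel)"
  proof -
    have ik: "integrable lborel ?k" and il: "integrable lborel ?l"
      by (intro nice_integrable nice_mult nice_cnj f f' g g')+
    let ?S = "\<lambda>z. joinv (fstv z) (sndv z + fstv z)"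
    have S: "lborel_preserving ?S" by (rule lborel_preserving_shear2) simp
    let ?t = "\<lambda>z. ?k (fstv z) * ?l (sndv z)"
    have it: "integrable lborel ?t" by (rule integrable_tensor[OF ik il])
    have iS: "integrable lborel (\<lambda>z. ?t (?S z))"
      by (rule lborel_preserving_integrable[OF S it])
    have "(\<integral>v. \<integral>x. ?k x * ?l (x + v) \<partial>lborel \<partial>lborel) = (\<integral>z. ?t (?S z) \<partial>lborel)"
      unfolding integral_joinv(2)[OF iS] by (simp add: add.commute)
    also have "\<dots> = (\<integral>z. ?t z \<partial>lborel)"
      by (rule lborel_preserving_integral[OF S]) measurable
    also have "\<dots> = (\<integral>x. ?k x \<partial>lborel) * (\<integral>y. ?l y \<partial>lborel)"
      unfolding integral_joinv(1)[OF it] by simp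
    finally show ?thesis .
  qed
  finally show ?thesis .
qed

lemma rho_unit_char:
  "rho w F t = unit_char (- (fstv w \<bullet> sndv w) / 2) * unit_char (sndv w \<bullet> t) * F (t - fstv w)"
  unfolding rho_def by (simp only: exp_unit_char)

lemma nice_rho:
  assumes "nice f"
  shows "nice (rho w f)"
  unfolding rho_unit_char[abs_def]
  by (intro nice_phase) (use nice_shift[OF assms, of "- fstv w"] in \<open>auto intro!: continuous_intros simp: norm_mult\<close>)

text \<open>A pair of phase-space shifts acts on the ambiguity function as one translation and a
  phase affine in \<zeta>. The translation vector is the lower half of the image of the shift under
  a covariant matrix.\<close>

lemma amb_rho:
  fixes f g :: "real^'d::finite \<Rightarrow> complex"
  assumes f: "nice f" and g: "nice g"
  shows "amb (rho (joinv p1 q1) f) (rho (joinv p2 (- q2)) g) \<zeta>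
    = unit_char (((p1 \<bullet> q2 + p2 \<bullet> q1) - fstv \<zeta> \<bullet> (p1 + p2) + sndv \<zeta> \<bullet> (q2 - q1)) / 2)
      * amb f g (\<zeta> - joinv (q1 + q2) (p2 - p1))"
proof -
  note [measurable] = nice_measurable[OF f] nice_measurable[OF g]
  define u v where "u = fstv \<zeta>" and "v = sndv \<zeta>"
  \<comment> \<open>The midpoint of the two translations: recentring the integration variable there
    leaves only their difference, which is absorbed in the displacement.\<close>
  define c where "c = (1/2) *\<^sub>R (p1 + p2)"
  let ?h = "\<lambda>x. sesq (-1/2) 1 (1/2) 1 f g (v - (p2 - p1)) x * unit_char (- (x \<bullet> (u - (q1 + q2))))"
  let ?E = "unit_char (((p1 \<bullet> q2 + p2 \<bullet> q1) - u \<bullet> (p1 + p2) + v \<bullet> (q2 - q1)) / 2)"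
  have "amb (rho (joinv p1 q1) f) (rho (joinv p2 (- q2)) g) \<zeta>
      = (\<integral>x. sesq (-1/2) 1 (1/2) 1 (rho (joinv p1 q1) f) (rho (joinv p2 (- q2)) g) v x * unit_char (- (x \<bullet> u)) \<partial>lborel)"
    by (simp add: amb_def fourier_unit_char u_def v_def)
  also have "\<dots> = (\<integral>x. ?E * ?h (x - c) \<partial>lborel)"
  proof (rule Bochner_Integration.integral_cong[OF refl])
    fix x
    have e1: "(-1/2) *\<^sub>R v + 1 *\<^sub>R x - p1 = (-1/2) *\<^sub>R (v - (p2 - p1)) + 1 *\<^sub>R (x - c)"
      and e2: "(1/2) *\<^sub>R v + 1 *\<^sub>R x - p2 = (1/2) *\<^sub>R (v - (p2 - p1)) + 1 *\<^sub>R (x - c)"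
      by (simp_all add: c_def vec_eq_iff field_simps)
    have e3: "- (p1 \<bullet> q1) / 2 + q1 \<bullet> ((-1/2) *\<^sub>R v + 1 *\<^sub>R x) + (- (- (p2 \<bullet> (- q2)) / 2) + - ((- q2) \<bullet> ((1/2) *\<^sub>R v + 1 *\<^sub>R x)))
        + (- (x \<bullet> u))
      = ((p1 \<bullet> q2 + p2 \<bullet> q1) - u \<bullet> (p1 + p2) + v \<bullet> (q2 - q1)) / 2 + (- ((x - c) \<bullet> (u - (q1 + q2))))"
      by (simp add: c_def inner_add_left inner_add_right inner_diff_left inner_diff_right inner_commute field_simps)
    have "sesq (-1/2) 1 (1/2) 1 (rho (joinv p1 q1) f) (rho (joinv p2 (- q2)) g) v x * unit_char (- (x \<bullet> u))
      = unit_char (- (p1 \<bullet> q1) / 2 + q1 \<bullet> ((-1/2) *\<^sub>R v + 1 *\<^sub>R x) + (- (- (p2 \<bullet> (- q2)) / 2) + - ((- q2) \<bullet> ((1/2) *\<^sub>R v + 1 *\<^sub>R x)))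
        + (- (x \<bullet> u))) * (f ((-1/2) *\<^sub>R v + 1 *\<^sub>R x - p1) * cnj (g ((1/2) *\<^sub>R v + 1 *\<^sub>R x - p2)))"
      unfolding unit_char_add sesq_def rho_unit_char fstv_joinv sndv_joinv complex_cnj_mult cnj_unit_char
      by (simp only: mult_ac)
    also have "\<dots> = ?E * ?h (x - c)"
      unfolding e1 e2 e3 unit_char_add sesq_def by (simp only: mult_ac)
    finally show "sesq (-1/2) 1 (1/2) 1 (rho (joinv p1 q1) f) (rho (joinv p2 (- q2)) g) v x * unit_char (- (x \<bullet> u))
      = ?E * ?h (x - c)" .
  qed
  also have "\<dots> = ?E * (\<integral>x. ?h (x - c) \<partial>lborel)"
    by simp
  also have "(\<integral>x. ?h (x - c) \<partial>lborel) = (\<integral>x. ?h x \<partial>lborel)"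
    by (rule lborel_preserving_integral[OF lborel_preserving_diff]) (unfold sesq_def, measurable)
  also have "\<dots> = amb f g (\<zeta> - joinv (q1 + q2) (p2 - p1))"
    by (simp add: amb_def fourier_unit_char u_def v_def)
  finally show ?thesis by (simp add: u_def v_def)
qed

lemma integrable_amb_rho:
  assumes f: "nice f" and g: "nice g" and i: "integrable lborel (amb f g)"
  shows "integrable lborel (amb (rho (joinv p1 q1) f) (rho (joinv p2 (- q2)) g))"
proof -
  have "integrable lborel (\<lambda>\<zeta>. amb f g (\<zeta> - joinv (q1 + q2) (p2 - p1)))"
    by (rule lborel_preserving_integrable[OF lborel_preserving_diff i])
  then show ?thesis
    unfolding amb_rho[OF f g, abs_def]
    by (rule integrable_mult_bounded(2)[where C=1]) auto
qed

subsection \<open>The explicit form of the operator on tensor products\<close>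

definition chirp :: "real^'n::finite^'n \<Rightarrow> real^'n \<Rightarrow> complex" where
  "chirp B \<zeta> = unit_char (- (\<zeta> \<bullet> (B *v \<zeta>)) / 2)"

text \<open>The map T of the overview. Expressing it through \<open>amb\<close> makes its properties
  available whenever \<open>f\<close> and \<open>g\<close> are \<open>nice\<close> and
  \<open>amb f g\<close> is integrable; these conditions pass to shifted functions by
  \<open>nice_rho\<close> and \<open>integrable_amb_rho\<close>.\<close>

definition chirp_op :: "real^('d::finite + 'd)^('d + 'd) \<Rightarrow> (real^'d \<Rightarrow> complex) \<Rightarrow> (real^'d \<Rightarrow> complex)
    \<Rightarrow> real^('d + 'd) \<Rightarrow> complex" where
  "chirp_op B f g = inv_fourier (\<lambda>\<zeta>. chirp B \<zeta> * amb f g \<zeta>)"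

lemma norm_chirp [simp]: "cmod (chirp B \<zeta>) = 1"
  by (simp add: chirp_def)

lemma continuous_on_chirp: "continuous_on S (chirp B)"
  unfolding chirp_def by (intro continuous_intros matrix_vector_mult_linear_continuous_on) auto

lemma nice_chirp_amb:
  assumes "nice f" "nice g" "integrable lborel (amb f g)"
  shows "nice (\<lambda>\<zeta>. chirp B \<zeta> * amb f g \<zeta>)"
  by (intro nice_phase nice_amb assms continuous_on_chirp) simp

lemma continuous_on_chirp_op:
  assumes "nice f" "nice g" "integrable lborel (amb f g)"
  shows "continuous_on UNIV (chirp_op B f g)"
proof -
  have "continuous_on UNIV (\<lambda>z. fourier (\<lambda>\<zeta>. chirp B \<zeta> * amb f g \<zeta>) (- z))"
    by (rule continuous_on_compose2[OF continuous_on_fourier[OF nice_integrable[OF nice_chirp_amb[OF assms]], of UNIV]])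
       (auto intro!: continuous_intros)
  then show ?thesis by (simp add: chirp_op_def inv_fourier_eq_fourier[abs_def])
qed

lemma bounded_chirp_op:
  assumes "nice f" "nice g" "integrable lborel (amb f g)"
  shows "\<exists>C. \<forall>z. cmod (chirp_op B f g z) \<le> C"
  unfolding chirp_op_def inv_fourier_eq_fourier
  using norm_fourier_le[OF nice_integrable[OF nice_chirp_amb[OF assms]]] by blast

lemma L2_chirp_op:
  assumes "nice f" "nice g" "integrable lborel (amb f g)"
  shows "L2 (chirp_op B f g)"
proof -
  have "integrable lborel (\<lambda>z. (cmod (fourier (\<lambda>\<zeta>. chirp B \<zeta> * amb f g \<zeta>) (- z)))\<^sup>2)"
    by (rule lborel_preserving_integrable[OF lborel_preserving_uminus plancherel_L2[OF nice_chirp_amb[OF assms]]])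
  then show ?thesis
    using borel_measurable_continuous_onI[OF continuous_on_chirp_op[OF assms, of B]]
    by (simp add: L2_def chirp_op_def inv_fourier_eq_fourier[abs_def])
qed

text \<open>Plancherel moves the inner product to the ambiguity side, where the chirp cancels
  against its conjugate.\<close>

lemma chirp_op_inner:
  assumes f: "nice f" and g: "nice g" and f': "nice f'" and g': "nice g'"
    and i: "integrable lborel (amb f g)" and i': "integrable lborel (amb f' g')"
  shows "(\<integral>z. chirp_op B f g z * cnj (chirp_op B f' g' z) \<partial>lborel)
     = (\<integral>x. f x * cnj (f' x) \<partial>lborel) * (\<integral>y. cnj (g y) * g' y \<partial>lborel)"
proof -
  let ?H = "\<lambda>\<zeta>. chirp B \<zeta> * amb f g \<zeta>" and ?H' = "\<lambda>\<zeta>. chirp B \<zeta> * amb f' g' \<zeta>"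
  note n = nice_chirp_amb[OF f g i, of B] and n' = nice_chirp_amb[OF f' g' i', of B]
  note [measurable] = nice_measurable[OF n] nice_measurable[OF n']
  have "(\<integral>z. chirp_op B f g z * cnj (chirp_op B f' g' z) \<partial>lborel)
      = (\<integral>z. fourier ?H (- z) * cnj (fourier ?H' (- z)) \<partial>lborel)"
    by (simp add: chirp_op_def inv_fourier_eq_fourier)
  also have "\<dots> = (\<integral>z. fourier ?H z * cnj (fourier ?H' z) \<partial>lborel)"
    by (rule lborel_preserving_integral[OF lborel_preserving_uminus]) measurable
  also have "\<dots> = (\<integral>\<zeta>. ?H \<zeta> * cnj (?H' \<zeta>) \<partial>lborel)"
    by (rule plancherel[OF n n'])
  also have "\<dots> = (\<integral>\<zeta>. amb f g \<zeta> * cnj (amb f' g' \<zeta>) \<partial>lborel)"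
  proof (rule Bochner_Integration.integral_cong[OF refl])
    fix \<zeta>
    have "chirp B \<zeta> * cnj (chirp B \<zeta>) = 1"
      by (simp add: complex_norm_square[symmetric])
    then show "?H \<zeta> * cnj (?H' \<zeta>) = amb f g \<zeta> * cnj (amb f' g' \<zeta>)"
      by (metis (no_types, lifting) complex_cnj_mult mult.assoc mult.commute mult_1)
  qed
  finally show ?thesis by (simp add: amb_inner[OF f g f' g' i])
qed

text \<open>Translating the argument of the chirp by Q changes it by a constant phase and a
  character of frequency BQ, because symmetry of \<open>B\<close> merges the two cross terms. After
  the inverse transform this character is the additional translation by BQ.\<close>

lemma chirp_op_rho:
  fixes f g :: "real^'d::finite \<Rightarrow> complex"
  assumes f: "nice f" and g: "nice g" and B: "transpose B = B"
  shows "chirp_op B (rho (joinv p1 q1) f) (rho (joinv p2 (- q2)) g)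
    = rho (joinv (joinv ((1/2) *\<^sub>R (p1 + p2)) ((1/2) *\<^sub>R (q1 - q2)) + B *v joinv (q1 + q2) (p2 - p1))
                 (joinv (q1 + q2) (p2 - p1))) (chirp_op B f g)"
proof (rule ext)
  fix z :: "real^('d + 'd)"
  define P where "P = joinv ((1/2) *\<^sub>R (p1 + p2)) ((1/2) *\<^sub>R (q1 - q2))"
  define Q where "Q = joinv (q1 + q2) (p2 - p1)"
  have "continuous_on UNIV (amb f g)" by (rule amb_continuous_bounded[OF f g])
  then have [measurable]: "amb f g \<in> borel_measurable borel" "chirp B \<in> borel_measurable borel"
    by (auto intro: borel_measurable_continuous_onI continuous_on_chirp)
  have PQ: "P \<bullet> Q = p1 \<bullet> q2 + p2 \<bullet> q1"
    unfolding P_def Q_def inner_joinv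
    by (simp add: inner_add_left inner_add_right inner_diff_left inner_diff_right inner_commute field_simps)
  have sym: "x \<bullet> (B *v y) = y \<bullet> (B *v x)" for x y
    by (metis B dot_lmul_matrix inner_commute vector_transpose_matrix)
  \<comment> \<open>In this form the phase of \<open>amb_rho\<close> is a modulation by -P, which
    the inverse transform turns into a translation by P.\<close>
  have phase: "(p1 \<bullet> q2 + p2 \<bullet> q1 - fstv \<zeta> \<bullet> (p1 + p2) + sndv \<zeta> \<bullet> (q2 - q1)) / 2 = (P \<bullet> Q) / 2 - \<zeta> \<bullet> P" for \<zeta>
    unfolding PQ by (simp add: inner_sumv[of \<zeta>] P_def inner_add_right inner_diff_right field_simps)
  let ?E = "unit_char (- ((P + B *v Q) \<bullet> Q) / 2) * unit_char (Q \<bullet> z)"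
  let ?h = "\<lambda>\<eta>. chirp B \<eta> * amb f g \<eta> * unit_char ((z - (P + B *v Q)) \<bullet> \<eta>)"
  have "chirp_op B (rho (joinv p1 q1) f) (rho (joinv p2 (- q2)) g) z
      = (\<integral>\<zeta>. chirp B \<zeta> * (unit_char ((P \<bullet> Q) / 2 - \<zeta> \<bullet> P) * amb f g (\<zeta> - Q)) * unit_char (z \<bullet> \<zeta>) \<partial>lborel)"
    by (simp add: chirp_op_def inv_fourier_unit_char amb_rho[OF f g] phase Q_def)
  also have "\<dots> = (\<integral>\<zeta>. ?E * ?h (\<zeta> - Q) \<partial>lborel)"
  proof (rule Bochner_Integration.integral_cong[OF refl])
    fix \<zeta>
    have "- (\<zeta> \<bullet> (B *v \<zeta>)) / 2 + ((P \<bullet> Q) / 2 - \<zeta> \<bullet> P) + z \<bullet> \<zeta>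
      = - ((P + B *v Q) \<bullet> Q) / 2 + Q \<bullet> z + (- ((\<zeta> - Q) \<bullet> (B *v (\<zeta> - Q))) / 2) + (z - (P + B *v Q)) \<bullet> (\<zeta> - Q)"
      using sym[of Q \<zeta>]
      by (simp add: matrix_vector_mult_diff_distrib inner_add_left inner_diff_left inner_diff_right
          inner_commute[of "B *v Q"] inner_commute[of P] inner_commute[of Q z] field_simps)
    then have e: "unit_char (- (\<zeta> \<bullet> (B *v \<zeta>)) / 2) * unit_char ((P \<bullet> Q) / 2 - \<zeta> \<bullet> P) * unit_char (z \<bullet> \<zeta>)
      = ?E * unit_char (- ((\<zeta> - Q) \<bullet> (B *v (\<zeta> - Q))) / 2) * unit_char ((z - (P + B *v Q)) \<bullet> (\<zeta> - Q))"
      unfolding unit_char_add[symmetric] by (simp only:)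
    show "chirp B \<zeta> * (unit_char ((P \<bullet> Q) / 2 - \<zeta> \<bullet> P) * amb f g (\<zeta> - Q)) * unit_char (z \<bullet> \<zeta>) = ?E * ?h (\<zeta> - Q)"
      using arg_cong[OF e, of "\<lambda>c. c * amb f g (\<zeta> - Q)"] unfolding chirp_def by (simp only: mult_ac)
  qed
  also have "\<dots> = ?E * (\<integral>\<zeta>. ?h (\<zeta> - Q) \<partial>lborel)" by simp
  also have "(\<integral>\<zeta>. ?h (\<zeta> - Q) \<partial>lborel) = (\<integral>\<zeta>. ?h \<zeta> \<partial>lborel)"
    by (rule lborel_preserving_integral[OF lborel_preserving_diff]) measurable
  also have "\<dots> = chirp_op B f g (z - (P + B *v Q))"
    by (simp add: chirp_op_def inv_fourier_unit_char)
  finally show "chirp_op B (rho (joinv p1 q1) f) (rho (joinv p2 (- q2)) g) z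
    = rho (joinv (joinv ((1/2) *\<^sub>R (p1 + p2)) ((1/2) *\<^sub>R (q1 - q2)) + B *v joinv (q1 + q2) (p2 - p1))
                 (joinv (q1 + q2) (p2 - p1))) (chirp_op B f g) z"
    by (simp only: rho_unit_char[of _ "chirp_op B f g"] fstv_joinv sndv_joinv P_def Q_def)
qed

section \<open>Wigner distributions and convolution with the transformed chirp\<close>

lemma wigner_eq_fourier: "wigner f g w = fourier (sesq 1 (1/2) 1 (-1/2) f g (fstv w)) (sndv w)"
  unfolding wigner_def fourier_def sesq_def by simp

lemma unimodular_coeffs_simps [simp]:
  "unimodular_coeffs 1 (1/2) 1 (-1/2)" "unimodular_coeffs (-1/2) 1 (1/2) 1" "unimodular_coeffs 0 1 (-1) 1"
  by (simp_all add: unimodular_coeffs_def)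

lemma integrable_weight_tensor:
  fixes h :: "real^('a::finite + 'b::finite) \<Rightarrow> complex"
  assumes [measurable]: "h \<in> borel_measurable borel"
    and h: "\<And>z. cmod (h z) \<le> C * (weight (fstv z) * weight (sndv z))"
  shows "integrable lborel h"
proof (rule Bochner_Integration.integrable_bound)
  show "integrable lborel (\<lambda>z :: real^('a + 'b). C * (weight (fstv z) * weight (sndv z)))"
    by (intro integrable_mult_right integrable_weight_joinv)
  show "AE z in lborel. norm (h z) \<le> norm (C * (weight (fstv z) * weight (sndv z)))"
    using h by (intro AE_I2) (metis abs_ge_self order_trans real_norm_def)
qed simp

lemma integrable_amb:
  assumes f: "schwartz f" and g: "schwartz g"
  shows "integrable lborel (amb f g)"
proof -
  obtain C where C: "\<And>p q. cmod (fourier (sesq (-1/2) 1 (1/2) 1 f g p) q) \<le> C * (weight p * weight q)"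
    using fourier_sesq_weight[OF f g unimodular_coeffs_simps(2)] by blast
  show ?thesis
  proof (rule integrable_weight_tensor)
    show "amb f g \<in> borel_measurable borel"
      by (rule borel_measurable_continuous_onI[OF amb_continuous_bounded(1)[OF schwartz_nice[OF f] schwartz_nice[OF g]]])
    show "cmod (amb f g z) \<le> C * (weight (fstv z) * weight (sndv z))" for z
      using C[of "sndv z" "fstv z"] by (simp add: amb_def mult.commute)
  qed
qed

lemma integrable_wigner:
  assumes f: "schwartz f" and g: "schwartz g"
  shows "integrable lborel (wigner f g)"
proof -
  note [measurable] = nice_measurable[OF schwartz_nice[OF f]] nice_measurable[OF schwartz_nice[OF g]]
  obtain C where C: "\<And>p q. cmod (fourier (sesq 1 (1/2) 1 (-1/2) f g p) q) \<le> C * (weight p * weight q)"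
    using fourier_sesq_weight[OF f g unimodular_coeffs_simps(1)] by blast
  show ?thesis
  proof (rule integrable_weight_tensor)
    show "wigner f g \<in> borel_measurable borel"
      unfolding wigner_eq_fourier[abs_def] fourier_unit_char sesq_def by measurable
    show "cmod (wigner f g z) \<le> C * (weight (fstv z) * weight (sndv z))" for z
      using C by (simp add: wigner_eq_fourier)
  qed
qed

text \<open>For each x the Wigner distribution is a Fourier transform in t. Transforming it once
  more in \<xi> inverts this and evaluates the product at t = -v; the remaining integral over x is
  the ambiguity function. The decay estimate makes every slice integrable, as inversion
  demands.\<close>

lemma fourier_wigner:
  fixes f g :: "real^'d::finite \<Rightarrow> complex"
  assumes f: "schwartz f" and g: "schwartz g"
  shows "fourier (wigner f g) \<zeta> = amb f g \<zeta>"
proof -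
  define u v where "u = fstv \<zeta>" and "v = sndv \<zeta>"
  let ?h = "\<lambda>x. sesq 1 (1/2) 1 (-1/2) f g x"
  obtain C where C: "\<And>p q. cmod (fourier (?h p) q) \<le> C * (weight p * weight q)"
    using fourier_sesq_weight[OF f g unimodular_coeffs_simps(1)] by blast
  obtain D where D: "\<And>p t. cmod (?h p t) \<le> D * weight t"
    using sesq_weight[OF f g unimodular_coeffs_simps(1), of 0] by auto
  have n: "nice (?h x)" for x
    by (rule nice_weight_bound[OF sesq_continuous D]) (intro schwartz_continuous f g)+
  have i: "integrable lborel (fourier (?h x))" for x
  proof (rule integrable_weight_bound)
    show "fourier (?h x) \<in> borel_measurable borel"
      by (intro measurable_fourier nice_measurable n)
    show "cmod (fourier (?h x) q) \<le> (C * weight x) * weight q" for q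
      using C[of x q] by (simp add: mult.assoc)
  qed
  have "integrable lborel (\<lambda>w. wigner f g w * unit_char (- (w \<bullet> \<zeta>)))"
    by (rule integrable_mult_bounded[where C=1, OF integrable_wigner[OF f g]]) auto
  from integral_joinv(1)[OF this]
  have "fourier (wigner f g) \<zeta> = (\<integral>x. \<integral>\<xi>. fourier (?h x) \<xi> * unit_char (- (x \<bullet> u + \<xi> \<bullet> v)) \<partial>lborel \<partial>lborel)"
    by (simp add: fourier_unit_char[of "wigner f g"] wigner_eq_fourier inner_sumv[of _ \<zeta>] u_def v_def)
  also have "\<dots> = (\<integral>x. unit_char (- (x \<bullet> u)) * inv_fourier (fourier (?h x)) (- v) \<partial>lborel)"
  proof (rule Bochner_Integration.integral_cong[OF refl])
    fix x
    have "fourier (?h x) \<xi> * unit_char (- (x \<bullet> u + \<xi> \<bullet> v))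
        = unit_char (- (x \<bullet> u)) * (fourier (?h x) \<xi> * unit_char (- v \<bullet> \<xi>))" for \<xi>
    proof -
      have "- (x \<bullet> u + \<xi> \<bullet> v) = - (x \<bullet> u) + (- v \<bullet> \<xi>)" by (simp add: inner_commute)
      then show ?thesis by (simp only: unit_char_add mult_ac)
    qed
    then show "(\<integral>\<xi>. fourier (?h x) \<xi> * unit_char (- (x \<bullet> u + \<xi> \<bullet> v)) \<partial>lborel)
        = unit_char (- (x \<bullet> u)) * inv_fourier (fourier (?h x)) (- v)"
      unfolding inv_fourier_unit_char by (simp only: integral_mult_right_zero)
  qed
  also have "\<dots> = (\<integral>x. unit_char (- (x \<bullet> u)) * ?h x (- v) \<partial>lborel)"
    by (simp only: fourier_inversion[OF n i])
  also have "\<dots> = amb f g \<zeta>"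
    by (simp add: amb_def fourier_unit_char sesq_def u_def v_def mult_ac add.commute)
  finally show ?thesis .
qed

text \<open>The test function is a reflected translate of the Wigner distribution, and the
  reflection turns its inverse transform into the forward one, times a character in z. Pairing with
  the chirp is therefore an inverse Fourier transform evaluated at z.\<close>

lemma conv_distr_wigner:
  assumes f: "schwartz f" and g: "schwartz g"
  shows "conv_distr (wigner f g) (sigma_cov A11 A13 A21) = chirp_op (B_cov A11 A13 A21) f g"
proof (rule ext)
  fix z
  have [measurable]: "wigner f g \<in> borel_measurable borel"
    using borel_measurable_integrable[OF integrable_wigner[OF f g]] by simp
  have "inv_fourier (\<lambda>y. wigner f g (z - y)) \<zeta> = unit_char (z \<bullet> \<zeta>) * amb f g \<zeta>" for \<zeta>
  proof -
    have "inv_fourier (\<lambda>y. wigner f g (z - y)) \<zeta>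
        = (\<integral>y. unit_char (z \<bullet> \<zeta>) * (wigner f g (z - y) * unit_char (- ((z - y) \<bullet> \<zeta>))) \<partial>lborel)"
      unfolding inv_fourier_unit_char
    proof (rule Bochner_Integration.integral_cong[OF refl])
      fix y
      have "unit_char (z \<bullet> \<zeta>) * unit_char (- ((z - y) \<bullet> \<zeta>)) = unit_char (\<zeta> \<bullet> y)"
        by (simp add: unit_char_add[symmetric] inner_diff_left inner_diff_right inner_commute)
      then show "wigner f g (z - y) * unit_char (\<zeta> \<bullet> y)
          = unit_char (z \<bullet> \<zeta>) * (wigner f g (z - y) * unit_char (- ((z - y) \<bullet> \<zeta>)))"
        by (metis mult.left_commute)
    qed
    also have "\<dots> = unit_char (z \<bullet> \<zeta>) * fourier (wigner f g) \<zeta>"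
      using lborel_preserving_integral[OF lborel_preserving_reflect, of "\<lambda>y. wigner f g y * unit_char (- (y \<bullet> \<zeta>))" z]
      by (simp add: fourier_unit_char)
    finally show ?thesis by (simp add: fourier_wigner[OF f g])
  qed
  then show "conv_distr (wigner f g) (sigma_cov A11 A13 A21) z = chirp_op (B_cov A11 A13 A21) f g z"
    unfolding conv_distr_def sigma_cov_def inv_fourier_distr_def chirp_op_def inv_fourier_unit_char[of _ z]
      chirp_def exp_unit_char
    by (simp add: mult_ac)
qed

subsection \<open>Moyal's identity\<close>

definition L2_inner :: "(real^'n::finite \<Rightarrow> complex) \<Rightarrow> (real^'n \<Rightarrow> complex) \<Rightarrow> complex" where
  "L2_inner F G = (\<integral>x. F x * cnj (G x) \<partial>lborel)"

lemma L2_measurable [measurable_dest]: "L2 F \<Longrightarrow> F \<in> borel_measurable borel"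
  by (simp add: L2_def)

lemma L2_integrable_mult:
  assumes F: "L2 F" and G: "L2 G"
  shows "integrable lborel (\<lambda>x. F x * cnj (G x))"
  by (rule integrable_mult_L2) (use F G in \<open>auto simp: L2_def\<close>)

lemma L2_inner_self: "L2_inner F F = complex_of_real (\<integral>x. (cmod (F x))\<^sup>2 \<partial>lborel)"
  unfolding L2_inner_def by (subst integral_complex_of_real[symmetric]) (simp add: complex_norm_square[symmetric])

lemma L2_rho:
  fixes F :: "real^'n::finite \<Rightarrow> complex"
  assumes F: "L2 F"
  shows "L2 (rho w F)"
proof -
  note [measurable] = L2_measurable[OF F]
  have "integrable lborel (\<lambda>t. (cmod (F (t - fstv w)))\<^sup>2)"
    by (rule lborel_preserving_integrable[OF lborel_preserving_diff, of "\<lambda>t. (cmod (F t))\<^sup>2"]) (use F in \<open>simp add: L2_def\<close>)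
  then show ?thesis
    unfolding L2_def rho_unit_char[abs_def] by (simp add: norm_mult)
qed

text \<open>A matrix coefficient is, up to a phase, a short-time Fourier transform; for each
  translation it is an ordinary Fourier transform in the frequency block.\<close>

lemma L2_inner_rho:
  fixes F G :: "real^'n::finite \<Rightarrow> complex"
  shows "L2_inner F (rho w G)
    = unit_char ((fstv w \<bullet> sndv w) / 2) * fourier (\<lambda>t. F t * cnj (G (t - fstv w))) (sndv w)"
  unfolding L2_inner_def fourier_unit_char
  by (subst integral_mult_right_zero[symmetric])
     (simp add: rho_unit_char mult_ac inner_commute)

lemma power2_norm_add_mult:
  "(cmod (x + c * y))\<^sup>2 = (cmod x)\<^sup>2 + (cmod c)\<^sup>2 * (cmod y)\<^sup>2 + 2 * Re (cnj c * (x * cnj y))"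
  unfolding cmod_power2 by (simp add: power2_eq_square algebra_simps)

lemma L2_add_mult:
  fixes F G :: "real^'n::finite \<Rightarrow> complex"
  assumes F: "L2 F" and G: "L2 G"
  shows "L2 (\<lambda>x. F x + c * G x)"
    and "(\<integral>x. (cmod (F x + c * G x))\<^sup>2 \<partial>lborel)
      = (\<integral>x. (cmod (F x))\<^sup>2 \<partial>lborel) + (cmod c)\<^sup>2 * (\<integral>x. (cmod (G x))\<^sup>2 \<partial>lborel) + 2 * Re (cnj c * L2_inner F G)"
proof -
  note [measurable] = L2_measurable[OF F] L2_measurable[OF G]
  have i: "integrable lborel (\<lambda>x. (cmod (F x))\<^sup>2)" "integrable lborel (\<lambda>x. (cmod (G x))\<^sup>2)"
    using F G by (auto simp: L2_def)
  have ic: "integrable lborel (\<lambda>x. cnj c * (F x * cnj (G x)))"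
    by (intro integrable_mult_right L2_integrable_mult F G)
  note ir = integrable_Re[OF ic]
  show "L2 (\<lambda>x. F x + c * G x)"
    unfolding L2_def power2_norm_add_mult
    by (intro conjI Bochner_Integration.integrable_add integrable_mult_right i ir) measurable
  have "(\<integral>x. Re (cnj c * (F x * cnj (G x))) \<partial>lborel) = Re (cnj c * L2_inner F G)"
    unfolding integral_Re[OF ic] L2_inner_def by simp
  then show "(\<integral>x. (cmod (F x + c * G x))\<^sup>2 \<partial>lborel)
      = (\<integral>x. (cmod (F x))\<^sup>2 \<partial>lborel) + (cmod c)\<^sup>2 * (\<integral>x. (cmod (G x))\<^sup>2 \<partial>lborel) + 2 * Re (cnj c * L2_inner F G)"
    unfolding power2_norm_add_mult
    by (simp only: Bochner_Integration.integral_add Bochner_Integration.integrable_add integrable_mult_right i ir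
        integral_mult_right_zero)
qed

text \<open>A crude form of the Cauchy-Schwarz inequality. It bounds matrix coefficients uniformly
  and makes inner products of null vectors vanish.\<close>

lemma norm_L2_inner_le:
  assumes "L2 F" "L2 G"
  shows "cmod (L2_inner F G) \<le> (\<integral>x. (cmod (F x))\<^sup>2 \<partial>lborel) + (\<integral>x. (cmod (G x))\<^sup>2 \<partial>lborel)"
proof -
  have i: "integrable lborel (\<lambda>x. (cmod (F x))\<^sup>2)" "integrable lborel (\<lambda>x. (cmod (G x))\<^sup>2)"
    using assms by (auto simp: L2_def)
  have "cmod (L2_inner F G) \<le> (\<integral>x. (cmod (F x))\<^sup>2 + (cmod (G x))\<^sup>2 \<partial>lborel)"
    unfolding L2_inner_def by (intro norm_integral_le) (use i in \<open>auto simp: norm_mult mult_le_sum_power2\<close>)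
  then show ?thesis using i by simp
qed

lemma measurable_L2_inner_rho:
  fixes F G :: "real^'n::finite \<Rightarrow> complex"
  assumes [measurable]: "F \<in> borel_measurable borel" "G \<in> borel_measurable borel"
  shows "(\<lambda>w. L2_inner F (rho w G)) \<in> borel_measurable borel"
  unfolding L2_inner_def rho_unit_char by measurable

lemma integral_rho_norm:
  fixes F :: "real^'n::finite \<Rightarrow> complex"
  assumes "L2 F"
  shows "(\<integral>x. (cmod (rho w F x))\<^sup>2 \<partial>lborel) = (\<integral>x. (cmod (F x))\<^sup>2 \<partial>lborel)"
proof -
  note [measurable] = L2_measurable[OF assms]
  have "(\<integral>x. (cmod (F (x - fstv w)))\<^sup>2 \<partial>lborel) = (\<integral>x. (cmod (F x))\<^sup>2 \<partial>lborel)"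
    by (rule lborel_preserving_integral[OF lborel_preserving_diff, of "\<lambda>x. (cmod (F x))\<^sup>2"]) simp
  then show ?thesis by (simp add: rho_unit_char norm_mult)
qed

text \<open>For fixed p the product of \<open>F\<close> with the shifted conjugate of
  \<open>G\<close> is only integrable, so Plancherel does not apply to it. The multiplication
  formula needs no more than that on this side; inversion is spent on the regular pair
  \<open>F'\<close>, \<open>G'\<close>.\<close>

theorem moyal:
  fixes F G F' G' :: "real^'n::finite \<Rightarrow> complex"
  assumes F: "L2 F" and G: "L2 G" and F': "L2 F'" and G': "L2 G'"
    and contF': "continuous_on UNIV F'" and contG': "continuous_on UNIV G'"
    and bF': "\<exists>C. \<forall>x. cmod (F' x) \<le> C" and bG': "\<exists>C. \<forall>x. cmod (G' x) \<le> C"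
    and i: "integrable lborel (\<lambda>w. L2_inner F' (rho w G'))"
  shows "(\<integral>w. L2_inner F (rho w G) * cnj (L2_inner F' (rho w G')) \<partial>lborel)
    = L2_inner F F' * cnj (L2_inner G G')"
proof -
  note [measurable] = L2_measurable[OF F] L2_measurable[OF G] L2_measurable[OF F'] L2_measurable[OF G']
  define k where "k p t = F t * cnj (G (t - p))" for p t
  define h where "h p t = F' t * cnj (G' (t - p))" for p t
  have shift: "L2 (\<lambda>t. H (t - p))" if "L2 H" for H :: "real^'n \<Rightarrow> complex" and p
    using L2_rho[OF that, of "joinv p 0"] by (simp add: rho_unit_char[abs_def])
  have ik: "integrable lborel (k p)" and ih: "integrable lborel (h p)" for p
    unfolding k_def h_def by (intro L2_integrable_mult shift F G F' G')+
  obtain C D where C: "\<And>x. cmod (F' x) \<le> C" and D: "\<And>x. cmod (G' x) \<le> D"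
    using bF' bG' by blast
  have C0: "0 \<le> C" using order_trans[OF norm_ge_zero C[of 0]] .
  have nh: "nice (h p)" for p
    unfolding nice_def
  proof (intro conjI ih)
    show "continuous_on UNIV (h p)"
      unfolding h_def
      by (intro continuous_intros contF' continuous_on_compose2[OF contG']) auto
    show "\<exists>C. \<forall>x. cmod (h p x) \<le> C"
      unfolding h_def norm_mult complex_mod_cnj using C D C0 by (meson mult_mono norm_ge_zero)
  qed
  let ?V = "\<lambda>w. L2_inner F (rho w G)" and ?V' = "\<lambda>w. L2_inner F' (rho w G')"
  have bV: "cmod (?V w) \<le> (\<integral>x. (cmod (F x))\<^sup>2 \<partial>lborel) + (\<integral>x. (cmod (G x))\<^sup>2 \<partial>lborel)" for w
    using norm_L2_inner_le[OF F L2_rho[OF G, of w]] by (simp add: integral_rho_norm[OF G])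
  have mV: "?V \<in> borel_measurable lborel"
    using measurable_L2_inner_rho[of F G] by simp
  have icn: "integrable lborel (\<lambda>w. cnj (?V' w))" using i by simp
  have iV: "integrable lborel (\<lambda>w. ?V w * cnj (?V' w))"
    by (rule integrable_mult_bounded(2)[OF icn mV bV])
  have V: "?V (joinv p q) * cnj (?V' (joinv p q)) = fourier (k p) q * cnj (fourier (h p) q)" for p q
  proof -
    have "unit_char ((p \<bullet> q) / 2) * cnj (unit_char ((p \<bullet> q) / 2)) = 1"
      by (simp add: unit_char_add[symmetric])
    then show ?thesis
      unfolding L2_inner_rho k_def h_def fstv_joinv sndv_joinv complex_cnj_mult
      by (simp add: mult_ac)
  qed
  \<comment> \<open>Fubini yields integrable frequency slices for almost every p only, which is
    enough inside the integral over p.\<close>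
  have ifh: "AE p in lborel. integrable lborel (fourier (h p))"
  proof -
    have "AE p in lborel. integrable lborel (\<lambda>q. ?V' (joinv p q))"
      by (rule integral_joinv(3)[OF i])
    then show ?thesis
    proof eventually_elim
      case (elim p)
      have "integrable lborel (\<lambda>q. unit_char (- (p \<bullet> q) / 2) * ?V' (joinv p q))"
        by (rule integrable_mult_bounded(2)[OF elim, where C=1]) auto
      moreover have "unit_char (- (p \<bullet> q) / 2) * ?V' (joinv p q) = fourier (h p) q" for q
        unfolding L2_inner_rho h_def fstv_joinv sndv_joinv mult.assoc[symmetric] unit_char_add[symmetric] by simp
      ultimately show ?case by simp
    qed
  qed
  have "(\<integral>w. ?V w * cnj (?V' w) \<partial>lborel) = (\<integral>p. \<integral>q. fourier (k p) q * cnj (fourier (h p) q) \<partial>lborel \<partial>lborel)"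
    unfolding integral_joinv(1)[OF iV] V ..
  also have "\<dots> = (\<integral>p. \<integral>t. k p t * cnj (h p t) \<partial>lborel \<partial>lborel)"
  proof (rule integral_cong_AE)
    show "AE p in lborel. (\<integral>q. fourier (k p) q * cnj (fourier (h p) q) \<partial>lborel) = (\<integral>t. k p t * cnj (h p t) \<partial>lborel)"
      using ifh
    proof eventually_elim
      case (elim p)
      \<comment> \<open>The conjugate of \<open>fourier (h p)\<close> is the function whose
        transform is known: by inversion it is the conjugate of \<open>h p\<close>.\<close>
      have "fourier (\<lambda>q. cnj (fourier (h p) q)) t = cnj (h p t)" for t
      proof -
        have "fourier (\<lambda>q. cnj (fourier (h p) q)) t = cnj (inv_fourier (fourier (h p)) t)"
          unfolding fourier_unit_char[of "\<lambda>q. cnj (fourier (h p) q)"] inv_fourier_unit_char[of "fourier (h p)"]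
            Bochner_Integration.integral_cnj[symmetric] by (simp add: inner_commute)
        then show ?thesis by (simp add: fourier_inversion[OF nh elim])
      qed
      moreover have "integrable lborel (\<lambda>q. cnj (fourier (h p) q))" using elim by simp
      ultimately show ?case
        using fourier_multiplication[OF ik[of p], of "\<lambda>q. cnj (fourier (h p) q)"] by simp
    qed
  qed (unfold k_def h_def fourier_unit_char, measurable)
  also have "\<dots> = L2_inner F F' * cnj (L2_inner G G')"
  proof -
    let ?k = "\<lambda>t. F t * cnj (F' t)" and ?l = "\<lambda>s. cnj (G s * cnj (G' s))"
    have ikk: "integrable lborel ?k" and ill: "integrable lborel ?l"
      using L2_integrable_mult[OF F F'] integrable_cnj[OF L2_integrable_mult[OF G G']] by auto
    let ?S = "\<lambda>z. joinv (sndv z) (sndv z - fstv z)"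
    have S: "lborel_preserving ?S"
      using lborel_preserving_compose[OF lborel_preserving_swapv
          lborel_preserving_compose[OF lborel_preserving_shear1[of "\<lambda>y. y"] lborel_preserving_fstv[OF lborel_preserving_uminus]]]
      by simp
    let ?t = "\<lambda>z. ?k (fstv z) * ?l (sndv z)"
    have it: "integrable lborel ?t" by (rule integrable_tensor[OF ikk ill])
    have iS: "integrable lborel (\<lambda>z. ?t (?S z))"
      by (rule lborel_preserving_integrable[OF S it])
    have "(\<integral>p. \<integral>t. k p t * cnj (h p t) \<partial>lborel \<partial>lborel) = (\<integral>z. ?t (?S z) \<partial>lborel)"
      unfolding integral_joinv(1)[OF iS] by (simp add: k_def h_def mult_ac)
    also have "\<dots> = (\<integral>z. ?t z \<partial>lborel)"
      by (rule lborel_preserving_integral[OF S]) measurable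
    also have "\<dots> = (\<integral>t. ?k t \<partial>lborel) * (\<integral>s. ?l s \<partial>lborel)"
      unfolding integral_joinv(1)[OF it] by simp
    also have "\<dots> = L2_inner F F' * cnj (L2_inner G G')"
      unfolding L2_inner_def Bochner_Integration.integral_cnj[symmetric] ..
    finally show ?thesis .
  qed
  finally show ?thesis .
qed

subsection \<open>Covariant matrices\<close>

lemma sum_UNIV_Plus:
  "(\<Sum>k\<in>UNIV. h k) = (\<Sum>i\<in>UNIV. h (Inl i :: 'a::finite + 'b::finite)) + (\<Sum>j\<in>UNIV. h (Inr j))"
  by (simp add: UNIV_Plus_UNIV[symmetric] sum.Plus del: UNIV_Plus_UNIV)

lemma mat_vector_mult: "mat c *v x = c *\<^sub>R (x :: real^'n::finite)"
  by (simp add: vec_eq_iff matrix_vector_mult_def mat_def if_distrib if_distribR cong: if_cong)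

lemma uminus_matrix_vector_mult: "(- A) *v x = - (A *v (x :: real^'n::finite))"
  by (simp add: vec_eq_iff matrix_vector_mult_def sum_negf)

lemma fstv_sndv_B_cov:
  "fstv (B_cov A11 A13 A21 *v z) = A13 *v fstv z + (mat (1/2) - A11) *v sndv z"
  "sndv (B_cov A11 A13 A21 *v z) = (mat (1/2) - transpose A11) *v fstv z + (- A21) *v sndv z"
  by (simp_all add: vec_eq_iff B_cov_def Let_def matrix_vector_mult_def sum_UNIV_Plus)

text \<open>The origin of the matrix B. Writing the upper rows around means gives A11 p1 + (I - A11)
  p2 = (p1 + p2)/2 + (I/2 - A11)(p2 - p1), and likewise for the second row. So a covariant matrix is
  a fixed matrix, that of the Wigner distribution, followed by the shear with B.\<close>

lemma cov_matrix_mult_joinv: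
  "cov_matrix A11 A13 A21 *v joinv (joinv p1 p2) (joinv q1 q2)
    = joinv (joinv ((1/2) *\<^sub>R (p1 + p2)) ((1/2) *\<^sub>R (q1 - q2)) + B_cov A11 A13 A21 *v joinv (q1 + q2) (p2 - p1))
        (joinv (q1 + q2) (p2 - p1))"
proof -
  have "cov_matrix A11 A13 A21 *v joinv (joinv p1 p2) (joinv q1 q2)
    = joinv (joinv (A11 *v p1 + (mat 1 - A11) *v p2 + (A13 *v q1 + A13 *v q2))
                   (A21 *v p1 + (- A21) *v p2 + ((mat 1 - transpose A11) *v q1 + (- transpose A11) *v q2)))
            (joinv (0 *v p1 + 0 *v p2 + (mat 1 *v q1 + mat 1 *v q2)) ((- mat 1) *v p1 + mat 1 *v p2 + (0 *v q1 + 0 *v q2)))"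
    by (simp add: vec_eq_iff split_sum_all cov_matrix_def Let_def matrix_vector_mult_def sum_UNIV_Plus
        numeral_2_eq_2 numeral_3_eq_3)
  also have "\<dots> = joinv (joinv ((1/2) *\<^sub>R (p1 + p2)) ((1/2) *\<^sub>R (q1 - q2)) + B_cov A11 A13 A21 *v joinv (q1 + q2) (p2 - p1))
        (joinv (q1 + q2) (p2 - p1))"
    unfolding joinv_eq_iff fstv_joinv sndv_joinv fstv_simps sndv_simps fstv_sndv_B_cov
      matrix_vector_mult_diff_rdistrib mat_vector_mult uminus_matrix_vector_mult
    by (simp add: vec_eq_iff matrix_vector_right_distrib matrix_vector_mult_diff_distrib field_simps)
  finally show ?thesis .
qed

lemma transpose_B_cov:
  assumes "transpose A13 = A13" "transpose A21 = A21"
  shows "transpose (B_cov A11 A13 A21) = B_cov A11 A13 A21"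
proof -
  have "A13 $ i $ j = A13 $ j $ i" "A21 $ i $ j = A21 $ j $ i" for i j
    using assms by (metis transpose_def vec_lambda_beta)+
  then show ?thesis
    by (simp add: vec_eq_iff split_sum_all B_cov_def Let_def transpose_def mat_def)
qed

lemma lborel_preserving_cov_matrix:
  fixes A11 :: "real^'d::finite^'d"
  shows "lborel_preserving (\<lambda>w. cov_matrix A11 A13 A21 *v w)"
proof -
  \<comment> \<open>\<open>?s1\<close> and \<open>?s2\<close> take (p1, p2) to ((p1 + p2)/2, p2 -
    p1); \<open>?s3\<close>, \<open>?s4\<close> and \<open>?s5\<close> take (q1, q2) to (q1 + q2,
    (q1 - q2)/2). The permutation \<open>?R\<close> then interchanges the two second components, and
    \<open>?B\<close> is the shear with B.\<close>
  let ?s1 = "\<lambda>z. joinv (fstv z) (sndv z + (- fstv z)) :: real^('d + 'd)"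
  let ?s2 = "\<lambda>z. joinv (fstv z + (1/2) *\<^sub>R sndv z) (sndv z) :: real^('d + 'd)"
  let ?s3 = "\<lambda>z. joinv (fstv z + sndv z) (sndv z) :: real^('d + 'd)"
  let ?s4 = "\<lambda>z. joinv (fstv z) (sndv z + (- (1/2)) *\<^sub>R fstv z) :: real^('d + 'd)"
  let ?s5 = "\<lambda>z. joinv (fstv z) (- sndv z) :: real^('d + 'd)"
  let ?P = "\<lambda>p. ?s2 (?s1 p)" and ?Q = "\<lambda>q. ?s5 (?s4 (?s3 q))"
  let ?\<pi> = "(\<lambda>k. case k of Inl (Inl i) \<Rightarrow> Inl (Inl i) | Inl (Inr i) \<Rightarrow> Inr (Inr i)
      | Inr (Inl i) \<Rightarrow> Inr (Inl i) | Inr (Inr i) \<Rightarrow> Inl (Inr i))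
      :: ('d + 'd) + ('d + 'd) \<Rightarrow> ('d + 'd) + ('d + 'd)"
  let ?R = "\<lambda>z :: real^(('d + 'd) + ('d + 'd)). \<chi> k. z $ ?\<pi> k"
  let ?B = "\<lambda>z. joinv (fstv z + B_cov A11 A13 A21 *v sndv z) (sndv z)"
  have "lborel_preserving ?s1" "lborel_preserving ?s2" "lborel_preserving ?s3" "lborel_preserving ?s4" "lborel_preserving ?s5"
    by (intro lborel_preserving_shear1 lborel_preserving_shear2 lborel_preserving_sndv[OF lborel_preserving_uminus];
        simp)+
  note s = this
  have P: "lborel_preserving ?P" by (rule lborel_preserving_compose[OF s(2) s(1)])
  have Q: "lborel_preserving ?Q" by (rule lborel_preserving_compose[OF s(5) lborel_preserving_compose[OF s(4) s(3)]])
  have "bij ?\<pi>" by (rule o_bij[where g="?\<pi>"]) (auto simp: fun_eq_iff split: sum.splits)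
  then have R: "lborel_preserving ?R" by (rule lborel_preserving_reindex)
  have B: "lborel_preserving ?B"
    by (rule lborel_preserving_shear1)
       (auto intro!: borel_measurable_continuous_onI matrix_vector_mult_linear_continuous_on continuous_intros)
  have "lborel_preserving (\<lambda>w. ?B (?R (joinv (?P (fstv w)) (?Q (sndv w)))))"
    using lborel_preserving_compose[OF B lborel_preserving_compose[OF R
        lborel_preserving_compose[OF lborel_preserving_fstv[OF P] lborel_preserving_sndv[OF Q]]]] by simp
  moreover have "?B (?R (joinv (?P (fstv w)) (?Q (sndv w)))) = cov_matrix A11 A13 A21 *v w" for w
  proof -
    define p1 p2 q1 q2 where "p1 = fstv (fstv w)" and "p2 = sndv (fstv w)" and "q1 = fstv (sndv w)" and "q2 = sndv (sndv w)"
    have w: "w = joinv (joinv p1 p2) (joinv q1 q2)"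
      by (simp add: p1_def p2_def q1_def q2_def)
    have "?R (joinv (?P (fstv w)) (?Q (sndv w)))
        = joinv (joinv ((1/2) *\<^sub>R (p1 + p2)) ((1/2) *\<^sub>R (q1 - q2))) (joinv (q1 + q2) (p2 - p1))"
      unfolding w by (simp add: vec_eq_iff split_sum_all field_simps)
    then show ?thesis unfolding w cov_matrix_mult_joinv by simp
  qed
  ultimately show ?thesis by simp
qed

subsection \<open>Tensor products\<close>

text \<open>Conjugating the second factor reverses its modulation, hence the sign of
  \<open>q2\<close> in all formulas for shifted pairs.\<close>

lemma rho_tensor_conj:
  "rho (joinv (joinv p1 p2) (joinv q1 q2)) (tensor_conj f g)
    = tensor_conj (rho (joinv p1 q1) f) (rho (joinv p2 (- q2)) g)"
proof (rule ext)
  fix z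
  have "- (p1 \<bullet> q1 + p2 \<bullet> q2) / 2 + (q1 \<bullet> fstv z + q2 \<bullet> sndv z)
      = (- (p1 \<bullet> q1) / 2 + q1 \<bullet> fstv z) + (- (- (p2 \<bullet> (- q2)) / 2) + - ((- q2) \<bullet> sndv z))"
    by (simp add: field_simps)
  then have "unit_char (- (p1 \<bullet> q1 + p2 \<bullet> q2) / 2) * unit_char (q1 \<bullet> fstv z + q2 \<bullet> sndv z)
      = (unit_char (- (p1 \<bullet> q1) / 2) * unit_char (q1 \<bullet> fstv z))
        * (cnj (unit_char (- (p2 \<bullet> (- q2)) / 2)) * cnj (unit_char ((- q2) \<bullet> sndv z)))"
    unfolding cnj_unit_char unit_char_add[symmetric] by (rule arg_cong)
  then show "rho (joinv (joinv p1 p2) (joinv q1 q2)) (tensor_conj f g) z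
      = tensor_conj (rho (joinv p1 q1) f) (rho (joinv p2 (- q2)) g) z"
    unfolding rho_unit_char tensor_conj_def fstv_joinv sndv_joinv inner_joinv inner_sumv[of _ z]
      complex_cnj_mult fstv_simps sndv_simps
    by (simp only: mult_ac)
qed

lemma L2_tensor_conj:
  assumes f: "L2 f" and g: "L2 g"
  shows "L2 (tensor_conj f g)"
proof -
  note [measurable] = L2_measurable[OF f] L2_measurable[OF g]
  have "integrable lborel (\<lambda>z. (cmod (f (fstv z)))\<^sup>2 * (cmod (g (sndv z)))\<^sup>2)"
    by (rule integrable_tensor[of "\<lambda>x. (cmod (f x))\<^sup>2" "\<lambda>x. (cmod (g x))\<^sup>2"]) (use f g in \<open>auto simp: L2_def\<close>)
  then show ?thesis
    unfolding L2_def tensor_conj_def by (simp add: norm_mult power_mult_distrib)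
qed

lemma L2_inner_tensor_conj:
  assumes f: "L2 f" and g: "L2 g" and f': "L2 f'" and g': "L2 g'"
  shows "L2_inner (tensor_conj f g) (tensor_conj f' g') = L2_inner f f' * cnj (L2_inner g g')"
proof -
  let ?k = "\<lambda>x. f x * cnj (f' x)" and ?l = "\<lambda>y. cnj (g y * cnj (g' y))"
  have i: "integrable lborel (\<lambda>z. ?k (fstv z) * ?l (sndv z))"
    by (rule integrable_tensor[OF L2_integrable_mult[OF f f'] integrable_cnj[OF L2_integrable_mult[OF g g']]])
  have "L2_inner (tensor_conj f g) (tensor_conj f' g') = (\<integral>z. ?k (fstv z) * ?l (sndv z) \<partial>lborel)"
    unfolding L2_inner_def tensor_conj_def by (simp add: mult_ac)
  also have "\<dots> = (\<integral>x. ?k x \<partial>lborel) * (\<integral>y. ?l y \<partial>lborel)"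
    unfolding integral_joinv(1)[OF i] by simp
  finally show ?thesis
    unfolding L2_inner_def Bochner_Integration.integral_cnj[symmetric] .
qed

lemma chirp_op_L2_inner:
  assumes f: "nice f" and g: "nice g" and f': "nice f'" and g': "nice g'"
    and i: "integrable lborel (amb f g)" and i': "integrable lborel (amb f' g')"
  shows "L2_inner (chirp_op B f g) (chirp_op B f' g') = L2_inner (tensor_conj f g) (tensor_conj f' g')"
proof -
  have "(\<integral>y. cnj (g y) * g' y \<partial>lborel) = cnj (L2_inner g g')"
    unfolding L2_inner_def Bochner_Integration.integral_cnj[symmetric] by simp
  then show ?thesis
    using chirp_op_inner[OF assms, of B]
    by (simp add: L2_inner_tensor_conj nice_L2 f g f' g') (simp add: L2_inner_def)
qed

text \<open>The shifted image of T is T applied to a shifted tensor product, so the statement is the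
  isometry property for the shifted pair.\<close>

lemma chirp_op_rho_inner:
  assumes f: "nice f" and g: "nice g" and f': "nice f'" and g': "nice g'"
    and i: "integrable lborel (amb f g)" and i': "integrable lborel (amb f' g')"
    and B: "transpose A13 = A13" "transpose A21 = A21"
  shows "L2_inner (chirp_op (B_cov A11 A13 A21) f g)
      (rho (cov_matrix A11 A13 A21 *v w) (chirp_op (B_cov A11 A13 A21) f' g'))
    = L2_inner (tensor_conj f g) (rho w (tensor_conj f' g'))"
proof -
  define p1 p2 q1 q2 where "p1 = fstv (fstv w)" and "p2 = sndv (fstv w)" and "q1 = fstv (sndv w)" and "q2 = sndv (sndv w)"
  have w: "w = joinv (joinv p1 p2) (joinv q1 q2)"
    by (simp add: p1_def p2_def q1_def q2_def)
  show ?thesis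
    unfolding w cov_matrix_mult_joinv rho_tensor_conj chirp_op_rho[OF f' g' transpose_B_cov[OF B], symmetric]
    by (intro chirp_op_L2_inner f g nice_rho f' g' i integrable_amb_rho i')
qed

lemma schwartz_L2_inner_rho_weight:
  assumes "schwartz f" "schwartz g"
  shows "\<exists>C. \<forall>w. cmod (L2_inner f (rho w g)) \<le> C * (weight (fstv w) * weight (sndv w))"
proof -
  obtain C where "\<And>p q. cmod (fourier (sesq 0 1 (-1) 1 f g p) q) \<le> C * (weight p * weight q)"
    using fourier_sesq_weight[OF assms unimodular_coeffs_simps(3)] by blast
  moreover have "sesq 0 1 (-1) 1 f g p = (\<lambda>t. f t * cnj (g (t - p)))" for p
    by (simp add: sesq_def[abs_def])
  ultimately show ?thesis
    unfolding L2_inner_rho by (intro exI[of _ C]) (simp add: norm_mult)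
qed

text \<open>The coefficient factors into one in (p1, q1) and one in (p2, -q2), each dominated by
  weights. Since weights are even, the reversed sign is harmless.\<close>

lemma integrable_L2_inner_rho_tensor_conj:
  fixes f g :: "real^'d::finite \<Rightarrow> complex"
  assumes f: "schwartz f" and g: "schwartz g" and f': "schwartz f'" and g': "schwartz g'"
  shows "integrable lborel (\<lambda>w. L2_inner (tensor_conj f g) (rho w (tensor_conj f' g')))"
proof -
  note n = schwartz_nice[OF f] schwartz_nice[OF g] schwartz_nice[OF f'] schwartz_nice[OF g']
  note l = n[THEN nice_L2]
  obtain C where C: "\<And>w. cmod (L2_inner f (rho w f')) \<le> C * (weight (fstv w) * weight (sndv w))"
    using schwartz_L2_inner_rho_weight[OF f f'] by blast
  obtain D where D: "\<And>w. cmod (L2_inner g (rho w g')) \<le> D * (weight (fstv w) * weight (sndv w))"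
    using schwartz_L2_inner_rho_weight[OF g g'] by blast
  let ?W = "\<lambda>z :: real^('d + 'd). weight (fstv z) * weight (sndv z)"
  have W: "0 \<le> ?W z" for z by simp
  have C0: "0 \<le> C * ?W z" for z
    using order_trans[OF norm_ge_zero C[of z]] .
  have bound: "cmod (L2_inner (tensor_conj f g) (rho w (tensor_conj f' g')))
      \<le> (C * D) * (?W (fstv w) * ?W (sndv w))" for w :: "real^(('d + 'd) + ('d + 'd))"
  proof -
    define p1 p2 q1 q2 where "p1 = fstv (fstv w)" and "p2 = sndv (fstv w)" and "q1 = fstv (sndv w)" and "q2 = sndv (sndv w)"
    have w: "w = joinv (joinv p1 p2) (joinv q1 q2)"
      by (simp add: p1_def p2_def q1_def q2_def)
    have "cmod (L2_inner (tensor_conj f g) (rho w (tensor_conj f' g')))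
        = cmod (L2_inner f (rho (joinv p1 q1) f')) * cmod (L2_inner g (rho (joinv p2 (- q2)) g'))"
      unfolding w rho_tensor_conj by (simp add: L2_inner_tensor_conj L2_rho l norm_mult)
    also have "\<dots> \<le> (C * ?W (joinv p1 q1)) * (D * ?W (joinv p2 (- q2)))"
      by (intro mult_mono C D C0 norm_ge_zero)
    also have "\<dots> = (C * D) * (?W (fstv w) * ?W (sndv w))"
      unfolding w by (simp add: mult_ac)
    finally show ?thesis .
  qed
  show ?thesis
  proof (rule Bochner_Integration.integrable_bound)
    show "integrable lborel (\<lambda>w :: real^(('d + 'd) + ('d + 'd)). (C * D) * (?W (fstv w) * ?W (sndv w)))"
      by (intro integrable_mult_right integrable_tensor[of ?W ?W] integrable_weight_joinv)
    show "(\<lambda>w. L2_inner (tensor_conj f g) (rho w (tensor_conj f' g'))) \<in> borel_measurable lborel"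
      using measurable_L2_inner_rho[OF L2_measurable[OF L2_tensor_conj[OF l(1,2)]] L2_measurable[OF L2_tensor_conj[OF l(3,4)]]]
      by simp
    show "AE w in lborel. cmod (L2_inner (tensor_conj f g) (rho w (tensor_conj f' g')))
      \<le> norm ((C * D) * (?W (fstv w) * ?W (sndv w)))"
      unfolding real_norm_def by (intro AE_I2 order_trans[OF bound abs_ge_self])
  qed
qed

lemma continuous_bounded_tensor_conj:
  assumes f: "nice f" and g: "nice g"
  shows "continuous_on UNIV (tensor_conj f g)" and "\<exists>C. \<forall>z. cmod (tensor_conj f g z) \<le> C"
proof -
  show "continuous_on UNIV (tensor_conj f g)"
    unfolding tensor_conj_def
    by (intro continuous_intros continuous_on_compose2[OF nice_continuous[OF f, of UNIV]]
        continuous_on_compose2[OF nice_continuous[OF g, of UNIV]]) auto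
  obtain C D where C: "\<And>x. cmod (f x) \<le> C" and D: "\<And>x. cmod (g x) \<le> D"
    using nice_bounded[OF f] nice_bounded[OF g] by blast
  have "0 \<le> C" using order_trans[OF norm_ge_zero C[of 0]] .
  then have "cmod (tensor_conj f g z) \<le> C * D" for z
    unfolding tensor_conj_def norm_mult complex_mod_cnj using C D by (intro mult_mono) auto
  then show "\<exists>C. \<forall>z. cmod (tensor_conj f g z) \<le> C" by blast
qed

subsection \<open>Metaplectic operators\<close>

text \<open>Polarisation: expanding the preserved norm of F + cG for c = 1 and c = i gives the real
  and imaginary parts. Linearity of \<open>U\<close> holds almost everywhere, which suffices under
  the integral.\<close>

lemma metaplectic_op_L2_inner:
  assumes U: "metaplectic_op A U" and F: "L2 F" and G: "L2 G"
  shows "L2_inner (U F) (U G) = L2_inner F G"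
proof -
  have L: "L2 (U F)" if "L2 F" for F
    using U that by (simp add: metaplectic_op_def)
  have N: "(\<integral>x. (cmod (U F x))\<^sup>2 \<partial>lborel) = (\<integral>x. (cmod (F x))\<^sup>2 \<partial>lborel)" if "L2 F" for F
    using U that by (simp add: metaplectic_op_def)
  have re: "Re (cnj c * L2_inner (U F) (U G)) = Re (cnj c * L2_inner F G)" for c
  proof -
    note FG = L2_add_mult[OF F G, of c] and UFG = L2_add_mult[OF L[OF F] L[OF G], of c]
    have "AE x in lborel. U (\<lambda>y. F y + c * G y) x = U F x + c * U G x"
      using U F G by (simp add: metaplectic_op_def)
    then have "(\<integral>x. (cmod (U (\<lambda>y. F y + c * G y) x))\<^sup>2 \<partial>lborel) = (\<integral>x. (cmod (U F x + c * U G x))\<^sup>2 \<partial>lborel)"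
      using L2_measurable[OF L[OF FG(1)]] L2_measurable[OF UFG(1)] by (intro integral_cong_AE) auto
    then show ?thesis
      using N[OF FG(1)] FG(2) UFG(2) N[OF F] N[OF G] by simp
  qed
  show ?thesis
    using re[of 1] re[of \<i>] by (simp add: complex_eq_iff)
qed

lemma metaplectic_op_L2_inner_rho:
  assumes U: "metaplectic_op A U" and F: "L2 F" and G: "L2 G"
  shows "L2_inner (U F) (rho (A *v w) (U G)) = L2_inner F (rho w G)"
proof -
  have L: "L2 (U F)" if "L2 F" for F
    using U that by (simp add: metaplectic_op_def)
  note [measurable] = L2_measurable[OF L[OF F]] L2_measurable[OF L2_rho[OF L[OF G]], of "A *v w"]
    L2_measurable[OF L[OF L2_rho[OF G]], of w]
  have "AE x in lborel. U (rho w G) x = rho (A *v w) (U G) x"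
    using U G by (simp add: metaplectic_op_def)
  then have "L2_inner (U F) (rho (A *v w) (U G)) = L2_inner (U F) (U (rho w G))"
    unfolding L2_inner_def by (intro integral_cong_AE) auto
  then show ?thesis
    by (simp add: metaplectic_op_L2_inner[OF U F L2_rho[OF G]])
qed

lemma metaplectic_op_chirp_op_product:
  fixes f g f' g' :: "real^'d::finite \<Rightarrow> complex"
  assumes U: "metaplectic_op (cov_matrix A11 A13 A21) U"
    and B: "transpose A13 = A13" "transpose A21 = A21"
    and f: "schwartz f" and g: "schwartz g" and f': "schwartz f'" and g': "schwartz g'"
  shows "L2_inner (U (tensor_conj f g)) (chirp_op (B_cov A11 A13 A21) f g)
      * cnj (L2_inner (U (tensor_conj f' g')) (chirp_op (B_cov A11 A13 A21) f' g'))
    = L2_inner (tensor_conj f g) (tensor_conj f g) * cnj (L2_inner (tensor_conj f' g') (tensor_conj f' g'))"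
proof -
  let ?F = "tensor_conj f g" and ?G = "tensor_conj f' g'"
  let ?S = "chirp_op (B_cov A11 A13 A21) f g" and ?T = "chirp_op (B_cov A11 A13 A21) f' g'"
  note n = schwartz_nice[OF f] schwartz_nice[OF g] schwartz_nice[OF f'] schwartz_nice[OF g']
  note ST = n(1,2) integrable_amb[OF f g] n(3,4) integrable_amb[OF f' g']
  have FG: "L2 ?F" "L2 ?G"
    by (intro L2_tensor_conj nice_L2 n)+
  then have U_FG: "L2 (U ?F)" "L2 (U ?G)"
    using U by (simp_all add: metaplectic_op_def)
  have L_ST: "L2 ?S" "L2 ?T"
    by (intro L2_chirp_op ST)+
  note A = lborel_preserving_cov_matrix[of A11 A13 A21]
  note mU = measurable_L2_inner_rho[OF U_FG[THEN L2_measurable]]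
    and mT = measurable_L2_inner_rho[OF L_ST[THEN L2_measurable]]
  note i = integrable_L2_inner_rho_tensor_conj[OF f g f' g']
  have T: "L2_inner ?S (rho (cov_matrix A11 A13 A21 *v w) ?T) = L2_inner ?F (rho w ?G)" for w
    by (intro chirp_op_rho_inner n integrable_amb f g f' g' B)
  \<comment> \<open>Integrability is not estimated for T directly: precomposition with the
    volume-preserving matrix turns these coefficients into those of Schwartz tensor
    products.\<close>
  have iT: "integrable lborel (\<lambda>w. L2_inner ?S (rho w ?T))"
    using lborel_preserving_integrable_iff[OF A mT] i by (simp add: T)
  have "L2_inner (U ?F) ?S * cnj (L2_inner (U ?G) ?T)
      = (\<integral>w. L2_inner (U ?F) (rho w (U ?G)) * cnj (L2_inner ?S (rho w ?T)) \<partial>lborel)"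
    by (rule moyal[symmetric]) (intro U_FG L_ST iT continuous_on_chirp_op bounded_chirp_op ST)+
  also have "\<dots> = (\<integral>w. L2_inner (U ?F) (rho (cov_matrix A11 A13 A21 *v w) (U ?G))
      * cnj (L2_inner ?S (rho (cov_matrix A11 A13 A21 *v w) ?T)) \<partial>lborel)"
    by (rule lborel_preserving_integral[OF A, symmetric]) (use mU mT in measurable)
  also have "\<dots> = (\<integral>w. L2_inner ?F (rho w ?G) * cnj (L2_inner ?F (rho w ?G)) \<partial>lborel)"
    by (simp only: T metaplectic_op_L2_inner_rho[OF U FG])
  also have "\<dots> = L2_inner ?F ?F * cnj (L2_inner ?G ?G)"
    by (rule moyal) (intro FG i continuous_bounded_tensor_conj n)+
  finally show ?thesis .
qed

text \<open>The squared norm of F - cG expands to N + N - 2N = 0.\<close>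

lemma L2_proportional:
  assumes F: "L2 F" and G: "L2 G" and c: "cmod c = 1" and N: "L2_inner F F = N" "L2_inner G G = N"
    and FG: "L2_inner F G = c * N"
  shows "AE x in lborel. F x = c * G x"
proof -
  let ?N = "\<integral>x. (cmod (F x))\<^sup>2 \<partial>lborel"
  have N': "N = complex_of_real ?N" "(\<integral>x. (cmod (G x))\<^sup>2 \<partial>lborel) = ?N"
    using N unfolding L2_inner_self by (simp, metis of_real_eq_iff)
  have "cnj c * (c * N) = N"
    using c by (simp add: mult.assoc[symmetric] mult.commute[of "cnj c"] complex_norm_square[symmetric])
  then have "cnj (- c) * L2_inner F G = - N" by (simp add: FG)
  then have "(\<integral>x. (cmod (F x + - c * G x))\<^sup>2 \<partial>lborel) = 0"
    unfolding L2_add_mult(2)[OF F G] N'(2) using c by (simp add: N'(1))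
  moreover have "integrable lborel (\<lambda>x. (cmod (F x + - c * G x))\<^sup>2)"
    using L2_add_mult(1)[OF F G, of "- c"] unfolding L2_def by blast
  ultimately have "AE x in lborel. (cmod (F x + - c * G x))\<^sup>2 = 0"
    by (subst (asm) integral_nonneg_eq_0_iff_AE) auto
  then show ?thesis by (auto elim!: eventually_mono)
qed

section \<open>The constant phase and equality in Cauchy-Schwarz\<close>

theorem mainTheorem5:
  fixes A11 A13 A21 :: "real^'d::finite^'d"
    and A :: "real^(('d + 'd) + ('d + 'd))^(('d + 'd) + ('d + 'd))"
    and U :: "(real^('d + 'd) \<Rightarrow> complex) \<Rightarrow> (real^('d + 'd) \<Rightarrow> complex)"
  assumes "symplectic A"
    and "transpose A13 = A13" and "transpose A21 = A21"
    and "A = cov_matrix A11 A13 A21"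
    and "metaplectic_op A U"
  shows "\<exists>c::complex. cmod c = 1 \<and>
           (\<forall>f g :: real^'d \<Rightarrow> complex. schwartz f \<longrightarrow> schwartz g \<longrightarrow>
              (AE z in lborel. U (tensor_conj f g) z
                  = c * conv_distr (wigner f g) (sigma_cov A11 A13 A21) z))"
proof -
  let ?B = "B_cov A11 A13 A21"
  let ?F = "\<lambda>f g. tensor_conj f g :: real^('d + 'd) \<Rightarrow> complex"
  let ?N = "\<lambda>f g. L2_inner (?F f g) (?F f g)" and ?a = "\<lambda>f g. L2_inner (U (?F f g)) (chirp_op ?B f g)"
  have U: "metaplectic_op (cov_matrix A11 A13 A21) U" using assms by simp
  note product = metaplectic_op_chirp_op_product[OF U assms(2,3)]
  have L: "L2 (?F f g)" "L2 (U (?F f g))" "L2 (chirp_op ?B f g)"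
      "L2_inner (U (?F f g)) (U (?F f g)) = ?N f g" "L2_inner (chirp_op ?B f g) (chirp_op ?B f g) = ?N f g"
    if "schwartz f" "schwartz g" for f g
  proof -
    show "L2 (?F f g)" by (intro L2_tensor_conj nice_L2 schwartz_nice that)
    then show "L2 (U (?F f g))" "L2_inner (U (?F f g)) (U (?F f g)) = ?N f g"
      using U metaplectic_op_L2_inner[OF U] by (auto simp: metaplectic_op_def)
    show "L2 (chirp_op ?B f g)" "L2_inner (chirp_op ?B f g) (chirp_op ?B f g) = ?N f g"
      by (intro L2_chirp_op chirp_op_L2_inner schwartz_nice integrable_amb that)+
  qed
  have "\<exists>c. cmod c = 1 \<and> (\<forall>f g. schwartz f \<longrightarrow> schwartz g \<longrightarrow> ?a f g = c * ?N f g)"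
  \<comment> \<open>A pair of nonzero norm serves as reference for reading off the constant. Were
    there none, both sides would vanish for all pairs and c = 1 would do; the case distinction
    replaces the construction of a nonzero Schwartz function.\<close>
  proof (cases "\<exists>f g. schwartz f \<and> schwartz g \<and> ?N f g \<noteq> 0")
    case True
    then obtain f0 g0 where 0: "schwartz f0" "schwartz g0" "?N f0 g0 \<noteq> 0" by blast
    define N0 where "N0 = ?N f0 g0"
    have N0: "N0 \<noteq> 0" "cnj N0 = N0"
      using 0 by (auto simp: N0_def L2_inner_self)
    define c where "c = ?a f0 g0 / N0"
    have "?a f0 g0 * cnj (?a f0 g0) = N0 * N0"
      using product[OF 0(1,2) 0(1,2)] N0 by (simp add: N0_def)
    then have cc: "c * cnj c = 1" using N0 by (simp add: c_def)
    then have "(cmod c)\<^sup>2 = 1"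
      by (metis complex_norm_square of_real_eq_1_iff)
    then have "cmod c = 1" by (simp add: power2_eq_1_iff) (smt (verit) norm_ge_zero)
    moreover have "?a f g = c * ?N f g" if fg: "schwartz f" "schwartz g" for f g
    proof -
      \<comment> \<open>The product formula against the reference pair, divided by the real number
        \<open>N0\<close>.\<close>
      have N: "?a f g * cnj c = ?N f g"
        using product[OF fg 0(1,2)] N0 by (simp add: c_def N0_def)
      have "c * ?N f g = ?a f g * (c * cnj c)" unfolding N[symmetric] by (simp only: mult_ac)
      then show ?thesis unfolding cc by simp
    qed
    ultimately show ?thesis by blast
  next
    case False
    have "?a f g = 1 * ?N f g" if fg: "schwartz f" "schwartz g" for f g
    proof -
      have "?N f g = 0" using False fg by blast
      \<comment> \<open>Both vectors have norm 0, so \<open>norm_L2_inner_le\<close> makes their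
        inner product vanish as well.\<close>
      then show ?thesis
        using norm_L2_inner_le[OF L(2,3)[OF fg]] L(4,5)[OF fg] by (simp add: L2_inner_self)
    qed
    then show ?thesis by (intro exI[of _ 1]) simp
  qed
  then obtain c where c: "cmod c = 1" "\<And>f g. schwartz f \<Longrightarrow> schwartz g \<Longrightarrow> ?a f g = c * ?N f g"
    by blast
  show ?thesis
  proof (intro exI[of _ c] conjI allI impI c(1))
    fix f g :: "real^'d \<Rightarrow> complex" assume fg: "schwartz f" "schwartz g"
    show "AE z in lborel. U (tensor_conj f g) z = c * conv_distr (wigner f g) (sigma_cov A11 A13 A21) z"
      unfolding conv_distr_wigner[OF fg]
      by (rule L2_proportional[OF L(2,3)[OF fg] c(1) L(4,5)[OF fg] c(2)[OF fg]])
  qed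
qed

end
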